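(* Let $K$ be a field, let $f\in K[x,x^{-1}]$ be a Laurent polynomial, and assume that neither $x=0$ nor $x=\infty$ is a pole of $f$ of order divisible by $\mathrm{char}(K)$. Write $f=a_1\circ\dots\circ a_r=b_1\circ\dots\circ b_s$ where $a_i,b_j\in K(x)$ are indecomposable and have degree more than $1$. Then $r=s$, and the sequence $(\deg(a_1),\dots,\deg(a_r))$ is a permutation of $(\deg(b_1),\dots,\deg(b_s))$.
   Context: The degree of a nonconstant rational function $p/q\in K(x)$ with $p,q\in K[x]$ coprime is $\max(\deg p,\deg q)$. A rational function in $K(x)$ of degree greater than $1$ is indecomposable if it cannot be written as $u\circ v$ with $u,v\in K(x)$ both of degree greater than $1$. When $\mathrm{char}(K)=0$ the assumption on pole orders is automatically satisfied (no positive integer is divisible by $0$). *)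

theory Defs
  imports "HOL-Computational_Algebra.Computational_Algebra"
begin

text \<open>
  The field \<open>K(x)\<close> is the type \<open>'a poly fract\<close> for an arbitrary \<open>'a :: field\<close>.
  The library's \<open>quot_of_fract\<close> needs a normalisation operation on \<open>'a\<close> that is not available in
  class \<open>field\<close>, so the reduced fraction is normalised here by making the denominator monic.
\<close>

type_synonym 'a ratfun = "'a poly fract"

lemma coprime_representation_exists:
  fixes p q :: "'a::field poly"
  assumes "q \<noteq> 0"
  shows "\<exists>p' q'. Fract p q = Fract p' q' \<and> coprime p' q' \<and> lead_coeff q' = 1"
  using assms
proof (induction "degree q" arbitrary: p q rule: less_induct)
  case less
  show ?case
  proof (cases "coprime p q")
    case True
    define c where "c = inverse (lead_coeff q)"
    have c: "c \<noteq> 0" using less.prems by (simp add: c_def)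
    have "Fract p q = Fract (smult c p) (smult c q)"
      using less.prems c by (subst eq_fract) auto
    moreover have "coprime (smult c p) (smult c q)"
      using True c by (auto simp: coprime_def dvd_smult_iff)
    moreover have "lead_coeff (smult c q) = 1"
      using less.prems by (simp add: c_def)
    ultimately show ?thesis by blast
  next
    case False
    then obtain d where d: "d dvd p" "d dvd q" "\<not> is_unit d"
      by (auto simp: coprime_def)
    obtain p1 q1 where pq: "p = d * p1" "q = d * q1"
      using d by (auto elim!: dvdE)
    have nz: "d \<noteq> 0" "q1 \<noteq> 0" using pq less.prems by auto
    have "degree d \<noteq> 0"
      using d(3) nz(1) is_unit_iff_degree by blast
    hence "degree q1 < degree q"
      using nz by (simp add: pq degree_mult_eq)
    from less.hyps[OF this nz(2), of p1] show ?thesis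
      using nz by (simp add: pq mult_fract_cancel)
  qed
qed

lemma coprime_bezout:
  fixes p q :: "'a::field poly"
  assumes "coprime p q"
  shows "\<exists>a b. a * p + b * q = 1"
  using assms
proof (induction "euclidean_size q" arbitrary: p q rule: less_induct)
  case less
  show ?case
  proof (cases "q = 0")
    case True
    with less.prems have "is_unit p" by (simp add: coprime_def)
    then obtain a where "1 = p * a" by (auto elim: dvdE)
    thus ?thesis using True by (intro exI[of _ a]) (simp add: mult.commute)
  next
    case False
    have "coprime q (p mod q)"
    proof (rule coprimeI)
      fix d assume "d dvd q" "d dvd p mod q"
      hence "d dvd p" by (simp add: dvd_mod_iff)
      with \<open>d dvd q\<close> less.prems show "is_unit d" by (auto simp: coprime_def)
    qed
    then obtain a b where ab: "a * q + b * (p mod q) = 1"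
      using less.hyps[OF mod_size_less[OF False]] by blast
    have "b * p + (a - b * (p div q)) * q = a * q + b * (p - p div q * q)"
      by (simp add: algebra_simps)
    also have "\<dots> = 1" using ab by (simp add: minus_div_mult_eq_mod)
    finally show ?thesis by blast
  qed
qed

lemma coprime_dvd_cancel:
  fixes p q r :: "'a::field poly"
  assumes "coprime p q" "q dvd p * r"
  shows "q dvd r"
proof -
  obtain a b where ab: "a * p + b * q = 1" using coprime_bezout[OF assms(1)] by blast
  have "r = (a * p + b * q) * r" using ab by simp
  also have "\<dots> = a * (p * r) + (b * r) * q" by (simp only: algebra_simps)
  finally show ?thesis using assms(2) by (metis dvd_add dvd_mult dvd_triv_right)
qed

lemma coprime_representation_unique:
  fixes p q p' q' :: "'a::field poly"
  assumes "Fract p q = Fract p' q'" "coprime p q" "coprime p' q'"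
    and "lead_coeff q = 1" "lead_coeff q' = 1"
  shows "p = p' \<and> q = q'"
proof -
  have nz: "q \<noteq> 0" "q' \<noteq> 0" using assms(4,5) by auto
  have eq: "p * q' = p' * q" using assms(1) nz by (simp add: eq_fract)
  have "q dvd q'"
    using assms(2) eq by (intro coprime_dvd_cancel[of p q q']) auto
  moreover have "q' dvd q"
    using assms(3) eq[symmetric] by (intro coprime_dvd_cancel[of p' q' q]) auto
  ultimately have "degree q' = degree q"
    using nz by (simp add: dvd_imp_degree_le order_antisym)
  moreover obtain k where k: "q' = q * k" using \<open>q dvd q'\<close> by (auto elim: dvdE)
  ultimately have "degree k = 0" using nz by (auto simp: degree_mult_eq)
  then obtain c where "k = [:c:]" by (auto elim: degree_eq_zeroE)
  moreover have "lead_coeff k = 1" using k assms(4,5) by (simp add: lead_coeff_mult)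
  ultimately have "q = q'" using k by simp
  with eq nz show ?thesis by simp
qed

lemma monic_representation_ex1:
  fixes f :: "'a::field ratfun"
  shows "\<exists>!(p, q). f = Fract p q \<and> coprime p q \<and> lead_coeff q = 1"
proof -
  obtain p q where "f = Fract p q" "q \<noteq> 0" by (cases f)
  then obtain p' q' where "f = Fract p' q'" "coprime p' q'" "lead_coeff q' = 1"
    using coprime_representation_exists by blast
  thus ?thesis
    by (intro ex1I[of _ "(p', q')"]) (use coprime_representation_unique in fastforce)+
qed

definition num_denom :: "'a::field ratfun \<Rightarrow> 'a poly \<times> 'a poly" where
  "num_denom f = (THE (p, q). f = Fract p q \<and> coprime p q \<and> lead_coeff q = 1)"

definition numer :: "'a::field ratfun \<Rightarrow> 'a poly" where
  "numer f = fst (num_denom f)"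

definition denom :: "'a::field ratfun \<Rightarrow> 'a poly" where
  "denom f = snd (num_denom f)"

lemma numer_denom:
  fixes f :: "'a::field ratfun"
  shows "f = Fract (numer f) (denom f)" "coprime (numer f) (denom f)" "lead_coeff (denom f) = 1"
  using theI'[OF monic_representation_ex1[of f]]
  unfolding numer_def denom_def num_denom_def by (auto simp: case_prod_unfold)

lemma denom_nonzero: "denom f \<noteq> 0"
  using numer_denom(3)[of f] by auto

lemma numer_denom_eqI:
  fixes p q :: "'a::field poly"
  assumes "coprime p q" "lead_coeff q = 1"
  shows "numer (Fract p q) = p" "denom (Fract p q) = q"
  using coprime_representation_unique[OF numer_denom(1)[of "Fract p q"]] numer_denom[of "Fract p q"] assms
  by metis+

text \<open>Constants get degree \<open>0\<close>.\<close>

definition ratfun_degree :: "'a::field ratfun \<Rightarrow> nat" where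
  "ratfun_degree f = max (degree (numer f)) (degree (denom f))"

definition ratfun_const :: "'a::field \<Rightarrow> 'a ratfun" where
  "ratfun_const c = to_fract [:c:]"

definition ratfun_X :: "'a::field ratfun" where
  "ratfun_X = to_fract [:0, 1:]"

text \<open>
  \<open>u \<circ> v = u(v)\<close>, obtained by substituting \<open>v\<close> into numerator and denominator of \<open>u\<close>.
  The denominator can only vanish after substitution if \<open>v\<close> is a constant that is a pole of \<open>u\<close>,
  in which case the value is the dummy \<open>0\<close>.
\<close>

definition ratfun_compose :: "'a::field ratfun \<Rightarrow> 'a ratfun \<Rightarrow> 'a ratfun" (infixl "\<circ>\<^sub>r" 55) where
  "u \<circ>\<^sub>r v = poly (map_poly ratfun_const (numer u)) v / poly (map_poly ratfun_const (denom u)) v"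

text \<open>\<open>a\<^sub>1 \<circ> (a\<^sub>2 \<circ> (\<dots> \<circ> a\<^sub>r))\<close>; the empty composition is the identity \<open>x\<close>.\<close>

definition ratfun_compose_list :: "'a::field ratfun list \<Rightarrow> 'a ratfun" where
  "ratfun_compose_list as = foldr (\<circ>\<^sub>r) as ratfun_X"

lemma poly_map_poly_ratfun_const_X:
  "poly (map_poly ratfun_const p) ratfun_X = to_fract (p :: 'a::field poly)"
proof (induction p)
  case (pCons a p)
  have "poly (map_poly ratfun_const (pCons a p)) ratfun_X =
      ratfun_const a + ratfun_X * poly (map_poly ratfun_const p) (ratfun_X :: 'a ratfun)"
    by (subst map_poly_pCons) (simp_all add: ratfun_const_def)
  also have "\<dots> = to_fract ([:a:] + [:0, 1:] * p)"
    unfolding pCons.IH by (simp only: to_fract_add to_fract_mult ratfun_const_def ratfun_X_def)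
  also have "[:a:] + [:0, 1:] * p = pCons a p" by simp
  finally show ?case .
qed simp

lemma ratfun_compose_X: "u \<circ>\<^sub>r ratfun_X = u"
  using numer_denom(1)[of u] denom_nonzero[of u]
  by (simp add: ratfun_compose_def poly_map_poly_ratfun_const_X to_fract_def)

lemma ratfun_compose_list_single: "ratfun_compose_list [a] = a"
  by (simp add: ratfun_compose_list_def ratfun_compose_X)

definition indecomposable :: "'a::field ratfun \<Rightarrow> bool" where
  "indecomposable f \<longleftrightarrow> ratfun_degree f > 1 \<and>
     \<not> (\<exists>u v. ratfun_degree u > 1 \<and> ratfun_degree v > 1 \<and> f = u \<circ>\<^sub>r v)"

definition laurent_polynomial :: "'a::field ratfun \<Rightarrow> bool" where
  "laurent_polynomial f \<longleftrightarrow> (\<exists>p n. f = Fract p (monom 1 n))"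

text \<open>
  Pole orders at \<open>x = 0\<close> and \<open>x = \<infinity>\<close>; both are \<open>0\<close> exactly when the point is not a pole
  (the subtraction on \<open>nat\<close> truncates).
\<close>

definition pole_order_zero :: "'a::field ratfun \<Rightarrow> nat" where
  "pole_order_zero f = order 0 (denom f)"

definition pole_order_infinity :: "'a::field ratfun \<Rightarrow> nat" where
  "pole_order_infinity f = degree (numer f) - degree (denom f)"

end

theory Submission
  imports Defs
begin

text \<open>A decomposition \<open>f = a \<circ> u\<close> corresponds to a field \<open>K(f) \<subseteq> K(u) \<subseteq> K(x)\<close>, so the theorem is a
Jordan--Hoelder statement for the maximal chains of such fields. By induction on the degree it suffices
to compare the last factors in \<open>f = a \<circ> u = b \<circ> v\<close>, with \<open>u\<close>, \<open>v\<close> indecomposable and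
\<open>K(u) \<noteq> K(v)\<close>. Suppose that \<open>s \<circ> u = t \<circ> v\<close> for some nonconstant \<open>s\<close> with \<open>deg s \<le> deg v\<close>. As
\<open>K(u, v) = K(x)\<close> by Lueroth's theorem (\<open>lueroth\<close>), degrees over \<open>K(u)\<close> and \<open>K(v)\<close> cannot be smaller
(\<open>indecomposable_relation_degree\<close>). It follows that \<open>s\<close>, \<open>t\<close> are indecomposable of degrees \<open>deg v\<close>,
\<open>deg u\<close> and that \<open>a = c \<circ> s\<close>, \<open>b = c \<circ> t\<close>; a decomposition of \<open>c\<close> then links the two given ones
(\<open>unique_degrees_step\<close>). All this holds for arbitrary rational functions.

For a Laurent polynomial \<open>f\<close>, possibly after \<open>x \<mapsto> 1/x\<close>, infinity is a pole of order \<open>n\<close> prime to the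
characteristic. Up to fractional linear changes, \<open>f = a \<circ> u\<close> has one of two shapes: \<open>a\<close> is a polynomial
and \<open>u\<close> a Laurent polynomial, or \<open>u = x\<^sup>q\<close> and \<open>a\<close> is a Laurent polynomial
(\<open>laurent_factor_normal_form\<close>). The common multiples \<open>s \<circ> u = t \<circ> v\<close> come from approximate roots: if
\<open>deg a = k r\<close>, some \<open>C\<close> of degree \<open>r\<close> satisfies \<open>deg (a - C\<^sup>k) < (k - 1) r\<close>
(\<open>approximate_root\<close>). As \<open>k\<close> is invertible in \<open>K\<close>, the terms of nonnegative order of \<open>C(u)\<close> at a pole are
determined by \<open>f\<close> and the leading coefficient (\<open>leads_power_diff_cancel\<close>), and a Laurent polynomial is
determined by such terms at both ends.

If \<open>v = x\<^sup>q\<close>, this shows that \<open>C(u)\<close> is a function of \<open>x\<^sup>q\<close> for a suitable \<open>C\<close> of degree \<open>q\<close> or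
\<open>1\<close> (\<open>common_multiple_with_power\<close>). If \<open>u\<close> and \<open>v\<close> are both Laurent polynomials, with \<open>a\<close>, \<open>b\<close> of
degrees \<open>d\<^sub>0 e\<close>, \<open>d\<^sub>0 e'\<close> and \<open>e\<close>, \<open>e'\<close> coprime, the approximate roots of degrees \<open>e\<close>, \<open>e'\<close> agree at
infinity, but at zero their leading coefficients may differ by a root of unity. If \<open>l\<close> is its order, those of
degrees \<open>l e\<close>, \<open>l e'\<close> agree everywhere, which is good enough for \<open>l \<le> 2\<close>. For \<open>l \<ge> 3\<close>, ramification
(\<open>generator_order_dvd\<close>) forces \<open>u\<close> and \<open>v\<close> to have poles of orders \<open>e'\<close> and \<open>e\<close> at both ends, and a
comparison of the leading terms at the two ends (locale \<open>two_ended\<close>) leaves only \<open>u = x + c + \<mu>/x\<close> and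
\<open>v = x + d + \<nu>/x\<close>. In this dihedral case \<open>u\<close> and \<open>v\<close> need not have a common multiple of the wanted degree,
but \<open>f\<close> is a function of \<open>x\<^sup>l\<close>, and both decompositions are compared with one that ends in \<open>x\<^sup>q\<close>, \<open>q\<close>
a prime factor of \<open>l\<close>.\<close>

section \<open>Evaluating rational functions\<close>

locale poly_eval =
  fixes h :: "'a::field \<Rightarrow> 'b::field" and y :: 'b
  assumes h_0 [simp]: "h 0 = 0" and h_1 [simp]: "h 1 = 1"
    and h_add: "h (a + b) = h a + h b" and h_mult: "h (a * b) = h a * h b"
begin

definition peval :: "'a poly \<Rightarrow> 'b" where
  "peval p = poly (map_poly h p) y"

lemma peval_0 [simp]: "peval 0 = 0"
  by (simp add: peval_def)

lemma peval_pCons [simp]: "peval (pCons a p) = h a + y * peval p"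
  by (simp add: peval_def map_poly_pCons)

lemma peval_1 [simp]: "peval 1 = 1"
  by (simp add: one_pCons)

lemma peval_add: "peval (p + q) = peval p + peval q"
proof (induction p arbitrary: q)
  case (pCons a p)
  show ?case by (cases q) (simp add: pCons.IH h_add distrib_left)
qed simp

lemma peval_smult: "peval (smult c p) = h c * peval p"
  by (induction p) (auto simp: h_mult algebra_simps)

lemma peval_mult: "peval (p * q) = peval p * peval q"
  by (induction p) (auto simp: peval_add peval_smult algebra_simps)

end

text \<open>Three instances matter: for a nonconstant rational function \<open>y\<close> evaluation is composition with \<open>y\<close>, and for
\<open>y = t\<close> and \<open>y = 1/t\<close> in the field of Laurent series it is expansion at zero and at infinity.\<close>

locale ratfun_eval = poly_eval +
  assumes transcendental: "poly (map_poly h p) y = 0 \<Longrightarrow> p = 0"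
begin

definition eval :: "'a ratfun \<Rightarrow> 'b" where
  "eval f = peval (numer f) / peval (denom f)"

lemma peval_eq_0_iff [simp]: "peval p = 0 \<longleftrightarrow> p = 0"
  using transcendental by (auto simp: peval_def)

lemma eval_Fract: "q \<noteq> 0 \<Longrightarrow> eval (Fract p q) = peval p / peval q"
proof -
  assume q: "q \<noteq> 0"
  have "Fract (numer (Fract p q)) (denom (Fract p q)) = Fract p q"
    using numer_denom(1)[of "Fract p q"] by simp
  hence "numer (Fract p q) * q = p * denom (Fract p q)"
    using eq_fract(1)[OF denom_nonzero q] by blast
  hence "peval (numer (Fract p q)) * peval q = peval p * peval (denom (Fract p q))"
    by (metis peval_mult)
  thus ?thesis
    using q denom_nonzero[of "Fract p q"] by (simp add: eval_def field_simps)
qed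

lemma eval_to_fract: "eval (to_fract p) = peval p"
  by (simp add: to_fract_def eval_Fract)

lemma eval_0 [simp]: "eval 0 = 0"
  using eval_to_fract[of 0] by simp

lemma eval_1 [simp]: "eval 1 = 1"
  using eval_to_fract[of 1] by simp

lemma eval_add: "eval (f + g) = eval f + eval g"
proof (cases f; cases g)
  fix a b c d assume "f = Fract a b" "b \<noteq> 0" "g = Fract c d" "d \<noteq> 0"
  thus ?thesis by (simp add: eval_Fract peval_add peval_mult divide_simps)
qed

lemma eval_mult: "eval (f * g) = eval f * eval g"
proof (cases f; cases g)
  fix a b c d assume "f = Fract a b" "b \<noteq> 0" "g = Fract c d" "d \<noteq> 0"
  thus ?thesis by (simp add: eval_Fract peval_mult)
qed

lemma eval_eq_0_iff [simp]: "eval f = 0 \<longleftrightarrow> f = 0"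
proof (cases f)
  case (Fract a b)
  thus ?thesis by (simp add: eval_Fract eq_fract Zero_fract_def)
qed

lemma eval_minus: "eval (- f) = - eval f"
  using eval_add[of f "- f"] by (simp add: eq_neg_iff_add_eq_0 add.commute)

lemma eval_diff: "eval (f - g) = eval f - eval g"
  using eval_add[of f "- g"] by (simp add: eval_minus)

lemma eval_inj: "eval f = eval g \<longleftrightarrow> f = g"
  using eval_eq_0_iff[of "f - g"] by (simp add: eval_diff)

lemma eval_inverse: "eval (inverse f) = inverse (eval f)"
proof (cases "f = 0")
  case False
  hence "eval (inverse f) * eval f = 1" by (simp flip: eval_mult)
  thus ?thesis by (metis inverse_unique mult.commute)
qed simp

lemma eval_divide: "eval (f / g) = eval f / eval g"
  by (simp add: divide_inverse eval_mult eval_inverse)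

lemma eval_power: "eval (f ^ n) = eval f ^ n"
  by (induction n) (auto simp: eval_mult)

lemma eval_power_int: "eval (f powi n) = eval f powi n"
  by (simp add: power_int_def eval_power eval_inverse)

lemma eval_sum: "eval (\<Sum>i\<in>A. f i) = (\<Sum>i\<in>A. eval (f i))"
  by (induction A rule: infinite_finite_induct) (auto simp: eval_add)

lemma eval_const: "eval (ratfun_const c) = h c"
  by (simp add: ratfun_const_def eval_to_fract)

lemma eval_X: "eval ratfun_X = y"
  by (simp add: ratfun_X_def eval_to_fract)

end

subsection \<open>Constants\<close>

lemma ratfun_const_0 [simp]: "ratfun_const 0 = 0"
  and ratfun_const_1 [simp]: "ratfun_const 1 = 1"
  and ratfun_const_add: "ratfun_const (a + b) = ratfun_const a + ratfun_const b"
  and ratfun_const_mult: "ratfun_const (a * b) = ratfun_const a * ratfun_const b"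
  by (simp_all add: ratfun_const_def flip: one_pCons to_fract_add to_fract_mult)

lemma ratfun_const_eq_iff [simp]: "ratfun_const a = ratfun_const b \<longleftrightarrow> a = b"
  by (simp add: ratfun_const_def)

lemma ratfun_const_eq_0_iff [simp]: "ratfun_const a = 0 \<longleftrightarrow> a = 0"
  by (metis ratfun_const_0 ratfun_const_eq_iff)

lemma ratfun_const_minus: "ratfun_const (- a) = - ratfun_const a"
  using ratfun_const_add[of a "- a"] by (simp add: eq_neg_iff_add_eq_0 add.commute)

lemma ratfun_const_diff: "ratfun_const (a - b) = ratfun_const a - ratfun_const b"
  using ratfun_const_add[of a "- b"] by (simp add: ratfun_const_minus)

lemma ratfun_const_inverse: "ratfun_const (inverse a) = inverse (ratfun_const a)"
proof (cases "a = 0")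
  case False
  hence "ratfun_const a * ratfun_const (inverse a) = 1" by (simp flip: ratfun_const_mult)
  thus ?thesis by (metis inverse_unique)
qed simp

lemma ratfun_const_divide: "ratfun_const (a / b) = ratfun_const a / ratfun_const b"
  by (simp add: divide_inverse ratfun_const_mult ratfun_const_inverse)

lemma ratfun_const_power: "ratfun_const (a ^ n) = ratfun_const a ^ n"
  by (induction n) (auto simp: ratfun_const_mult)

lemma degree_eq_0_iff_const: "ratfun_degree f = 0 \<longleftrightarrow> (\<exists>c. f = ratfun_const c)"
proof
  assume "ratfun_degree f = 0"
  hence "degree (numer f) = 0" "degree (denom f) = 0" by (auto simp: ratfun_degree_def)
  then obtain a b where ab: "numer f = [:a:]" "denom f = [:b:]" by (metis degree_eq_zeroE)
  have "b \<noteq> 0" using denom_nonzero[of f] ab by simp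
  have "f = Fract [:a:] [:b:]" using numer_denom(1)[of f] ab by simp
  also have "\<dots> = ratfun_const (a / b)"
    using \<open>b \<noteq> 0\<close> by (simp add: ratfun_const_def to_fract_def eq_fract)
  finally show "\<exists>c. f = ratfun_const c" by blast
next
  assume "\<exists>c. f = ratfun_const c"
  then obtain c where "f = Fract [:c:] 1" by (auto simp: ratfun_const_def to_fract_def)
  moreover have "numer (Fract [:c:] 1) = [:c:]" "denom (Fract [:c:] 1) = 1"
    by (intro numer_denom_eqI; simp)+
  ultimately show "ratfun_degree f = 0" by (simp add: ratfun_degree_def)
qed

subsection \<open>Coprimality in \<open>K[x]\<close>\<close>

lemma poly_coprime_iff_bezout:
  fixes p q :: "'a::field poly"
  shows "coprime p q \<longleftrightarrow> (\<exists>a b. a * p + b * q = 1)"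
proof
  assume "\<exists>a b. a * p + b * q = 1"
  then obtain a b where ab: "a * p + b * q = 1" by blast
  show "coprime p q"
    by (rule coprimeI) (metis ab dvd_add dvd_mult)
qed (rule coprime_bezout)

lemma poly_coprime_mult:
  fixes p q r :: "'a::field poly"
  assumes "coprime p r" "coprime q r"
  shows "coprime (p * q) r"
proof -
  obtain a b c d where "a * p + b * r = 1" "c * q + d * r = 1"
    using assms by (auto simp: poly_coprime_iff_bezout)
  hence "(a * p + b * r) * (c * q + d * r) = 1" by simp
  hence "(a * c) * (p * q) + (a * p * d + b * c * q + b * d * r) * r = 1"
    by (simp add: algebra_simps)
  thus ?thesis unfolding poly_coprime_iff_bezout by blast
qed

lemma poly_coprime_power:
  fixes p r :: "'a::field poly"
  assumes "coprime p r"
  shows "coprime (p ^ n) r"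
  by (induction n) (auto intro: poly_coprime_mult assms)

lemma poly_coprime_dvd_power:
  fixes g h :: "'a::field poly"
  assumes "coprime g h" "h dvd c * g ^ n"
  shows "h dvd c"
  by (rule coprime_dvd_cancel[OF poly_coprime_power[OF assms(1)]]) (use assms(2) in \<open>simp add: mult.commute\<close>)

section \<open>Composition of rational functions\<close>

subsection \<open>Homogenised substitution\<close>

text \<open>This is \<open>h\<^sup>D p(g/h)\<close> for \<open>deg p \<le> D\<close>.\<close>

definition homog :: "'a::field poly \<Rightarrow> nat \<Rightarrow> 'a poly \<Rightarrow> 'a poly \<Rightarrow> 'a poly" where
  "homog p D g h = (\<Sum>i\<le>D. smult (coeff p i) (g ^ i * h ^ (D - i)))"

lemma to_fract_power: "to_fract (p ^ n) = to_fract p ^ n"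
  by (induction n) auto

lemma to_fract_sum: "to_fract (\<Sum>i\<in>A. f i) = (\<Sum>i\<in>A. to_fract (f i))"
  by (induction A rule: infinite_finite_induct) auto

lemma to_fract_smult: "to_fract (smult c p) = ratfun_const c * to_fract p"
  by (simp add: ratfun_const_def flip: to_fract_mult)

lemma coeff_map_const [simp]: "coeff (map_poly ratfun_const p) i = ratfun_const (coeff p i)"
  by (simp add: coeff_map_poly)

lemma degree_map_const [simp]: "degree (map_poly ratfun_const p) = degree p"
  by (intro degree_map_poly) auto

lemma poly_altdef_le:
  fixes p :: "'a::comm_semiring_1 poly"
  assumes "degree p \<le> D"
  shows "poly p x = (\<Sum>i\<le>D. coeff p i * x ^ i)"
proof -
  have "(\<Sum>i\<le>D. coeff p i * x ^ i) = (\<Sum>i\<le>degree p. coeff p i * x ^ i)"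
    using assms by (intro sum.mono_neutral_right) (auto simp: coeff_eq_0)
  thus ?thesis unfolding poly_altdef by simp
qed

lemma poly_const_homog:
  assumes "degree p \<le> D" "h \<noteq> 0"
  shows "poly (map_poly ratfun_const p) (to_fract g / to_fract h) * to_fract h ^ D = to_fract (homog p D g h)"
proof -
  have "poly (map_poly ratfun_const p) (to_fract g / to_fract h) * to_fract h ^ D =
     (\<Sum>i\<le>D. ratfun_const (coeff p i) * (to_fract g / to_fract h) ^ i * to_fract h ^ D)"
    using assms by (simp add: poly_altdef_le[of _ D] sum_distrib_right)
  also have "\<dots> = (\<Sum>i\<le>D. ratfun_const (coeff p i) * (to_fract g ^ i * to_fract h ^ (D - i)))"
  proof (intro sum.cong refl)
    fix i assume "i \<in> {..D}"
    hence "to_fract h ^ D = to_fract h ^ i * to_fract h ^ (D - i)" by (simp flip: power_add)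
    thus "ratfun_const (coeff p i) * (to_fract g / to_fract h) ^ i * to_fract h ^ D =
        ratfun_const (coeff p i) * (to_fract g ^ i * to_fract h ^ (D - i))"
      using assms by (simp add: power_divide)
  qed
  finally show ?thesis
    by (simp add: homog_def to_fract_sum to_fract_smult to_fract_power)
qed

lemma homog_cong_mod:
  "h dvd homog p D g h - smult (coeff p D) (g ^ D)"
proof -
  have "homog p D g h = (\<Sum>i<D. smult (coeff p i) (g ^ i * h ^ (D - i))) + smult (coeff p D) (g ^ D)"
    by (simp add: homog_def flip: lessThan_Suc_atMost)
  moreover have "h dvd (\<Sum>i<D. smult (coeff p i) (g ^ i * h ^ (D - i)))"
    by (intro dvd_sum dvd_smult dvd_mult) auto
  ultimately show ?thesis by simp
qed

lemma homog_cong_mod':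
  "g dvd homog p D g h - smult (coeff p 0) (h ^ D)"
proof -
  have "homog p D g h = (\<Sum>i=1..D. smult (coeff p i) (g ^ i * h ^ (D - i))) + smult (coeff p 0) (h ^ D)"
    by (simp add: homog_def atMost_atLeast0 sum.atLeast_Suc_atMost add.commute)
  moreover have "g dvd (\<Sum>i=1..D. smult (coeff p i) (g ^ i * h ^ (D - i)))"
    by (intro dvd_sum dvd_smult dvd_mult2) auto
  ultimately show ?thesis by simp
qed

lemma coeff_mult_top:
  fixes p q :: "'a::field poly"
  assumes "degree p \<le> m" "degree q \<le> n"
  shows "coeff (p * q) (m + n) = coeff p m * coeff q n"
proof (cases "degree p = m \<and> degree q = n")
  case True
  thus ?thesis using coeff_mult_degree_sum[of p q] by simp
next
  case False
  hence "degree p < m \<or> degree q < n" using assms by auto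
  moreover from this have "degree (p * q) < m + n"
    using assms degree_mult_le[of p q] by linarith
  ultimately show ?thesis by (auto simp: coeff_eq_0)
qed

lemma coeff_power_top:
  fixes p :: "'a::field poly"
  assumes "degree p \<le> m"
  shows "degree (p ^ k) \<le> k * m \<and> coeff (p ^ k) (k * m) = coeff p m ^ k"
proof (induction k)
  case (Suc k)
  have "degree (p ^ Suc k) \<le> degree p + degree (p ^ k)" by (simp add: degree_mult_le)
  thus ?case using coeff_mult_top[OF assms, of "p ^ k" "k * m"] Suc assms by simp
qed simp

lemma homog_top:
  assumes "degree g \<le> N" "degree h \<le> N"
  shows "degree (homog p D g h) \<le> D * N"
    and "coeff (homog p D g h) (D * N) = (\<Sum>i\<le>D. coeff p i * (coeff g N ^ i * coeff h N ^ (D - i)))"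
proof -
  have *: "degree (g ^ i * h ^ (D - i)) \<le> D * N \<and>
      coeff (g ^ i * h ^ (D - i)) (D * N) = coeff g N ^ i * coeff h N ^ (D - i)" if "i \<le> D" for i
  proof -
    have eq: "i * N + (D - i) * N = D * N" using that by (simp flip: add_mult_distrib)
    show ?thesis
      using coeff_mult_top[of "g ^ i" "i * N" "h ^ (D - i)" "(D - i) * N"]
        coeff_power_top[OF assms(1), of i] coeff_power_top[OF assms(2), of "D - i"]
        degree_mult_le[of "g ^ i" "h ^ (D - i)"] eq by auto
  qed
  show "degree (homog p D g h) \<le> D * N"
    unfolding homog_def by (intro degree_sum_le) (use * in \<open>auto intro: order_trans[OF degree_smult_le]\<close>)
  show "coeff (homog p D g h) (D * N) = (\<Sum>i\<le>D. coeff p i * (coeff g N ^ i * coeff h N ^ (D - i)))"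
    unfolding homog_def by (simp add: coeff_sum *)
qed

subsection \<open>Nonconstant rational functions are transcendental\<close>

lemma ratfun_quot: "f = to_fract (numer f) / to_fract (denom f)"
  using numer_denom(1)[of f] denom_nonzero[of f] by (simp add: to_fract_def)

lemma poly_const_to_fract:
  "poly (map_poly ratfun_const p) (to_fract g) = to_fract (pcompose p g)"
proof (induction p)
  case (pCons a p)
  thus ?case by (simp add: map_poly_pCons pcompose_pCons ratfun_const_def)
qed simp

lemma dvd_smult_power_imp_const:
  fixes g h :: "'a::field poly"
  assumes "coprime g h" "h dvd smult c (g ^ n)" "c \<noteq> 0"
  shows "degree h = 0"
proof -
  have "h dvd [:c:] * g ^ n" using assms(2) by simp
  hence "h dvd [:c:]" by (rule poly_coprime_dvd_power[OF assms(1)])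
  thus ?thesis using assms(3) by (metis degree_pCons_0 dvd_imp_degree_le le_zero_eq pCons_eq_0_iff)
qed

text \<open>From \<open>p(g/h) = 0\<close> with coprime \<open>g\<close>, \<open>h\<close> it follows that \<open>h\<close> divides a power of \<open>g\<close>, so \<open>h = 1\<close>; and
\<open>p(g) = 0\<close> is impossible by degrees.\<close>

lemma nonconst_transcendental:
  assumes v: "ratfun_degree v \<ge> 1" and z: "poly (map_poly ratfun_const p) v = 0"
  shows "p = 0"
proof (rule ccontr)
  assume p: "p \<noteq> 0"
  define g h D where "g = numer v" and "h = denom v" and "D = degree p"
  have h: "h \<noteq> 0" by (simp add: h_def denom_nonzero)
  have veq: "v = to_fract g / to_fract h" unfolding g_def h_def by (rule ratfun_quot)
  have "to_fract (homog p D g h) = 0"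
    using poly_const_homog[of p D h g] h z by (simp add: D_def flip: veq)
  hence "h dvd smult (coeff p D) (g ^ D)"
    using homog_cong_mod[of h p D g] by simp
  hence dh: "degree h = 0"
    by (rule dvd_smult_power_imp_const[rotated])
      (use p numer_denom(2)[of v] in \<open>auto simp: D_def g_def h_def\<close>)
  hence "h = 1" using numer_denom(3)[of v] by (metis degree_eq_zeroE h_def lead_coeff_pCons(1) lead_coeff_pCons(2) one_pCons)
  hence "v = to_fract g" using veq by simp
  hence "pcompose p g = 0" using z by (simp add: poly_const_to_fract)
  moreover have "degree g > 0" using v dh by (simp add: ratfun_degree_def g_def h_def)
  ultimately show False using p pcompose_eq_0 by blast
qed

lemma poly_eval_const: "poly_eval ratfun_const"
  by unfold_locales (auto simp: ratfun_const_add ratfun_const_mult)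

lemma ratfun_eval_const:
  assumes "ratfun_degree v \<ge> 1"
  shows "ratfun_eval ratfun_const v"
  unfolding ratfun_eval_def ratfun_eval_axioms_def
  using nonconst_transcendental[OF assms] poly_eval_const by blast

lemma compose_eq_eval: 
  assumes "ratfun_degree v \<ge> 1"
  shows "u \<circ>\<^sub>r v = ratfun_eval.eval ratfun_const v u"
proof -
  interpret ratfun_eval ratfun_const v by (rule ratfun_eval_const[OF assms])
  show ?thesis by (simp add: eval_def peval_def ratfun_compose_def)
qed

context
  fixes v :: "'a::field ratfun"
  assumes v: "ratfun_degree v \<ge> 1"
begin

interpretation ratfun_eval ratfun_const v by (rule ratfun_eval_const[OF v])

lemmas compose_add = eval_add[folded compose_eq_eval[OF v]]
  and compose_diff = eval_diff[folded compose_eq_eval[OF v]]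
  and compose_mult = eval_mult[folded compose_eq_eval[OF v]]
  and compose_divide = eval_divide[folded compose_eq_eval[OF v]]
  and compose_inverse = eval_inverse[folded compose_eq_eval[OF v]]
  and compose_power = eval_power[folded compose_eq_eval[OF v]]
  and compose_inj = eval_inj[folded compose_eq_eval[OF v]]
  and compose_0 = eval_0[folded compose_eq_eval[OF v]]
  and compose_1 = eval_1[folded compose_eq_eval[OF v]]
  and compose_eq_0_iff = eval_eq_0_iff[folded compose_eq_eval[OF v]]
  and compose_const = eval_const[folded compose_eq_eval[OF v]]
  and X_compose = eval_X[folded compose_eq_eval[OF v]]

lemma to_fract_compose: "to_fract p \<circ>\<^sub>r v = poly (map_poly ratfun_const p) v"
  by (simp add: compose_eq_eval[OF v] eval_to_fract peval_def)

lemma poly_const_compose: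
  "poly (map_poly ratfun_const p) u \<circ>\<^sub>r v = poly (map_poly ratfun_const p) (u \<circ>\<^sub>r v)"
  by (induction p) (simp_all add: map_poly_pCons compose_add compose_mult compose_const compose_0)

lemma compose_assoc: "(u \<circ>\<^sub>r w) \<circ>\<^sub>r v = u \<circ>\<^sub>r (w \<circ>\<^sub>r v)"
  unfolding ratfun_compose_def[of u] by (simp add: poly_const_compose compose_divide)

end

subsection \<open>Degrees\<close>

lemma ratfun_degree_Fract:
  assumes "coprime P Q" "Q \<noteq> 0"
  shows "ratfun_degree (Fract P Q) = max (degree P) (degree Q)"
proof -
  define c where "c = inverse (lead_coeff Q)"
  have c: "c \<noteq> 0" using assms by (simp add: c_def)
  have eq: "Fract P Q = Fract (smult c P) (smult c Q)" using assms c by (subst eq_fract) auto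
  have "numer (Fract (smult c P) (smult c Q)) = smult c P" "denom (Fract (smult c P) (smult c Q)) = smult c Q"
    by (rule numer_denom_eqI; use assms c in \<open>auto simp: coprime_def dvd_smult_iff c_def\<close>)+
  thus ?thesis using c unfolding eq by (simp add: ratfun_degree_def)
qed

lemma ratfun_degree_to_fract: "ratfun_degree (to_fract p) = degree p"
  by (simp add: to_fract_def ratfun_degree_Fract)

lemma ratfun_degree_X [simp]: "ratfun_degree ratfun_X = 1"
  by (simp add: ratfun_X_def ratfun_degree_to_fract)

lemma ratfun_degree_const [simp]: "ratfun_degree (ratfun_const c) = 0"
  by (simp add: ratfun_const_def ratfun_degree_to_fract)

lemma coprime_no_common_root:
  fixes p q :: "'a::field poly"
  assumes "coprime p q"
  shows "poly p x \<noteq> 0 \<or> poly q x \<noteq> 0"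
proof -
  obtain a b where "a * p + b * q = 1" using coprime_bezout[OF assms] by blast
  hence "poly a x * poly p x + poly b x * poly q x = 1" by (metis poly_1 poly_add poly_mult)
  thus ?thesis by auto
qed

text \<open>A common divisor divides a power of \<open>h\<close> by the homogenised identity of Bezout. But it is coprime to \<open>h\<close>, as one of
the two polynomials is congruent to a nonzero multiple of \<open>g\<^sup>D\<close> modulo \<open>h\<close>.\<close>

lemma coprime_homog:
  assumes "coprime p q" "coprime g h" "h \<noteq> 0" "D = max (degree p) (degree q)" "p \<noteq> 0 \<or> q \<noteq> 0"
  shows "coprime (homog p D g h) (homog q D g h)"
proof -
  let ?v = "to_fract g / to_fract h"
  let ?P = "homog p D g h" and ?Q = "homog q D g h"
  obtain a b where ab: "a * p + b * q = 1" using coprime_bezout[OF assms(1)] by blast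
  define E where "E = max (degree a) (degree b)"
  interpret poly_eval ratfun_const ?v by (rule poly_eval_const)
  have "to_fract (homog a E g h * ?P + homog b E g h * ?Q) = to_fract (h ^ (E + D))"
  proof -
    have "to_fract (homog a E g h * ?P + homog b E g h * ?Q) =
      poly (map_poly ratfun_const (a * p + b * q)) ?v * to_fract h ^ (E + D)"
      using assms(3,4) by (simp add: E_def peval_mult[unfolded peval_def] peval_add[unfolded peval_def] power_add algebra_simps flip: poly_const_homog)
    thus ?thesis unfolding ab by (simp add: to_fract_power)
  qed
  hence bez: "homog a E g h * ?P + homog b E g h * ?Q = h ^ (E + D)" by (simp only: to_fract_eq_iff)
  have key: "coprime (homog r D g h) h" if "coeff r D \<noteq> 0" for r
  proof (rule coprimeI)
    fix d assume d: "d dvd homog r D g h" "d dvd h"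
    have "d dvd smult (coeff r D) (g ^ D)"
      using dvd_diff[OF d(1) dvd_trans[OF d(2) homog_cong_mod[of h r D g]]] by simp
    moreover have "coprime (g ^ D) h" by (rule poly_coprime_power[OF assms(2)])
    ultimately show "is_unit d" using d(2) that by (metis coprime_common_divisor dvd_smult_cancel)
  qed
  show ?thesis
  proof (rule coprimeI)
    fix d assume d: "d dvd ?P" "d dvd ?Q"
    hence dh: "d dvd h ^ (E + D)" unfolding bez[symmetric] by (intro dvd_add dvd_mult)
    have "coeff p D \<noteq> 0 \<or> coeff q D \<noteq> 0"
    proof (cases "degree p = D")
      case True
      show ?thesis
      proof (cases "p = 0")
        case True
        hence "degree q = D" "q \<noteq> 0" using assms(4,5) \<open>degree p = D\<close> by auto
        thus ?thesis using leading_coeff_0_iff by auto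
      qed (use True in auto)
    next
      case False
      hence "degree q = D" "q \<noteq> 0" using assms(4) by (auto simp: max_def split: if_splits)
      thus ?thesis using leading_coeff_0_iff by auto
    qed
    then obtain r where r: "coeff r D \<noteq> 0" "d dvd homog r D g h" using d by blast
    have "coprime (h ^ (E + D)) (homog r D g h)"
      by (rule poly_coprime_power) (use key[OF r(1)] in \<open>simp add: coprime_commute\<close>)
    thus "is_unit d" using dh r(2) by (metis coprime_common_divisor)
  qed
qed

text \<open>Homogenisation keeps numerator and denominator coprime. One of them attains the degree \<open>D N\<close>, because \<open>p\<close> and \<open>q\<close>
do not both vanish at the value of \<open>v\<close> at infinity.\<close>

theorem ratfun_degree_compose:
  assumes v: "ratfun_degree v \<ge> 1"
  shows "ratfun_degree (u \<circ>\<^sub>r v) = ratfun_degree u * ratfun_degree v"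
proof -
  define p q g h D N where "p = numer u" and "q = denom u" and "g = numer v" and "h = denom v"
    and "D = max (degree p) (degree q)" and "N = max (degree g) (degree h)"
  have nz: "q \<noteq> 0" "h \<noteq> 0" by (simp_all add: q_def h_def denom_nonzero)
  have veq: "v = to_fract g / to_fract h" unfolding g_def h_def by (rule ratfun_quot)
  have cop: "coprime p q" "coprime g h" unfolding p_def q_def g_def h_def by (rule numer_denom)+
  have DN: "ratfun_degree u = D" "ratfun_degree v = N"
    by (simp_all add: ratfun_degree_def D_def N_def p_def q_def g_def h_def)
  let ?P = "homog p D g h" and ?Q = "homog q D g h"
  have "poly (map_poly ratfun_const q) v \<noteq> 0" using nonconst_transcendental[OF v] nz by blast
  moreover have PQ: "to_fract ?Q = poly (map_poly ratfun_const q) v * to_fract h ^ D"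
      "to_fract ?P = poly (map_poly ratfun_const p) v * to_fract h ^ D"
    unfolding veq using nz by (auto intro!: poly_const_homog[symmetric] simp: D_def)
  ultimately have "to_fract ?Q \<noteq> 0" using nz by simp
  hence Q: "?Q \<noteq> 0" by simp
  have "u \<circ>\<^sub>r v = to_fract ?P / to_fract ?Q"
    unfolding PQ using nz by (simp add: ratfun_compose_def p_def q_def)
  hence eq: "u \<circ>\<^sub>r v = Fract ?P ?Q" by (simp add: to_fract_def)
  have cop': "coprime ?P ?Q" using coprime_homog[OF cop nz(2)] nz(1) D_def by blast
  have le: "degree g \<le> N" "degree h \<le> N" by (auto simp: N_def)
  have "coeff ?P (D * N) \<noteq> 0 \<or> coeff ?Q (D * N) \<noteq> 0"
  proof (cases "coeff h N = 0")
    case True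
    have gN: "coeff g N \<noteq> 0"
    proof (cases "degree h = N")
      case True
      thus ?thesis using \<open>coeff h N = 0\<close> nz leading_coeff_0_iff by auto
    next
      case False
      hence "degree g = N" "N > 0" using v DN by (auto simp: N_def max_def split: if_splits)
      thus ?thesis by (metis degree_0 leading_coeff_0_iff less_numeral_extra(3))
    qed
    have "(\<Sum>i\<le>D. coeff r i * (coeff g N ^ i * coeff h N ^ (D - i))) = coeff r D * coeff g N ^ D" for r
    proof -
      have "(\<Sum>i\<le>D. coeff r i * (coeff g N ^ i * coeff h N ^ (D - i))) =
          (\<Sum>i\<in>{D}. coeff r i * (coeff g N ^ i * coeff h N ^ (D - i)))"
        using True by (intro sum.mono_neutral_right) auto
      thus ?thesis by simp
    qed
    moreover have "coeff p D \<noteq> 0 \<or> coeff q D \<noteq> 0"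
    proof (cases "degree q = D")
      case True
      thus ?thesis using nz leading_coeff_0_iff by auto
    next
      case False
      hence "degree p = D" "p \<noteq> 0" by (auto simp: D_def max_def split: if_splits)
      thus ?thesis using leading_coeff_0_iff by auto
    qed
    ultimately show ?thesis using gN by (simp add: homog_top(2)[OF le])
  next
    case False
    let ?x = "coeff g N / coeff h N"
    have "coeff (homog r D g h) (D * N) = poly r ?x * coeff h N ^ D" if "degree r \<le> D" for r
    proof -
      have "coeff r i * ?x ^ i * coeff h N ^ D = coeff r i * (coeff g N ^ i * coeff h N ^ (D - i))" if "i \<le> D" for i
      proof -
        have "coeff h N ^ D = coeff h N ^ i * coeff h N ^ (D - i)" using that by (simp flip: power_add)
        thus ?thesis using False by (simp add: power_divide)
      qed
      thus ?thesis unfolding homog_top(2)[OF le] poly_altdef_le[OF that] sum_distrib_right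
        by (intro sum.cong refl) (simp only: atMost_iff)
    qed
    thus ?thesis using coprime_no_common_root[OF cop(1), of ?x] False by (simp add: D_def)
  qed
  hence "degree ?P \<ge> D * N \<or> degree ?Q \<ge> D * N" using le_degree by blast
  hence "max (degree ?P) (degree ?Q) = D * N"
    using homog_top(1)[OF le, of p D] homog_top(1)[OF le, of q D] by auto
  thus ?thesis unfolding eq DN using ratfun_degree_Fract[OF cop' Q] by simp
qed

section \<open>Algebraic elements and linear dependence\<close>

context poly_eval
begin

lemma peval_minus: "peval (- p) = - peval p"
  using peval_add[of p "- p"] by (simp add: eq_neg_iff_add_eq_0 add.commute)

lemma peval_diff: "peval (p - q) = peval p - peval q"
  using peval_add[of p "- q"] by (simp add: peval_minus)

lemma peval_sum: "peval (\<Sum>i\<in>A. f i) = (\<Sum>i\<in>A. peval (f i))"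
  by (induction A rule: infinite_finite_induct) (auto simp: peval_add)

lemma peval_monom: "peval (monom c n) = h c * y ^ n"
  by (induction n) (auto simp: monom_0 monom_Suc)

lemma peval_altdef: "peval p = (\<Sum>i\<le>degree p. h (coeff p i) * y ^ i)"
  using peval_sum[of "\<lambda>i. monom (coeff p i) i" "{..degree p}"]
  by (simp add: peval_monom poly_as_sum_of_monoms)

lemma peval_mod:
  assumes "peval p = 0"
  shows "peval (q mod p) = peval q"
proof -
  have "peval q = peval (p * (q div p) + q mod p)" by simp
  also have "\<dots> = peval (q mod p)" unfolding peval_add peval_mult assms by simp
  finally show ?thesis by simp
qed

lemma range_peval_reduced:
  assumes "peval p = 0" "p \<noteq> 0"
  shows "\<exists>r. (r = 0 \<or> degree r < degree p) \<and> peval q = peval r"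
  using peval_mod[OF assms(1), of q] degree_mod_less[OF assms(2), of q] by metis

text \<open>A polynomial that does not vanish at an algebraic element \<open>y\<close> is coprime to the minimal polynomial of \<open>y\<close>; Bezout's
identity yields the inverse of its value.\<close>

lemma range_peval_inverse:
  assumes "peval p = 0" "p \<noteq> 0"
  shows "inverse (peval q) \<in> range peval"
proof (cases "peval q = 0")
  case True
  thus ?thesis by (intro range_eqI[of _ _ 0]) simp
next
  case nz: False
  obtain m where m: "peval m = 0" "m \<noteq> 0"
    and min: "\<And>r. peval r = 0 \<Longrightarrow> r \<noteq> 0 \<Longrightarrow> degree m \<le> degree r"
    using ex_has_least_nat[of "\<lambda>r. peval r = 0 \<and> r \<noteq> 0" p degree] assms by auto
  have "coprime m q"
  proof (rule coprimeI)
    fix e assume e: "e dvd m" "e dvd q"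
    then obtain f where f: "m = e * f" by (elim dvdE)
    have "peval e \<noteq> 0" using e(2) nz by (auto elim!: dvdE simp: peval_mult)
    hence "peval f = 0" using m(1) by (simp add: f peval_mult)
    moreover have "f \<noteq> 0" "e \<noteq> 0" using m(2) f by auto
    ultimately have "degree e = 0" using min[of f] by (simp add: f degree_mult_eq)
    thus "is_unit e" using \<open>e \<noteq> 0\<close> by (simp add: is_unit_iff_degree)
  qed
  then obtain a b where "a * m + b * q = 1" using coprime_bezout by blast
  hence "peval (a * m + b * q) = 1" by simp
  hence "peval b * peval q = 1" using m(1) by (simp add: peval_add peval_mult)
  hence "inverse (peval q) = peval b" by (metis inverse_unique mult.commute)
  thus ?thesis by blast
qed

end

text \<open>The copy of \<open>K(x)\<close> inside the larger field acts on that field, so dimensions over \<open>K(w)\<close> become dimensions of vector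
spaces over the type of rational functions.\<close>

context ratfun_eval
begin

sublocale vs: vector_space "\<lambda>c z. eval c * z"
  by unfold_locales (auto simp: algebra_simps eval_add eval_mult)

lemma poly_eval_eval: "poly_eval eval"
  by unfold_locales (auto simp: eval_add eval_mult)

lemma powers_dependent:
  assumes "finite T" "card T \<le> n" "\<And>i. i \<le> n \<Longrightarrow> z ^ i \<in> vs.span T"
  shows "\<exists>p. p \<noteq> 0 \<and> degree p \<le> n \<and> poly (map_poly eval p) z = 0"
proof -
  interpret E: poly_eval eval z by (rule poly_eval_eval)
  show ?thesis
  proof (cases "inj_on (\<lambda>i. z ^ i) {..n}")
    case False
    then obtain i j where ij: "i \<le> n" "j \<le> n" "i \<noteq> j" "z ^ i = z ^ j" by (auto simp: inj_on_def)
    define p :: "'a ratfun poly" where "p = monom 1 i - monom 1 j"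
    have "coeff p i = 1" using ij by (simp add: p_def)
    hence "p \<noteq> 0" by auto
    moreover have "degree p \<le> n"
      unfolding p_def by (intro degree_diff_le) (use ij degree_monom_le order_trans in blast)+
    moreover have "E.peval p = 0" using ij by (simp add: p_def E.peval_diff E.peval_monom)
    ultimately show ?thesis by (auto simp: E.peval_def)
  next
    case True
    let ?S = "(\<lambda>i. z ^ i) ` {..n}"
    have "card ?S = Suc n" using True by (simp add: card_image)
    moreover have "?S \<subseteq> vs.span T" using assms(3) by auto
    ultimately have "vs.dependent ?S"
      using vs.independent_span_bound[OF assms(1), of ?S] assms(2) by auto
    then obtain c x where c: "x \<in> ?S" "c x \<noteq> 0" "(\<Sum>x\<in>?S. eval (c x) * x) = 0"
      using vs.dependent_finite[of ?S] by auto
    define p where "p = (\<Sum>i\<le>n. monom (c (z ^ i)) i)"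
    have cf: "coeff p i = c (z ^ i)" if "i \<le> n" for i
      using that by (simp add: p_def coeff_sum)
    hence "p \<noteq> 0" using c(1,2) by auto
    moreover have "degree p \<le> n"
      unfolding p_def by (intro degree_sum_le) (auto intro: order_trans[OF degree_monom_le])
    moreover have "E.peval p = (\<Sum>x\<in>?S. eval (c x) * x)"
      using True by (simp add: p_def E.peval_sum E.peval_monom sum.reindex)
    ultimately show ?thesis using c(3) by (auto simp: E.peval_def)
  qed
qed

lemma powers_independent:
  assumes "\<And>p. p \<noteq> 0 \<Longrightarrow> poly (map_poly eval p) z = 0 \<Longrightarrow> n \<le> degree p"
  shows "inj_on (\<lambda>i. z ^ i) {..<n}" "vs.independent ((\<lambda>i. z ^ i) ` {..<n})"
proof -
  interpret E: poly_eval eval z by (rule poly_eval_eval)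
  have *: "p = 0" if "E.peval p = 0" "degree p < n" for p
    using assms[of p] that by (auto simp: E.peval_def)
  have small: "degree (\<Sum>i<n. monom (c i) i) < n" if "n > 0" for c :: "nat \<Rightarrow> 'a ratfun"
    by (intro degree_sum_less that) (auto intro: le_less_trans[OF degree_monom_le])
  show inj: "inj_on (\<lambda>i. z ^ i) {..<n}"
  proof (rule inj_onI, rule ccontr)
    fix i j assume ij: "i \<in> {..<n}" "j \<in> {..<n}" "z ^ i = z ^ j" "i \<noteq> j"
    define p :: "'a ratfun poly" where "p = monom 1 i - monom 1 j"
    have "coeff p i = 1" using ij by (simp add: p_def)
    hence "p \<noteq> 0" by auto
    moreover have "degree p < n"
      unfolding p_def by (intro degree_diff_less) (use ij in \<open>auto intro: le_less_trans[OF degree_monom_le]\<close>)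
    moreover have "E.peval p = 0" using ij by (simp add: p_def E.peval_diff E.peval_monom)
    ultimately show False using * by blast
  qed
  show "vs.independent ((\<lambda>i. z ^ i) ` {..<n})"
  proof
    let ?S = "(\<lambda>i. z ^ i) ` {..<n}"
    assume "vs.dependent ?S"
    then obtain c x where c: "x \<in> ?S" "c x \<noteq> 0" "(\<Sum>x\<in>?S. eval (c x) * x) = 0"
      using vs.dependent_finite[of ?S] by auto
    define p where "p = (\<Sum>i<n. monom (c (z ^ i)) i)"
    have "E.peval p = (\<Sum>x\<in>?S. eval (c x) * x)"
      using inj by (simp add: p_def E.peval_sum E.peval_monom sum.reindex)
    moreover have "n > 0" using c(1) by auto
    ultimately have "p = 0" using *[of p] c(3) small by (auto simp: p_def)
    moreover have cf: "coeff p i = c (z ^ i)" if "i < n" for i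
      using that by (simp add: p_def coeff_sum)
    ultimately show False using c(1,2) by auto
  qed
qed

end

section \<open>Gauss's lemma\<close>

lemma prime_divisor_exists_poly:
  fixes k :: "'a::field poly"
  assumes "k \<noteq> 0" "degree k > 0"
  shows "\<exists>d. prime_elem d \<and> d dvd k"
proof -
  obtain d where d: "d dvd k" "degree d > 0"
    and min: "\<And>e. e dvd k \<Longrightarrow> degree e > 0 \<Longrightarrow> degree d \<le> degree e"
    using ex_has_least_nat[of "\<lambda>d. d dvd k \<and> degree d > 0" k degree] assms by auto
  have "prime_elem d"
  proof (rule prime_elemI)
    show "d \<noteq> 0" using d by auto
    show "\<not> is_unit d" using d \<open>d \<noteq> 0\<close> by (simp add: is_unit_iff_degree)
    fix x y assume xy: "d dvd x * y"
    show "d dvd x \<or> d dvd y"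
    proof (cases "coprime x d")
      case True
      thus ?thesis using coprime_dvd_cancel[OF True xy] by blast
    next
      case False
      then obtain e where e: "e dvd x" "e dvd d" "\<not> is_unit e" by (auto simp: coprime_def)
      have "e \<noteq> 0" using e(2) \<open>d \<noteq> 0\<close> by auto
      hence "degree e > 0" using e(3) by (simp add: is_unit_iff_degree)
      hence "degree d \<le> degree e" using min[of e] e(2) d(1) dvd_trans by blast
      obtain f where f: "d = e * f" using e(2) by (elim dvdE)
      have "f \<noteq> 0" using f \<open>d \<noteq> 0\<close> by auto
      hence "degree f = 0" using f \<open>degree d \<le> degree e\<close> \<open>e \<noteq> 0\<close> by (simp add: degree_mult_eq)
      hence "is_unit f" using \<open>f \<noteq> 0\<close> by (simp add: is_unit_iff_degree)
      hence "d dvd e" by (simp add: f mult_unit_dvd_iff)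
      thus ?thesis using e(1) dvd_trans by blast
    qed
  qed
  thus ?thesis using d(1) by blast
qed

text \<open>A prime factor of \<open>k\<close> stays prime in \<open>K[x][T]\<close> and hence divides \<open>B\<close> or \<open>C\<close>; cancel the prime factors of
\<open>k\<close> one by one.\<close>

lemma gauss_cancel:
  fixes A B C :: "'a::field poly poly"
  assumes "smult k A = B * C" "k \<noteq> 0"
  shows "\<exists>s t B' C'. s \<noteq> 0 \<and> t \<noteq> 0 \<and> B = smult s B' \<and> C = smult t C' \<and> A = B' * C'"
  using assms
proof (induction "degree k" arbitrary: k B C rule: less_induct)
  case less
  show ?case
  proof (cases "degree k = 0")
    case True
    then obtain c where c: "k = [:c:]" by (auto elim: degree_eq_zeroE)
    with less.prems have "c \<noteq> 0" by simp
    have "A = smult [:inverse c:] (smult k A)" using \<open>c \<noteq> 0\<close> by (simp add: c flip: one_pCons)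
    also have "\<dots> = B * smult [:inverse c:] C" by (simp add: less.prems)
    finally have "A = B * smult [:inverse c:] C" .
    moreover have "C = smult [:c:] (smult [:inverse c:] C)" using \<open>c \<noteq> 0\<close> by (simp flip: one_pCons)
    moreover have "B = smult 1 B" by simp
    moreover have "[:c:] \<noteq> 0" using \<open>c \<noteq> 0\<close> by simp
    ultimately show ?thesis by (metis one_neq_zero)
  next
    case False
    then obtain d where d: "prime_elem d" "d dvd k" using prime_divisor_exists_poly less.prems(2) by blast
    obtain l where l: "k = d * l" using d(2) by (elim dvdE)
    have nz: "d \<noteq> 0" "l \<noteq> 0" using l less.prems(2) by auto
    have "degree d > 0" using d(1) nz by (metis gr0I is_unit_iff_degree prime_elem_not_unit)
    hence dl: "degree l < degree k" using nz by (simp add: l degree_mult_eq)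
    have "B * C = [:d:] * smult l A" by (simp add: l mult.commute flip: less.prems(1))
    hence "[:d:] dvd B * C" by (rule dvdI)
    moreover have "prime_elem [:d:]" using d(1) by (rule lift_prime_elem_poly)
    ultimately have "[:d:] dvd B \<or> [:d:] dvd C" by (simp add: prime_elem_dvd_mult_iff)
    thus ?thesis
    proof
      assume "[:d:] dvd B"
      then obtain B1 where "B = [:d:] * B1" by (elim dvdE)
      hence B1: "B = smult d B1" by simp
      have "smult d (smult l A) = smult d (B1 * C)" using less.prems(1) by (simp add: l B1)
      hence "smult l A = B1 * C" using nz(1) by (metis smult_cancel)
      from less.hyps[OF dl this nz(2)] obtain s t B' C' where
        *: "s \<noteq> 0" "t \<noteq> 0" "B1 = smult s B'" "C = smult t C'" "A = B' * C'" by metis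
      hence "B = smult (d * s) B'" "d * s \<noteq> 0" using B1 nz by auto
      thus ?thesis using * by blast
    next
      assume "[:d:] dvd C"
      then obtain C1 where "C = [:d:] * C1" by (elim dvdE)
      hence C1: "C = smult d C1" by simp
      have "smult d (smult l A) = smult d (B * C1)" using less.prems(1) by (simp add: l C1)
      hence "smult l A = B * C1" using nz(1) by (metis smult_cancel)
      from less.hyps[OF dl this nz(2)] obtain s t B' C' where
        *: "s \<noteq> 0" "t \<noteq> 0" "B = smult s B'" "C1 = smult t C'" "A = B' * C'" by metis
      hence "C = smult (d * t) C'" "d * t \<noteq> 0" using C1 nz by auto
      thus ?thesis using * by blast
    qed
  qed
qed

lemma common_denominator:
  fixes p :: "'a::field ratfun poly"
  shows "\<exists>b A. b \<noteq> 0 \<and> smult (to_fract b) p = map_poly to_fract A"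
proof (induction p)
  case 0
  show ?case by (intro exI[of _ 1] exI[of _ 0]) simp
next
  case (pCons a p)
  then obtain b A where bA: "b \<noteq> 0" "smult (to_fract b) p = map_poly to_fract A" by blast
  have d: "denom a \<noteq> 0" by (rule denom_nonzero)
  have "to_fract (b * denom a) * a = to_fract (b * numer a)"
    using d by (subst (2) ratfun_quot) simp
  moreover have "smult (to_fract (b * denom a)) p = map_poly to_fract (smult (denom a) A)"
    using bA(2) by (simp add: fract_poly_smult mult.commute[of "to_fract b"] flip: smult_smult)
  ultimately have "smult (to_fract (b * denom a)) (pCons a p) = map_poly to_fract (pCons (b * numer a) (smult (denom a) A))"
    by (simp add: map_poly_pCons del: to_fract_mult)
  moreover have "b * denom a \<noteq> 0" using d bA(1) by simp
  ultimately show ?case by blast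
qed

lemma gauss_lemma:
  fixes A :: "'a::field poly poly" and p q :: "'a ratfun poly"
  assumes "map_poly to_fract A = p * q"
  shows "\<exists>P Q c. c \<noteq> 0 \<and> A = P * Q \<and> map_poly to_fract P = smult c p"
proof -
  obtain b P1 where b: "b \<noteq> 0" "smult (to_fract b) p = map_poly to_fract P1" using common_denominator by blast
  obtain c Q1 where c: "c \<noteq> 0" "smult (to_fract c) q = map_poly to_fract Q1" using common_denominator by blast
  have "map_poly to_fract (smult (b * c) A) = smult (to_fract b) p * smult (to_fract c) q"
    by (simp add: fract_poly_smult assms mult.commute)
  also have "\<dots> = map_poly to_fract (P1 * Q1)" by (simp add: b c)
  finally have "smult (b * c) A = P1 * Q1" by (simp only: fract_poly_eq_iff)
  then obtain s t P Q where *: "s \<noteq> 0" "P1 = smult s P" "A = P * Q"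
    using gauss_cancel[of "b * c" A P1 Q1] b(1) c(1) by auto
  have "smult (to_fract s) (map_poly to_fract P) = smult (to_fract b) p"
    using b(2) *(2) by (simp add: fract_poly_smult)
  hence "smult (inverse (to_fract s)) (smult (to_fract s) (map_poly to_fract P)) = 
      smult (inverse (to_fract s)) (smult (to_fract b) p)" by simp
  hence "map_poly to_fract P = smult (inverse (to_fract s) * to_fract b) p"
    using *(1) by simp
  moreover have "inverse (to_fract s) * to_fract b \<noteq> 0" using *(1) b(1) by simp
  ultimately show ?thesis using *(3) by blast
qed

section \<open>The field extension \<open>K(x)/K(w)\<close>\<close>

text \<open>The value at \<open>z\<close> of a polynomial over \<open>K(w)\<close>, whose coefficients are given as rational functions of \<open>w\<close>.\<close>

definition coeval :: "'a::field ratfun \<Rightarrow> 'a ratfun poly \<Rightarrow> 'a ratfun \<Rightarrow> 'a ratfun" where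
  "coeval w p z = poly (map_poly (\<lambda>c. c \<circ>\<^sub>r w) p) z"

lemma poly_eval_compose: "ratfun_degree w \<ge> 1 \<Longrightarrow> poly_eval (\<lambda>c. c \<circ>\<^sub>r w)"
  by unfold_locales (auto simp: compose_0 compose_1 compose_add compose_mult)

lemma degree_less_of_dvd:
  fixes h s :: "'a::field poly"
  assumes "h dvd s" "s = 0 \<or> degree s < degree h"
  shows "s = 0"
  using assms dvd_imp_degree_le by force

lemma X_power: "ratfun_X ^ j = to_fract (monom 1 j)"
  by (simp add: ratfun_X_def monom_altdef to_fract_power)

text \<open>Write \<open>w = g/h\<close> and clear denominators. Modulo \<open>h\<close> the relation retains only the coefficients of \<open>w\<^sup>M\<close>, modulo \<open>g\<close>
only the constant coefficients. The one of \<open>g\<close>, \<open>h\<close> that has degree \<open>N\<close> divides a polynomial of degree less than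
\<open>N\<close> with these coefficients, so they vanish and \<open>M\<close> can be lowered.\<close>

lemma X_independent_poly:
  fixes r :: "nat \<Rightarrow> 'a::field poly"
  assumes w: "ratfun_degree w \<ge> 1" and N: "N = ratfun_degree w"
    and z: "(\<Sum>j<N. (to_fract (r j) \<circ>\<^sub>r w) * ratfun_X ^ j) = 0"
    and M: "\<And>j. j < N \<Longrightarrow> degree (r j) \<le> M"
  shows "\<forall>j<N. r j = 0"
  using z M
proof (induction M arbitrary: r rule: less_induct)
  case (less M)
  note z = less.prems(1) and M = less.prems(2)
  have IH: "\<forall>j<N. r j = 0" if "M \<noteq> 0" "(\<Sum>j<N. (to_fract (r j) \<circ>\<^sub>r w) * ratfun_X ^ j) = 0"
    "\<And>j. j < N \<Longrightarrow> degree (r j) \<le> M - 1" for r :: "nat \<Rightarrow> 'a poly"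
    using less.IH[of "M - 1" r] that by simp
  define g h where "g = numer w" and "h = denom w"
  have h: "h \<noteq> 0" by (simp add: h_def denom_nonzero)
  have weq: "w = to_fract g / to_fract h" unfolding g_def h_def by (rule ratfun_quot)
  have cop: "coprime g h" "coprime h g" using numer_denom(2)[of w] by (simp_all add: g_def h_def coprime_commute)
  have Npos: "N > 0" using w N by simp
  have small: "degree (\<Sum>j<N. monom (c j) j) < N" for c :: "nat \<Rightarrow> 'a"
    by (intro degree_sum_less Npos) (auto intro: le_less_trans[OF degree_monom_le])
  have cf: "coeff (\<Sum>j<N. monom (c j) j) j = c j" if "j < N" for c :: "nat \<Rightarrow> 'a" and j
    using that by (simp add: coeff_sum)
  have "(\<Sum>j<N. to_fract (homog (r j) M g h) * ratfun_X ^ j) =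
      (\<Sum>j<N. (to_fract (r j) \<circ>\<^sub>r w) * ratfun_X ^ j) * to_fract h ^ M"
    unfolding sum_distrib_right
  proof (intro sum.cong refl)
    fix j assume "j \<in> {..<N}"
    hence "to_fract (homog (r j) M g h) = (to_fract (r j) \<circ>\<^sub>r w) * to_fract h ^ M"
      using poly_const_homog[OF M h, of j g] by (simp add: to_fract_compose[OF w] flip: weq)
    thus "to_fract (homog (r j) M g h) * ratfun_X ^ j = (to_fract (r j) \<circ>\<^sub>r w) * ratfun_X ^ j * to_fract h ^ M"
      by (simp add: mult_ac)
  qed
  also have "\<dots> = 0" by (simp add: z)
  finally have "to_fract (\<Sum>j<N. homog (r j) M g h * monom 1 j) = 0"
    by (simp add: X_power to_fract_sum)
  hence rel: "(\<Sum>j<N. homog (r j) M g h * monom 1 j) = 0" by (simp only: to_fract_eq_0_iff)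
  have "max (degree g) (degree h) = N" by (simp add: N ratfun_degree_def g_def h_def)
  then consider "degree h = N" | "degree g = N" by (auto simp: max_def split: if_splits)
  thus "\<forall>j<N. r j = 0"
  proof cases
    case 1
    define s where "s = (\<Sum>j<N. monom (coeff (r j) M) j)"
    have "h dvd (\<Sum>j<N. (homog (r j) M g h - smult (coeff (r j) M) (g ^ M)) * monom 1 j)"
      by (intro dvd_sum dvd_mult2 homog_cong_mod)
    also have "\<dots> = - (\<Sum>j<N. smult (coeff (r j) M) (g ^ M) * monom 1 j)"
      using rel by (simp add: left_diff_distrib sum_subtractf)
    also have "(\<Sum>j<N. smult (coeff (r j) M) (g ^ M) * monom 1 j) = g ^ M * s"
      unfolding s_def sum_distrib_left
    proof (intro sum.cong refl)
      fix j
      have "monom (coeff (r j) M) j = smult (coeff (r j) M) (monom 1 j)" by (simp add: smult_monom)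
      thus "smult (coeff (r j) M) (g ^ M) * monom 1 j = g ^ M * monom (coeff (r j) M) j" by simp
    qed
    finally have "h dvd g ^ M * s" by simp
    hence "h dvd s" by (rule coprime_dvd_cancel[OF poly_coprime_power[OF cop(1)]])
    hence "s = 0" using small 1 by (intro degree_less_of_dvd[of h s]) (auto simp: s_def)
    hence top: "coeff (r j) M = 0" if "j < N" for j using cf[OF that, of "\<lambda>j. coeff (r j) M"] by (simp add: s_def)
    show ?thesis
    proof (cases "M = 0")
      case True
      thus ?thesis using top M by (metis leading_coeff_0_iff le_zero_eq)
    next
      case False
      show ?thesis
      proof (rule IH[OF False z])
        fix j assume "j < N"
        thus "degree (r j) \<le> M - 1" using M[of j] top[of j] False
          by (metis One_nat_def Suc_pred degree_0 leading_coeff_0_iff le_SucE neq0_conv zero_le)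
      qed
    qed
  next
    case 2
    define s where "s = (\<Sum>j<N. monom (coeff (r j) 0) j)"
    have "g dvd (\<Sum>j<N. (homog (r j) M g h - smult (coeff (r j) 0) (h ^ M)) * monom 1 j)"
      by (intro dvd_sum dvd_mult2 homog_cong_mod')
    also have "\<dots> = - (\<Sum>j<N. smult (coeff (r j) 0) (h ^ M) * monom 1 j)"
      using rel by (simp add: left_diff_distrib sum_subtractf)
    also have "(\<Sum>j<N. smult (coeff (r j) 0) (h ^ M) * monom 1 j) = h ^ M * s"
      unfolding s_def sum_distrib_left
    proof (intro sum.cong refl)
      fix j
      have "monom (coeff (r j) 0) j = smult (coeff (r j) 0) (monom 1 j)" by (simp add: smult_monom)
      thus "smult (coeff (r j) 0) (h ^ M) * monom 1 j = h ^ M * monom (coeff (r j) 0) j" by simp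
    qed
    finally have "g dvd h ^ M * s" by simp
    hence "g dvd s" by (rule coprime_dvd_cancel[OF poly_coprime_power[OF cop(2)]])
    hence "s = 0" using small 2 by (intro degree_less_of_dvd[of g s]) (auto simp: s_def)
    hence top: "coeff (r j) 0 = 0" if "j < N" for j using cf[OF that, of "\<lambda>j. coeff (r j) 0"] by (simp add: s_def)
    show ?thesis
    proof (cases "M = 0")
      case True
      thus ?thesis using top M by (metis leading_coeff_0_iff le_zero_eq)
    next
      case False
      have "\<exists>t. \<forall>j<N. r j = pCons 0 (t j)"
      proof (intro exI allI impI)
        fix j assume "j < N"
        thus "r j = pCons 0 (poly_shift 1 (r j))"
          using top[of j] by (intro poly_eqI) (auto simp: coeff_poly_shift coeff_pCons split: nat.splits)
      qed
      then obtain t where t: "\<And>j. j < N \<Longrightarrow> r j = pCons 0 (t j)" by blast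
      have "w * (\<Sum>j<N. (to_fract (t j) \<circ>\<^sub>r w) * ratfun_X ^ j) = 
          (\<Sum>j<N. (to_fract (r j) \<circ>\<^sub>r w) * ratfun_X ^ j)"
        unfolding sum_distrib_left
      proof (intro sum.cong refl)
        fix j assume "j \<in> {..<N}"
        hence "to_fract (r j) \<circ>\<^sub>r w = w * (to_fract (t j) \<circ>\<^sub>r w)"
          using t[of j] by (simp add: to_fract_compose[OF w] map_poly_pCons)
        thus "w * ((to_fract (t j) \<circ>\<^sub>r w) * ratfun_X ^ j) = (to_fract (r j) \<circ>\<^sub>r w) * ratfun_X ^ j"
          by simp
      qed
      moreover have "w \<noteq> 0" using w by (metis ratfun_const_0 ratfun_degree_const not_one_le_zero)
      ultimately have z': "(\<Sum>j<N. (to_fract (t j) \<circ>\<^sub>r w) * ratfun_X ^ j) = 0" using z by simp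
      have "\<forall>j<N. t j = 0"
      proof (rule IH[OF False z'])
        fix j assume "j < N"
        thus "degree (t j) \<le> M - 1" using M[of j] t[of j] by (cases "t j = 0") auto
      qed
      thus ?thesis using t by simp
    qed
  qed
qed


lemma coeval_smult: "ratfun_degree w \<ge> 1 \<Longrightarrow> coeval w (smult c p) z = (c \<circ>\<^sub>r w) * coeval w p z"
  using poly_eval.peval_smult[OF poly_eval_compose, of w z c p]
  by (simp add: coeval_def poly_eval.peval_def[OF poly_eval_compose])

lemma coeval_sum_le:
  assumes "ratfun_degree w \<ge> 1" "degree p < n \<or> p = 0"
  shows "coeval w p z = (\<Sum>i<n. (coeff p i \<circ>\<^sub>r w) * z ^ i)"
proof -
  interpret W: poly_eval "\<lambda>c. c \<circ>\<^sub>r w" z by (rule poly_eval_compose[OF assms(1)])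
  have "(\<Sum>i<n. (coeff p i \<circ>\<^sub>r w) * z ^ i) = (\<Sum>i\<le>degree p. (coeff p i \<circ>\<^sub>r w) * z ^ i)"
  proof (cases "p = 0")
    case False
    thus ?thesis using assms(2)
      by (intro sum.mono_neutral_right) (auto simp: coeff_eq_0 compose_0[OF assms(1)])
  qed (simp add: compose_0[OF assms(1)])
  thus ?thesis using W.peval_altdef[of p] by (simp add: W.peval_def coeval_def)
qed

text \<open>Together with the annihilator below this says \<open>[K(x) : K(w)] = deg w\<close>.\<close>

theorem X_degree_bound:
  assumes w: "ratfun_degree w \<ge> 1" and p: "p \<noteq> 0" "coeval w p ratfun_X = 0"
  shows "ratfun_degree w \<le> degree p"
proof (rule ccontr)
  assume "\<not> ?thesis"
  hence less: "degree p < ratfun_degree w" by simp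
  obtain b A where bA: "b \<noteq> 0" "smult (to_fract b) p = map_poly to_fract A" using common_denominator by blast
  have "coeval w (smult (to_fract b) p) ratfun_X = 0" using p(2) by (simp add: coeval_smult[OF w])
  moreover have "degree (map_poly to_fract A) < ratfun_degree w" using less bA by (metis degree_smult_eq to_fract_eq_0_iff)
  ultimately have "(\<Sum>i<ratfun_degree w. (to_fract (coeff A i) \<circ>\<^sub>r w) * ratfun_X ^ i) = 0"
    using coeval_sum_le[OF w, of "map_poly to_fract A" "ratfun_degree w" ratfun_X]
    by (simp add: bA(2) coeff_map_poly)
  moreover have "degree (coeff A j) \<le> (\<Sum>i\<le>degree A. degree (coeff A i))" for j
    by (cases "j \<le> degree A") (auto intro: member_le_sum simp: coeff_eq_0)
  ultimately have "\<forall>j<ratfun_degree w. coeff A j = 0"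
    using X_independent_poly[OF w refl, of "coeff A" "\<Sum>i\<le>degree A. degree (coeff A i)"] by blast
  moreover have "degree A < ratfun_degree w"
    using \<open>degree (map_poly to_fract A) < _\<close> by (simp add: degree_map_poly)
  ultimately have "A = 0" by (metis leading_coeff_0_iff)
  thus False using bA p(1) by simp
qed

text \<open>The minimal polynomial of \<open>x\<close> over \<open>K(w)\<close>, \<open>w = g/h\<close>, is \<open>g(T) - w h(T)\<close> up to a factor.\<close>

lemma X_annihilator:
  fixes w :: "'a::field ratfun"
  assumes w: "ratfun_degree w \<ge> 1"
  defines "F \<equiv> map_poly ratfun_const (numer w) - smult w (map_poly ratfun_const (denom w))"
  shows "poly F ratfun_X = 0" and "degree F = ratfun_degree w"
proof -
  have nz: "denom w \<noteq> 0" by (rule denom_nonzero)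
  show "poly F ratfun_X = 0" unfolding F_def
    by (simp add: poly_map_poly_ratfun_const_X) (subst (2) ratfun_quot, simp add: nz)
  have 0: "a = 0 \<and> b = 0" if "ratfun_const a - w * ratfun_const b = 0" for a b
  proof (cases "b = 0")
    case False
    hence "w = ratfun_const (a / b)" using that by (simp add: ratfun_const_divide field_simps)
    thus ?thesis using w by simp
  qed (use that in simp)
  have cf: "coeff F i = ratfun_const (coeff (numer w) i) - w * ratfun_const (coeff (denom w) i)" for i
    by (simp add: F_def)
  show "degree F = ratfun_degree w"
  proof (rule antisym)
    show "degree F \<le> ratfun_degree w" unfolding F_def ratfun_degree_def
      by (intro degree_diff_le_max[THEN order_trans]) (auto intro: order_trans[OF degree_smult_le])
    have "coeff (numer w) (ratfun_degree w) \<noteq> 0 \<or> coeff (denom w) (ratfun_degree w) \<noteq> 0"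
    proof (cases "degree (denom w) = ratfun_degree w")
      case True
      thus ?thesis using nz by (metis leading_coeff_0_iff)
    next
      case False
      hence "degree (numer w) = ratfun_degree w" by (auto simp: ratfun_degree_def max_def)
      thus ?thesis using w by (metis degree_0 leading_coeff_0_iff not_one_le_zero)
    qed
    hence "coeff F (ratfun_degree w) \<noteq> 0" unfolding cf using 0 by blast
    thus "ratfun_degree w \<le> degree F" by (rule le_degree)
  qed
qed

definition ratfun_subfield :: "'a::field ratfun set \<Rightarrow> bool" where
  "ratfun_subfield E \<longleftrightarrow> (\<forall>c. ratfun_const c \<in> E) \<and>
     (\<forall>f\<in>E. \<forall>g\<in>E. f + g \<in> E \<and> f * g \<in> E) \<and> (\<forall>f\<in>E. inverse f \<in> E)"

lemma ratfun_subfieldD: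
  assumes "ratfun_subfield E"
  shows "ratfun_const c \<in> E" "f \<in> E \<Longrightarrow> g \<in> E \<Longrightarrow> f + g \<in> E" "f \<in> E \<Longrightarrow> g \<in> E \<Longrightarrow> f * g \<in> E"
    "f \<in> E \<Longrightarrow> inverse f \<in> E" "f \<in> E \<Longrightarrow> g \<in> E \<Longrightarrow> f / g \<in> E" "f \<in> E \<Longrightarrow> - f \<in> E"
    "f \<in> E \<Longrightarrow> g \<in> E \<Longrightarrow> f - g \<in> E" "0 \<in> E" "1 \<in> E"
proof -
  note E = assms[unfolded ratfun_subfield_def]
  show c: "ratfun_const c \<in> E" for c using E by blast
  show "0 \<in> E" "1 \<in> E" using c[of 0] c[of 1] by auto
  show 1: "f + g \<in> E" "f * g \<in> E" if "f \<in> E" "g \<in> E" for f g using E that by blast+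
  show 2: "inverse f \<in> E" if "f \<in> E" for f using E that by blast
  show "f / g \<in> E" if "f \<in> E" "g \<in> E" for f g using 1 2 that by (simp add: divide_inverse)
  show 3: "- f \<in> E" if "f \<in> E" for f
  proof -
    have "- f = ratfun_const (-1) * f" by (simp add: ratfun_const_minus)
    thus ?thesis using 1(2)[OF c that] by simp
  qed
  show "f - g \<in> E" if "f \<in> E" "g \<in> E" for f g using 1(1)[OF that(1) 3[OF that(2)]] by simp
qed

lemma ratfun_subfield_poly:
  assumes E: "ratfun_subfield E" and z: "z \<in> E" and p: "\<And>i. coeff p i \<in> E"
  shows "poly p z \<in> E"
proof -
  have pow: "z ^ i \<in> E" for i
    by (induction i) (auto intro: ratfun_subfieldD[OF E] z)
  have "(\<Sum>i\<in>A. coeff p i * z ^ i) \<in> E" for A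
    by (induction A rule: infinite_finite_induct) (auto intro!: ratfun_subfieldD[OF E] p pow)
  thus ?thesis by (simp add: poly_altdef)
qed

lemma ratfun_subfield_compose:
  assumes E: "ratfun_subfield E" and w: "w \<in> E"
  shows "c \<circ>\<^sub>r w \<in> E"
  unfolding ratfun_compose_def
  by (intro ratfun_subfieldD[OF E] ratfun_subfield_poly[OF E w]) (simp_all add: ratfun_subfieldD[OF E])

lemma ratfun_subfield_full:
  assumes E: "ratfun_subfield E" and X: "ratfun_X \<in> E"
  shows "E = UNIV"
  using ratfun_subfield_compose[OF E X] by (auto simp: ratfun_compose_X)

lemma ratfun_subfield_range:
  assumes "ratfun_degree w \<ge> 1"
  shows "ratfun_subfield (range (\<lambda>c. c \<circ>\<^sub>r w))"
  unfolding ratfun_subfield_def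
proof (intro conjI allI ballI)
  let ?R = "range (\<lambda>c. c \<circ>\<^sub>r w)"
  show "ratfun_const c \<in> ?R" for c
    by (rule range_eqI[of _ _ "ratfun_const c"]) (simp add: compose_const[OF assms])
  fix f g assume "f \<in> ?R" "g \<in> ?R"
  then obtain a b where ab: "f = a \<circ>\<^sub>r w" "g = b \<circ>\<^sub>r w" by blast
  show "f + g \<in> ?R" by (rule range_eqI[of _ _ "a + b"]) (simp add: ab compose_add[OF assms])
  show "f * g \<in> ?R" by (rule range_eqI[of _ _ "a * b"]) (simp add: ab compose_mult[OF assms])
next
  let ?R = "range (\<lambda>c. c \<circ>\<^sub>r w)"
  fix f assume "f \<in> ?R"
  then obtain a where a: "f = a \<circ>\<^sub>r w" by blast
  show "inverse f \<in> ?R" by (rule range_eqI[of _ _ "inverse a"]) (simp add: a compose_inverse[OF assms])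
qed

lemma ratfun_subfield_adjoin:
  assumes u: "ratfun_degree u \<ge> 1" and p: "p \<noteq> 0" "coeval u p v = 0"
  shows "ratfun_subfield (range (\<lambda>q. coeval u q v))"
    and "u \<in> range (\<lambda>q. coeval u q v)" and "v \<in> range (\<lambda>q. coeval u q v)"
    and "\<exists>r. (r = 0 \<or> degree r < degree p) \<and> coeval u q v = coeval u r v"
proof -
  interpret U: poly_eval "\<lambda>c. c \<circ>\<^sub>r u" v by (rule poly_eval_compose[OF u])
  have eq: "coeval u q v = U.peval q" for q by (simp add: coeval_def U.peval_def)
  have p': "U.peval p = 0" using p(2) by (simp add: eq)
  show u': "u \<in> range (\<lambda>q. coeval u q v)"
    by (rule range_eqI[of _ _ "[:ratfun_X:]"]) (simp add: eq X_compose[OF u])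
  show "v \<in> range (\<lambda>q. coeval u q v)"
    by (rule range_eqI[of _ _ "[:0, 1:]"]) (simp add: eq)
  show "ratfun_subfield (range (\<lambda>q. coeval u q v))"
    unfolding ratfun_subfield_def eq
  proof (intro conjI allI ballI)
    show "ratfun_const c \<in> range U.peval" for c
      by (rule range_eqI[of _ _ "[:ratfun_const c:]"]) (simp add: compose_const[OF u])
    fix f g assume "f \<in> range U.peval" "g \<in> range U.peval"
    then obtain a b where ab: "f = U.peval a" "g = U.peval b" by blast
    show "f + g \<in> range U.peval" unfolding ab U.peval_add[symmetric] by blast
    show "f * g \<in> range U.peval" unfolding ab U.peval_mult[symmetric] by blast
  next
    show "inverse f \<in> range U.peval" if "f \<in> range U.peval" for f
      using that U.range_peval_inverse[OF p' p(1)] by auto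
  qed
  show "\<exists>r. (r = 0 \<or> degree r < degree p) \<and> coeval u q v = coeval u r v"
    unfolding eq by (rule U.range_peval_reduced[OF p' p(1)])
qed

theorem X_powers_span:
  assumes w: "ratfun_degree w \<ge> 1"
  shows "\<exists>r. (r = 0 \<or> degree r < ratfun_degree w) \<and> z = coeval w r ratfun_X"
proof -
  define F where "F = map_poly ratfun_const (numer w) - smult w (map_poly ratfun_const (denom w))"
  have F: "poly F ratfun_X = 0" "degree F = ratfun_degree w" unfolding F_def by (rule X_annihilator[OF w])+
  define G where "G = map_poly (\<lambda>c. ratfun_const c) (numer w) - smult ratfun_X (map_poly ratfun_const (denom w))"
  have cf: "map_poly (\<lambda>c. c \<circ>\<^sub>r w) G = F"
    by (rule poly_eqI) (simp add: coeff_map_poly G_def F_def compose_0[OF w] compose_diff[OF w]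
      compose_mult[OF w] compose_const[OF w] X_compose[OF w])
  have dG: "degree G = ratfun_degree w"
    unfolding F(2)[symmetric] cf[symmetric]
    by (rule degree_map_poly[symmetric]) (simp add: compose_eq_0_iff[OF w])
  have G: "G \<noteq> 0" "coeval w G ratfun_X = 0" using F w dG by (auto simp: coeval_def cf)
  have "z \<in> range (\<lambda>q. coeval w q ratfun_X)"
    using ratfun_subfield_full[OF ratfun_subfield_adjoin(1,3)[OF w G]] by simp
  thus ?thesis using ratfun_subfield_adjoin(4)[OF w G] dG by force
qed

section \<open>Lueroth's theorem\<close>

lemma ratfun_degree_quot_le:
  assumes "Q \<noteq> 0" "z * to_fract Q = to_fract P"
  shows "ratfun_degree z \<le> max (degree P) (degree Q)"
proof -
  have z: "z * to_fract (denom z) = to_fract (numer z)"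
    using denom_nonzero[of z] by (subst (1) ratfun_quot) simp
  have "to_fract (numer z * Q) = z * to_fract Q * to_fract (denom z)" by (simp add: z[symmetric] mult_ac)
  hence "to_fract (numer z * Q) = to_fract (P * denom z)" by (simp add: assms(2))
  hence eq: "numer z * Q = P * denom z" by (simp only: to_fract_eq_iff)
  have "denom z dvd Q" using coprime_dvd_cancel[OF numer_denom(2)[of z]] eq by (metis dvd_triv_right)
  then obtain k where k: "Q = denom z * k" by (elim dvdE)
  have "P = numer z * k" using eq denom_nonzero[of z] by (simp add: k mult_ac)
  moreover have "k \<noteq> 0" using k assms(1) by auto
  ultimately have "degree (numer z) \<le> degree P" "degree (denom z) \<le> degree Q"
    using k by (metis degree_mult_right_le)+
  thus ?thesis by (auto simp: ratfun_degree_def)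
qed

text \<open>The coefficient of \<open>x\<^sup>m\<close>, as a polynomial in \<open>T\<close>, of an element of \<open>K[x][T]\<close>.\<close>

definition x_coeff :: "nat \<Rightarrow> 'a::field poly poly \<Rightarrow> 'a poly" where
  "x_coeff m A = map_poly (\<lambda>c. coeff c m) A"

lemma coeff_x_coeff [simp]: "coeff (x_coeff m A) i = coeff (coeff A i) m"
  by (simp add: x_coeff_def coeff_map_poly)

lemma x_coeff_mult_top:
  assumes "\<And>i. degree (coeff A i) \<le> m" "\<And>i. degree (coeff B i) \<le> k"
  shows "x_coeff (m + k) (A * B) = x_coeff m A * x_coeff k B"
proof (rule poly_eqI)
  fix n
  have "coeff (x_coeff (m + k) (A * B)) n = (\<Sum>i\<le>n. coeff (coeff A i * coeff B (n - i)) (m + k))"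
    by (simp only: coeff_x_coeff coeff_mult[of A B] coeff_sum)
  also have "\<dots> = (\<Sum>i\<le>n. coeff (coeff A i) m * coeff (coeff B (n - i)) k)"
    by (simp only: coeff_mult_top[OF assms])
  also have "\<dots> = coeff (x_coeff m A * x_coeff k B) n"
    by (simp add: coeff_mult)
  finally show "coeff (x_coeff (m + k) (A * B)) n = coeff (x_coeff m A * x_coeff k B) n" .
qed

definition x_degree :: "'a::field poly poly \<Rightarrow> nat" where
  "x_degree A = Max (insert 0 ((\<lambda>i. degree (coeff A i)) ` {..degree A}))"

lemma degree_coeff_le_x_degree: "degree (coeff A i) \<le> x_degree A"
proof (cases "i \<le> degree A")
  case True
  thus ?thesis unfolding x_degree_def by (intro Max_ge) auto
qed (simp add: coeff_eq_0)

lemma x_coeff_x_degree_nonzero: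
  assumes "A \<noteq> 0"
  shows "x_coeff (x_degree A) A \<noteq> 0"
proof -
  have "x_degree A \<in> insert 0 ((\<lambda>i. degree (coeff A i)) ` {..degree A})"
    unfolding x_degree_def by (intro Max_in) auto
  then consider "x_degree A = 0" | i where "x_degree A = degree (coeff A i)" "x_degree A \<noteq> 0" by force
  then obtain i where i: "coeff A i \<noteq> 0" "x_degree A = degree (coeff A i)"
  proof cases
    case 1
    have "degree (coeff A (degree A)) = 0" using degree_coeff_le_x_degree[of A "degree A"] 1 by simp
    thus ?thesis using that[of "degree A"] assms 1 by simp
  next
    case (2 i)
    thus ?thesis using that[of i] by (cases "coeff A i = 0") auto
  qed
  hence "coeff (x_coeff (x_degree A) A) i \<noteq> 0" by simp
  thus ?thesis by (metis coeff_0)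
qed

lemma division_over_subfield:
  assumes E: "ratfun_subfield E" and p: "p \<noteq> 0" "lead_coeff p = 1" "\<And>i. coeff p i \<in> E"
    and F: "\<And>i. coeff F i \<in> E"
  shows "\<exists>q r. F = p * q + r \<and> (r = 0 \<or> degree r < degree p) \<and> (\<forall>i. coeff r i \<in> E)"
  using F
proof (induction "degree F" arbitrary: F rule: less_induct)
  case less
  show ?case
  proof (cases "F = 0 \<or> degree F < degree p")
    case True
    thus ?thesis using less.prems by (intro exI[of _ 0] exI[of _ F]) auto
  next
    case False
    define t where "t = monom (lead_coeff F) (degree F - degree p)"
    have t0: "t \<noteq> 0" "degree t = degree F - degree p" using False by (auto simp: t_def degree_monom_eq)
    have dpt: "degree (p * t) = degree F"
      using False p t0 by (simp add: degree_mult_eq)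
    moreover have "lead_coeff (p * t) = lead_coeff F"
      unfolding lead_coeff_mult p(2) by (simp add: t0(2)) (simp add: t_def)
    ultimately have dpt: "degree (p * t) = degree F" "coeff (p * t) (degree F) = lead_coeff F" by auto
    define G where "G = F - p * t"
    have "coeff (p * t) i \<in> E" for i
      using p(3) less.prems ratfun_subfieldD(3,8)[OF E]
      by (simp add: t_def mult.commute[of p] coeff_monom_mult del: mult_monom)
    hence GE: "coeff G i \<in> E" for i using less.prems ratfun_subfieldD(7)[OF E] by (simp add: G_def)
    show ?thesis
    proof (cases "G = 0")
      case True
      thus ?thesis using ratfun_subfieldD(8)[OF E] by (intro exI[of _ t] exI[of _ 0]) (auto simp: G_def)
    next
      case G: False
      have "coeff G (degree F) = 0" using dpt by (simp add: G_def)
      moreover have "degree G \<le> degree F" unfolding G_def by (intro degree_diff_le) (auto simp: dpt)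
      ultimately have "degree G < degree F" using G by (metis leading_coeff_0_iff le_neq_implies_less)
      from less.hyps[OF this GE] obtain q r where
        "G = p * q + r" "r = 0 \<or> degree r < degree p" "\<forall>i. coeff r i \<in> E" by blast
      thus ?thesis by (intro exI[of _ "q + t"] exI[of _ r]) (simp add: G_def algebra_simps)
    qed
  qed
qed

text \<open>Choose \<open>w = g/h\<close> in \<open>E\<close> of minimal degree \<open>N\<close>. The minimal polynomial \<open>p\<close> of \<open>x\<close> over \<open>E\<close> divides
\<open>g(T) - w h(T)\<close>, so by Gauss's lemma \<open>L = h(x) g(T) - g(x) h(T)\<close> factors in \<open>K[x][T]\<close> as \<open>P Q\<close> with \<open>P\<close>
proportional to \<open>p\<close>. Some coefficient of \<open>p\<close> is not constant and has degree at least \<open>N\<close>, hence \<open>P\<close> has degree at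
least \<open>N\<close> in \<open>x\<close>. As \<open>L\<close> has degree at most \<open>N\<close> in \<open>x\<close>, the factor \<open>Q\<close> does not involve \<open>x\<close>; then it
divides \<open>g\<close> and \<open>h\<close> and is constant. So \<open>[K(x) : E] = N = [K(x) : K(w)]\<close>.\<close>

theorem lueroth:
  fixes E :: "'a::field ratfun set"
  assumes E: "ratfun_subfield E" and nc: "z0 \<in> E" "ratfun_degree z0 \<ge> 1"
  shows "\<exists>w. ratfun_degree w \<ge> 1 \<and> E = range (\<lambda>c. c \<circ>\<^sub>r w)"
proof -
  obtain w where w: "w \<in> E" "ratfun_degree w \<ge> 1"
    and minw: "\<And>z. z \<in> E \<Longrightarrow> ratfun_degree z \<ge> 1 \<Longrightarrow> ratfun_degree w \<le> ratfun_degree z"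
    using ex_has_least_nat[of "\<lambda>z. z \<in> E \<and> ratfun_degree z \<ge> 1" z0 ratfun_degree] nc by auto
  define N g h where "N = ratfun_degree w" and "g = numer w" and "h = denom w"
  have h0: "h \<noteq> 0" by (simp add: h_def denom_nonzero)
  define F where "F = map_poly ratfun_const g - smult w (map_poly ratfun_const h)"
  have F: "poly F ratfun_X = 0" "degree F = N"
    unfolding F_def g_def h_def N_def by (rule X_annihilator[OF w(2)])+
  have F0: "F \<noteq> 0" using F w by (auto simp: N_def)
  have FE: "coeff F i \<in> E" for i
    using w(1) by (simp add: F_def ratfun_subfieldD[OF E])
  define annih where "annih = (\<lambda>p. p \<noteq> 0 \<and> (\<forall>i. coeff p i \<in> E) \<and> poly p ratfun_X = 0)"
  obtain p0 where p0: "annih p0" and min0: "\<And>q. annih q \<Longrightarrow> degree p0 \<le> degree q"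
    using ex_has_least_nat[of annih F degree] F F0 FE by (auto simp: annih_def)
  define p where "p = smult (inverse (lead_coeff p0)) p0"
  have p: "p \<noteq> 0" "lead_coeff p = 1" "\<And>i. coeff p i \<in> E" "poly p ratfun_X = 0"
    using p0 by (auto simp: p_def annih_def intro!: ratfun_subfieldD[OF E])
  have min: "q = 0" if "\<And>i. coeff q i \<in> E" "poly q ratfun_X = 0" "q = 0 \<or> degree q < degree p" for q
    using min0[of q] that p0 by (cases "q = 0") (auto simp: annih_def p_def)
  obtain q r where qr: "F = p * q + r" "r = 0 \<or> degree r < degree p" "\<forall>i. coeff r i \<in> E"
    using division_over_subfield[OF E p(1,2,3) FE] by blast
  have "r = 0" using qr F(1) p(4) by (intro min) auto
  hence Fpq: "F = p * q" using qr by simp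
  define L where "L = map_poly (\<lambda>c. smult c h) g - map_poly (\<lambda>c. smult c g) h"
  have cL: "coeff L i = smult (coeff g i) h - smult (coeff h i) g" for i
    by (simp add: L_def coeff_map_poly)
  have weq: "w * to_fract h = to_fract g" using h0 by (simp add: g_def h_def) (subst ratfun_quot, simp)
  have "map_poly to_fract L = smult (to_fract h) F"
  proof (rule poly_eqI)
    fix i
    have "to_fract (coeff L i) = to_fract h * (ratfun_const (coeff g i) - w * ratfun_const (coeff h i))"
      by (simp add: cL to_fract_smult right_diff_distrib mult_ac flip: weq)
    thus "coeff (map_poly to_fract L) i = coeff (smult (to_fract h) F) i"
      by (simp add: coeff_map_poly F_def)
  qed
  hence mL: "map_poly to_fract L = p * smult (to_fract h) q" by (simp add: Fpq)
  obtain P Q c where PQ: "c \<noteq> 0" "L = P * Q" "map_poly to_fract P = smult c p"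
    using gauss_lemma[OF mL] by blast
  have dL: "degree L = N"
    using \<open>map_poly to_fract L = smult (to_fract h) F\<close> h0 F(2)
    by (metis degree_smult_eq degree_map_poly to_fract_eq_0_iff)
  have L0: "L \<noteq> 0" using dL w by (auto simp: N_def)
  have P0: "P \<noteq> 0" "Q \<noteq> 0" using L0 PQ(2) by auto
  have dP: "degree P = degree p"
    using PQ(1,3) by (metis degree_smult_eq degree_map_poly to_fract_eq_0_iff)
  have "\<exists>i. ratfun_degree (coeff p i) \<ge> 1"
  proof (rule ccontr)
    assume "\<not> ?thesis"
    hence "ratfun_degree (coeff p i) = 0" for i by (metis less_one not_le)
    hence "\<forall>i. \<exists>a. coeff p i = ratfun_const a" unfolding degree_eq_0_iff_const by blast
    then obtain a where a: "\<And>i. coeff p i = ratfun_const (a i)" by metis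
    define s where "s = Poly (map a [0..<Suc (degree p)])"
    have "coeff s i = a i" for i
      using a[of i] by (auto simp: s_def nth_default_def coeff_eq_0 simp del: upt_Suc)
    hence ps: "p = map_poly ratfun_const s" by (intro poly_eqI) (simp add: a)
    hence "s = 0" using p(4) by (simp add: ps poly_map_poly_ratfun_const_X)
    thus False using ps p(1) by simp
  qed
  then obtain i where i: "ratfun_degree (coeff p i) \<ge> 1" by blast
  have "coeff p i * to_fract (lead_coeff P) = to_fract (coeff P i)"
  proof -
    have "to_fract (coeff P j) = c * coeff p j" for j
      using arg_cong[OF PQ(3), of "\<lambda>p. coeff p j"] by (simp add: coeff_map_poly)
    thus ?thesis using p(2) by (simp add: dP)
  qed
  hence "ratfun_degree (coeff p i) \<le> max (degree (coeff P i)) (degree (lead_coeff P))"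
    using P0(1) by (intro ratfun_degree_quot_le) auto
  hence "N \<le> x_degree P"
    using minw[OF p(3) i] degree_coeff_le_x_degree[of P i] degree_coeff_le_x_degree[of P "degree P"]
    by (auto simp: N_def)
  have xL: "x_coeff (x_degree P + x_degree Q) L = x_coeff (x_degree P) P * x_coeff (x_degree Q) Q"
    unfolding PQ(2) by (rule x_coeff_mult_top) (rule degree_coeff_le_x_degree)+
  have "x_coeff (x_degree P + x_degree Q) L \<noteq> 0"
    unfolding xL using P0 x_coeff_x_degree_nonzero by auto
  then obtain j where "coeff (coeff L j) (x_degree P + x_degree Q) \<noteq> 0"
    by (metis coeff_x_coeff leading_coeff_0_iff)
  hence "x_degree P + x_degree Q \<le> degree (coeff L j)" by (rule le_degree)
  also have "\<dots> \<le> N" unfolding cL N_def ratfun_degree_def g_def[symmetric] h_def[symmetric]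
    by (intro degree_diff_le) (auto intro: order_trans[OF degree_smult_le])
  finally have xQ: "x_degree Q = 0" using \<open>N \<le> x_degree P\<close> by simp
  have xLk: "x_coeff k L = x_coeff k P * x_coeff 0 Q" for k
  proof (rule poly_eqI)
    fix n
    have "coeff (A * B) k = coeff A k * coeff B 0" if "degree B \<le> 0" for A B :: "'a poly"
      using that by (auto elim!: degree_eq_zeroE)
    thus "coeff (x_coeff k L) n = coeff (x_coeff k P * x_coeff 0 Q) n"
      using degree_coeff_le_x_degree[of Q] by (simp add: PQ(2) coeff_mult coeff_sum xQ)
  qed
  define Q0 where "Q0 = x_coeff 0 Q"
  have dvd: "Q0 dvd smult (coeff h k) g - smult (coeff g k) h" for k
  proof -
    have "x_coeff k L = smult (coeff h k) g - smult (coeff g k) h"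
      by (rule poly_eqI) (simp add: cL mult.commute)
    thus ?thesis by (metis xLk Q0_def dvd_triv_right)
  qed
  have "is_unit Q0"
  proof -
    obtain k where k: "coeff h k \<noteq> 0" using h0 by (metis leading_coeff_0_iff)
    have ex: "\<exists>k'. coeff h k' * coeff g k - coeff g k' * coeff h k \<noteq> 0"
    proof (rule ccontr)
      assume "\<not> ?thesis"
      hence "g = smult (coeff g k / coeff h k) h" using k by (intro poly_eqI) (simp add: field_simps)
      hence "to_fract g = ratfun_const (coeff g k / coeff h k) * to_fract h" by (metis to_fract_smult)
      hence "w = ratfun_const (coeff g k / coeff h k)" using weq h0 by simp
      thus False using w(2) by simp
    qed
    then obtain k' where k': "coeff h k' * coeff g k - coeff g k' * coeff h k \<noteq> 0" by blast
    let ?d = "coeff h k' * coeff g k - coeff g k' * coeff h k"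
    have "Q0 dvd smult (coeff h k) (smult (coeff h k') g - smult (coeff g k') h)
        - smult (coeff h k') (smult (coeff h k) g - smult (coeff g k) h)"
      by (intro dvd_diff dvd_smult dvd)
    also have "\<dots> = smult ?d h" by (rule poly_eqI) (simp add: algebra_simps)
    finally have "Q0 dvd h" using k' by (simp add: dvd_smult_iff)
    have "Q0 dvd smult (coeff h k) g"
      using dvd_add[OF dvd[of k] dvd_smult[OF \<open>Q0 dvd h\<close>, of "coeff g k"]] by simp
    hence "Q0 dvd g" using k by (simp add: dvd_smult_iff)
    thus ?thesis using \<open>Q0 dvd h\<close> numer_denom(2)[of w] unfolding g_def h_def
      by (metis coprime_common_divisor)
  qed
  have "degree Q = 0"
  proof (rule ccontr)
    assume "degree Q \<noteq> 0"
    have "degree (lead_coeff Q) = 0" using degree_coeff_le_x_degree[of Q "degree Q"] xQ by simp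
    hence "coeff (lead_coeff Q) 0 \<noteq> 0" using P0(2) by (metis leading_coeff_0_iff)
    hence "coeff Q0 (degree Q) \<noteq> 0" by (simp add: Q0_def)
    hence "degree Q0 \<noteq> 0" using \<open>degree Q \<noteq> 0\<close> le_degree by fastforce
    thus False using \<open>is_unit Q0\<close> by (metis is_unit_iff_degree not_is_unit_0)
  qed
  hence dpN: "degree p = N" using dL P0 dP by (simp add: PQ(2) degree_mult_eq)
  have "E = range (\<lambda>c. c \<circ>\<^sub>r w)"
  proof
    show "range (\<lambda>c. c \<circ>\<^sub>r w) \<subseteq> E" using ratfun_subfield_compose[OF E w(1)] by blast
    show "E \<subseteq> range (\<lambda>c. c \<circ>\<^sub>r w)"
    proof
      fix z assume z: "z \<in> E"
      obtain s where s: "s = 0 \<or> degree s < N" "z = coeval w s ratfun_X"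
        using X_powers_span[OF w(2), of z] by (auto simp: N_def)
      define t where "t = map_poly (\<lambda>c. c \<circ>\<^sub>r w) s - [:z:]"
      have "t = 0"
      proof (rule min)
        show "poly t ratfun_X = 0" using s(2) by (simp add: t_def coeval_def)
        show "coeff t i \<in> E" for i
          using z by (auto simp: t_def coeff_map_poly compose_0[OF w(2)] coeff_pCons
            split: nat.splits intro!: ratfun_subfieldD[OF E] ratfun_subfield_compose[OF E w(1)])
        have "degree t < N" unfolding t_def
        proof (intro degree_diff_less)
          show "degree (map_poly (\<lambda>c. c \<circ>\<^sub>r w) s) < N"
            using s(1) w(2) degree_map_poly[of "\<lambda>c. c \<circ>\<^sub>r w" s]
            by (auto simp: N_def compose_eq_0_iff[OF w(2)])
        qed (use w(2) N_def in auto)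
        thus "t = 0 \<or> degree t < degree p" by (simp add: dpN)
      qed
      hence "coeff t 0 = 0" by simp
      hence "z = coeff s 0 \<circ>\<^sub>r w" by (simp add: t_def coeff_map_poly compose_0[OF w(2)])
      thus "z \<in> range (\<lambda>c. c \<circ>\<^sub>r w)" by blast
    qed
  qed
  thus ?thesis using w(2) by blast
qed

section \<open>Indecomposable right factors\<close>

text \<open>As \<open>[K(x) : K(\<mu>)] = 1\<close>, \<open>x\<close> is a function of \<open>\<mu>\<close>.\<close>

lemma mobius_inverse:
  assumes "ratfun_degree \<mu> = 1"
  shows "\<exists>\<nu>. ratfun_degree \<nu> = 1 \<and> \<nu> \<circ>\<^sub>r \<mu> = ratfun_X \<and> \<mu> \<circ>\<^sub>r \<nu> = ratfun_X"
proof -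
  have \<mu>: "ratfun_degree \<mu> \<ge> 1" using assms by simp
  obtain r where r: "r = 0 \<or> degree r < 1" "ratfun_X = coeval \<mu> r ratfun_X"
    using X_powers_span[OF \<mu>, of ratfun_X] assms by auto
  then obtain \<nu> where "r = [:\<nu>:]" by (metis degree_eq_zeroE less_one degree_0)
  hence \<nu>: "\<nu> \<circ>\<^sub>r \<mu> = ratfun_X" using r(2) by (simp add: coeval_def map_poly_pCons compose_0[OF \<mu>])
  hence d: "ratfun_degree \<nu> = 1" using ratfun_degree_compose[OF \<mu>, of \<nu>] assms by simp
  have "(\<mu> \<circ>\<^sub>r \<nu>) \<circ>\<^sub>r \<mu> = ratfun_X \<circ>\<^sub>r \<mu>"
    using d by (simp add: compose_assoc[OF \<mu>] \<nu> ratfun_compose_X X_compose[OF \<mu>])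
  hence "\<mu> \<circ>\<^sub>r \<nu> = ratfun_X" by (simp add: compose_inj[OF \<mu>])
  thus ?thesis using \<nu> d by blast
qed

lemma ratfun_subfield_Int: "ratfun_subfield E \<Longrightarrow> ratfun_subfield E' \<Longrightarrow> ratfun_subfield (E \<inter> E')"
  unfolding ratfun_subfield_def by simp

lemma indecomposable_degree: "indecomposable u \<Longrightarrow> ratfun_degree u > 1"
  by (simp add: indecomposable_def)

lemma indecomposable_compose_cases:
  assumes "indecomposable (a \<circ>\<^sub>r b)" "ratfun_degree b \<ge> 1"
  shows "ratfun_degree a = 1 \<or> ratfun_degree b = 1"
proof -
  have "ratfun_degree a * ratfun_degree b > 1"
    using assms by (metis indecomposable_degree ratfun_degree_compose)
  moreover have "\<not> (ratfun_degree a > 1 \<and> ratfun_degree b > 1)"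
    using assms(1) unfolding indecomposable_def by blast
  moreover have "ratfun_degree a \<noteq> 0" using calculation(1) by (metis less_nat_zero_code mult_0)
  ultimately show ?thesis using assms(2) by linarith
qed

lemma indecomposable_compose_mobius:
  assumes u: "indecomposable u" and \<mu>: "ratfun_degree \<mu> = 1"
  shows "indecomposable (u \<circ>\<^sub>r \<mu>)" "indecomposable (\<mu> \<circ>\<^sub>r u)"
proof -
  obtain \<nu> where \<nu>: "ratfun_degree \<nu> = 1" "\<nu> \<circ>\<^sub>r \<mu> = ratfun_X" "\<mu> \<circ>\<^sub>r \<nu> = ratfun_X"
    using mobius_inverse[OF \<mu>] by blast
  have d: "ratfun_degree u > 1" by (rule indecomposable_degree[OF u])
  hence u1: "ratfun_degree u \<ge> 1" by simp
  have \<mu>1: "ratfun_degree \<mu> \<ge> 1" "ratfun_degree \<nu> \<ge> 1" using \<mu> \<nu> by simp_all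
  show "indecomposable (u \<circ>\<^sub>r \<mu>)"
    unfolding indecomposable_def
  proof (intro conjI notI)
    show "1 < ratfun_degree (u \<circ>\<^sub>r \<mu>)" using d \<mu> by (simp add: ratfun_degree_compose)
    assume "\<exists>a b. 1 < ratfun_degree a \<and> 1 < ratfun_degree b \<and> u \<circ>\<^sub>r \<mu> = a \<circ>\<^sub>r b"
    then obtain a b where ab: "1 < ratfun_degree a" "1 < ratfun_degree b" "u \<circ>\<^sub>r \<mu> = a \<circ>\<^sub>r b" by blast
    have "u = (u \<circ>\<^sub>r \<mu>) \<circ>\<^sub>r \<nu>" using \<mu>1 \<nu> by (simp add: compose_assoc ratfun_compose_X)
    also have "\<dots> = a \<circ>\<^sub>r (b \<circ>\<^sub>r \<nu>)" using ab \<mu>1 by (simp add: compose_assoc)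
    finally have "u = a \<circ>\<^sub>r (b \<circ>\<^sub>r \<nu>)" .
    moreover have "1 < ratfun_degree (b \<circ>\<^sub>r \<nu>)" using ab \<nu> by (simp add: ratfun_degree_compose)
    ultimately show False using u ab(1) by (auto simp: indecomposable_def)
  qed
  show "indecomposable (\<mu> \<circ>\<^sub>r u)"
    unfolding indecomposable_def
  proof (intro conjI notI)
    show "1 < ratfun_degree (\<mu> \<circ>\<^sub>r u)" using d \<mu> by (simp add: ratfun_degree_compose)
    assume "\<exists>a b. 1 < ratfun_degree a \<and> 1 < ratfun_degree b \<and> \<mu> \<circ>\<^sub>r u = a \<circ>\<^sub>r b"
    then obtain a b where ab: "1 < ratfun_degree a" "1 < ratfun_degree b" "\<mu> \<circ>\<^sub>r u = a \<circ>\<^sub>r b" by blast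
    have "u = \<nu> \<circ>\<^sub>r (\<mu> \<circ>\<^sub>r u)" using u1 \<mu>1 \<nu> by (simp add: X_compose flip: compose_assoc)
    also have "\<dots> = (\<nu> \<circ>\<^sub>r a) \<circ>\<^sub>r b" using ab \<mu>1 by (simp add: compose_assoc)
    finally have "u = (\<nu> \<circ>\<^sub>r a) \<circ>\<^sub>r b" .
    moreover have "1 < ratfun_degree (\<nu> \<circ>\<^sub>r a)" using ab \<nu> by (simp add: ratfun_degree_compose)
    ultimately show False using u ab(2) by (auto simp: indecomposable_def)
  qed
qed

lemma algebraic_relation_exists:
  fixes u v :: "'a::field ratfun"
  assumes u: "ratfun_degree u \<ge> 1"
  shows "\<exists>p. p \<noteq> 0 \<and> degree p \<le> ratfun_degree u \<and> coeval u p v = 0"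
proof -
  interpret U: ratfun_eval ratfun_const u by (rule ratfun_eval_const[OF u])
  have ev: "U.eval = (\<lambda>c. c \<circ>\<^sub>r u)" by (intro ext) (simp add: compose_eq_eval[OF u])
  let ?T = "(\<lambda>j. ratfun_X ^ j) ` {..<ratfun_degree u}"
  have "z \<in> U.vs.span ?T" for z
  proof -
    obtain r where r: "r = 0 \<or> degree r < ratfun_degree u" "z = coeval u r ratfun_X"
      using X_powers_span[OF u, of z] by blast
    have "z = (\<Sum>i<ratfun_degree u. U.eval (coeff r i) * ratfun_X ^ i)"
      using r coeval_sum_le[OF u, of r "ratfun_degree u" ratfun_X] by (auto simp: ev)
    also have "\<dots> \<in> U.vs.span ?T" by (intro U.vs.span_sum U.vs.span_scale U.vs.span_base) auto
    finally show ?thesis .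
  qed
  moreover have "card ?T \<le> ratfun_degree u" using card_image_le[of "{..<ratfun_degree u}"] by simp
  ultimately show ?thesis
    using U.powers_dependent[of ?T "ratfun_degree u" v] by (simp add: coeval_def ev)
qed

text \<open>By Lueroth's theorem there is no field strictly between \<open>K(u)\<close> and \<open>K(x)\<close>, so \<open>v\<close> generates \<open>K(x)\<close> over
\<open>K(u)\<close>, and \<open>K(x)\<close> is spanned by \<open>deg p\<close> powers of \<open>v\<close>.\<close>

theorem indecomposable_relation_degree:
  fixes u v :: "'a::field ratfun"
  assumes u: "indecomposable u" and v: "v \<notin> range (\<lambda>c. c \<circ>\<^sub>r u)"
    and p: "p \<noteq> 0" "coeval u p v = 0"
  shows "ratfun_degree u \<le> degree p"
    and "range (\<lambda>q. coeval u q v) = UNIV"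
proof -
  have du: "ratfun_degree u > 1" by (rule indecomposable_degree[OF u])
  hence u1: "ratfun_degree u \<ge> 1" by simp
  note adj = ratfun_subfield_adjoin[OF u1 p]
  obtain w where w: "ratfun_degree w \<ge> 1" "range (\<lambda>q. coeval u q v) = range (\<lambda>c. c \<circ>\<^sub>r w)"
    using lueroth[OF adj(1) adj(2) u1] by blast
  obtain \<alpha> where \<alpha>: "u = \<alpha> \<circ>\<^sub>r w" using adj(2) w(2) by auto
  obtain \<beta> where \<beta>: "v = \<beta> \<circ>\<^sub>r w" using adj(3) w(2) by auto
  have "ratfun_degree w = 1"
  proof (rule ccontr)
    assume "ratfun_degree w \<noteq> 1"
    hence "ratfun_degree \<alpha> = 1" using indecomposable_compose_cases[of \<alpha> w] u w(1) by (simp add: \<alpha>)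
    then obtain \<nu> where \<nu>: "ratfun_degree \<nu> = 1" "\<nu> \<circ>\<^sub>r \<alpha> = ratfun_X" using mobius_inverse by blast
    have "\<nu> \<circ>\<^sub>r u = w" using \<nu> w(1) \<open>ratfun_degree \<alpha> = 1\<close>
      by (simp add: \<alpha> X_compose flip: compose_assoc)
    hence "v = (\<beta> \<circ>\<^sub>r \<nu>) \<circ>\<^sub>r u" using \<nu>(1) u1 by (simp add: \<beta> compose_assoc)
    thus False using v by blast
  qed
  then obtain \<nu> where "\<nu> \<circ>\<^sub>r w = ratfun_X" using mobius_inverse by blast
  hence "ratfun_X \<in> range (\<lambda>q. coeval u q v)" unfolding w(2) by (metis rangeI)
  thus full: "range (\<lambda>q. coeval u q v) = UNIV" by (rule ratfun_subfield_full[OF adj(1)])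
  interpret U: ratfun_eval ratfun_const u by (rule ratfun_eval_const[OF u1])
  have ev: "U.eval = (\<lambda>c. c \<circ>\<^sub>r u)" by (intro ext) (simp add: compose_eq_eval[OF u1])
  let ?T = "(\<lambda>i. v ^ i) ` {..<degree p}"
  have span: "z \<in> U.vs.span ?T" for z
  proof -
    obtain q where "z = coeval u q v" using full by blast
    then obtain r where r: "r = 0 \<or> degree r < degree p" "z = coeval u r v" using adj(4) by metis
    have "z = (\<Sum>i<degree p. U.eval (coeff r i) * v ^ i)"
      using r coeval_sum_le[OF u1, of r "degree p" v] by (auto simp: ev)
    also have "\<dots> \<in> U.vs.span ?T" by (intro U.vs.span_sum U.vs.span_scale U.vs.span_base) auto
    finally show ?thesis .
  qed
  let ?S = "(\<lambda>i. ratfun_X ^ i :: 'a ratfun) ` {..<ratfun_degree u}"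
  have inj: "inj_on (\<lambda>i. ratfun_X ^ i :: 'a ratfun) {..<ratfun_degree u}" and "U.vs.independent ?S"
    by (rule U.powers_independent; use X_degree_bound[OF u1] in \<open>simp add: ev coeval_def\<close>)+
  have "ratfun_degree u = card ?S" using card_image[OF inj] by simp
  also have "\<dots> \<le> card ?T"
    using U.vs.independent_span_bound[of ?T ?S] \<open>U.vs.independent ?S\<close> span by blast
  also have "\<dots> \<le> degree p" using card_image_le[of "{..<degree p}"] by simp
  finally show "ratfun_degree u \<le> degree p" .
qed

text \<open>\<open>z\<close> is a zero of the numerator of \<open>y(T) - t(v)\<close>, a polynomial over \<open>K(v)\<close>.\<close>

lemma indecomposable_multiple_degree:
  assumes v: "indecomposable v" and z: "z \<notin> range (\<lambda>c. c \<circ>\<^sub>r v)"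
    and eq: "y \<circ>\<^sub>r z = t \<circ>\<^sub>r v" and t: "ratfun_degree t \<ge> 1" and z1: "ratfun_degree z \<ge> 1"
  shows "ratfun_degree v \<le> ratfun_degree y"
proof -
  have v1: "ratfun_degree v \<ge> 1" using indecomposable_degree[OF v] by simp
  interpret V: poly_eval "\<lambda>c. c \<circ>\<^sub>r v" z by (rule poly_eval_compose[OF v1])
  define G where "G = map_poly ratfun_const (numer y) - smult t (map_poly ratfun_const (denom y))"
  have mc: "map_poly (\<lambda>c. c \<circ>\<^sub>r v) (map_poly ratfun_const q) = map_poly ratfun_const q" for q
    by (rule poly_eqI) (simp add: coeff_map_poly compose_0[OF v1] compose_const[OF v1])
  have pc: "V.peval (map_poly ratfun_const q) = to_fract q \<circ>\<^sub>r z" for q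
    by (simp add: V.peval_def mc to_fract_compose[OF z1])
  have "(y \<circ>\<^sub>r z) * (to_fract (denom y) \<circ>\<^sub>r z) = (y * to_fract (denom y)) \<circ>\<^sub>r z" by (simp add: compose_mult[OF z1])
  also have "y * to_fract (denom y) = to_fract (numer y)"
    using denom_nonzero[of y] by (subst (1) ratfun_quot) simp
  finally have "V.peval G = 0"
    by (simp add: G_def V.peval_diff V.peval_smult pc flip: eq)
  hence G0: "coeval v G z = 0" by (simp add: coeval_def V.peval_def)
  have "coeff (denom y) (degree (denom y)) \<noteq> 0" by (simp add: denom_nonzero)
  have "coeff G (degree (denom y)) \<noteq> 0"
  proof
    assume "coeff G (degree (denom y)) = 0"
    hence "ratfun_const (coeff (numer y) (degree (denom y))) = t" 
      using numer_denom(3)[of y] by (simp add: G_def)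
    thus False using t by (metis ratfun_degree_const not_one_le_zero)
  qed
  hence "G \<noteq> 0" by auto
  hence "ratfun_degree v \<le> degree G" by (rule indecomposable_relation_degree(1)[OF v z _ G0])
  also have "\<dots> \<le> ratfun_degree y" unfolding G_def ratfun_degree_def
    by (intro degree_diff_le_max[THEN order_trans]) (auto intro: order_trans[OF degree_smult_le])
  finally show ?thesis .
qed

lemma not_in_range_sym:
  assumes "indecomposable u" "indecomposable v" "v \<notin> range (\<lambda>c. c \<circ>\<^sub>r u)"
  shows "u \<notin> range (\<lambda>c. c \<circ>\<^sub>r v)"
proof
  assume "u \<in> range (\<lambda>c. c \<circ>\<^sub>r v)"
  then obtain \<gamma> where \<gamma>: "u = \<gamma> \<circ>\<^sub>r v" by blast
  have v1: "ratfun_degree v > 1" using assms(2) by (rule indecomposable_degree)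
  have "ratfun_degree \<gamma> = 1" using indecomposable_compose_cases[of \<gamma> v] assms(1) v1 by (auto simp: \<gamma>)
  then obtain \<nu> where "\<nu> \<circ>\<^sub>r \<gamma> = ratfun_X" using mobius_inverse by blast
  hence "\<nu> \<circ>\<^sub>r u = v" using v1 \<open>ratfun_degree \<gamma> = 1\<close> by (simp add: \<gamma> X_compose flip: compose_assoc)
  thus False using assms(3) by blast
qed

text \<open>The diamond of fields \<open>K(s \<circ> u) \<subseteq> K(u), K(v) \<subseteq> K(x)\<close>. The bound on \<open>deg s\<close> is sharp, and it makes
\<open>K(s \<circ> u)\<close> the intersection of \<open>K(u)\<close> and \<open>K(v)\<close>.\<close>

context
  fixes u v s t a b :: "'a::field ratfun"
  assumes u: "indecomposable u" and v: "indecomposable v"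
    and ne: "v \<notin> range (\<lambda>c. c \<circ>\<^sub>r u)"
    and st: "s \<circ>\<^sub>r u = t \<circ>\<^sub>r v" and s: "1 \<le> ratfun_degree s" "ratfun_degree s \<le> ratfun_degree v"
begin

lemma diamond_degrees:
  shows "ratfun_degree s = ratfun_degree v" "ratfun_degree t = ratfun_degree u"
    and "s' \<circ>\<^sub>r u = t' \<circ>\<^sub>r v \<Longrightarrow> ratfun_degree s' \<ge> 1 \<Longrightarrow> ratfun_degree v \<le> ratfun_degree s'"
proof -
  have du: "ratfun_degree u > 1" "ratfun_degree v > 1" using indecomposable_degree[OF u] indecomposable_degree[OF v] by simp_all
  have key: "ratfun_degree v \<le> ratfun_degree s'" if "s' \<circ>\<^sub>r u = t' \<circ>\<^sub>r v" "ratfun_degree s' \<ge> 1" for s' t'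
  proof -
    have "ratfun_degree u \<le> ratfun_degree t'"
      by (rule indecomposable_multiple_degree[OF u ne that(1)[symmetric] that(2)]) (use du in simp)
    moreover have "ratfun_degree s' * ratfun_degree u = ratfun_degree t' * ratfun_degree v"
      using that(1) du by (metis ratfun_degree_compose less_imp_le)
    ultimately have "ratfun_degree u * ratfun_degree v \<le> ratfun_degree u * ratfun_degree s'"
      by (metis mult.commute mult_le_mono1)
    thus ?thesis using du by simp
  qed
  thus "s' \<circ>\<^sub>r u = t' \<circ>\<^sub>r v \<Longrightarrow> ratfun_degree s' \<ge> 1 \<Longrightarrow> ratfun_degree v \<le> ratfun_degree s'" .
  show s': "ratfun_degree s = ratfun_degree v" using key[OF st] s by simp
  have "ratfun_degree s * ratfun_degree u = ratfun_degree t * ratfun_degree v"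
    using st du by (metis ratfun_degree_compose less_imp_le)
  thus "ratfun_degree t = ratfun_degree u" using s' du by simp
qed

text \<open>If \<open>s = y \<circ> z\<close>, then either \<open>z(u)\<close> lies in \<open>K(v)\<close>, which makes \<open>deg z\<close> too large, or it generates \<open>K(x)\<close>
over \<open>K(v)\<close>, which makes \<open>deg y\<close> too large.\<close>

lemma diamond_indecomposable: "indecomposable s"
  unfolding indecomposable_def
proof (intro conjI notI)
  have du: "ratfun_degree u > 1" "ratfun_degree v > 1" using indecomposable_degree[OF u] indecomposable_degree[OF v] by simp_all
  show "1 < ratfun_degree s" using diamond_degrees(1) du by simp
  assume "\<exists>y z. 1 < ratfun_degree y \<and> 1 < ratfun_degree z \<and> s = y \<circ>\<^sub>r z"
  then obtain y z where yz: "1 < ratfun_degree y" "1 < ratfun_degree z" "s = y \<circ>\<^sub>r z" by blast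
  have dyz: "ratfun_degree v = ratfun_degree y * ratfun_degree z"
    using diamond_degrees(1) yz by (simp add: ratfun_degree_compose)
  have u1: "ratfun_degree u \<ge> 1" using du by simp
  show False
  proof (cases "z \<circ>\<^sub>r u \<in> range (\<lambda>c. c \<circ>\<^sub>r v)")
    case True
    then obtain t' where t': "z \<circ>\<^sub>r u = t' \<circ>\<^sub>r v" by blast
    have "ratfun_degree v \<le> ratfun_degree z" using diamond_degrees(3)[OF t'] yz by simp
    thus False using dyz yz by simp
  next
    case False
    have "y \<circ>\<^sub>r (z \<circ>\<^sub>r u) = t \<circ>\<^sub>r v" using st yz by (simp add: compose_assoc[OF u1])
    moreover have "1 \<le> ratfun_degree t" using diamond_degrees(2) du by simp
    moreover have "1 \<le> ratfun_degree (z \<circ>\<^sub>r u)" using yz(2) u1 by (simp add: ratfun_degree_compose[OF u1])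
    ultimately have "ratfun_degree v \<le> ratfun_degree y" by (rule indecomposable_multiple_degree[OF v False])
    thus False using dyz yz by simp
  qed
qed

text \<open>By Lueroth's theorem \<open>K(u) \<inter> K(v) = K(w)\<close>. The generator \<open>w\<close> is itself a common multiple of \<open>u\<close> and \<open>v\<close>, so
the degree of \<open>s\<close> is minimal and \<open>K(w) = K(s \<circ> u)\<close>.\<close>

lemma diamond_factor:
  assumes ab: "a \<circ>\<^sub>r u = b \<circ>\<^sub>r v"
  shows "\<exists>c. a = c \<circ>\<^sub>r s \<and> b = c \<circ>\<^sub>r t"
proof -
  have du: "ratfun_degree u \<ge> 1" "ratfun_degree v \<ge> 1"
    using u v by (auto dest!: indecomposable_degree)
  have t1: "ratfun_degree t \<ge> 1" using diamond_degrees(2) du by simp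
  define E where "E = range (\<lambda>c. c \<circ>\<^sub>r u) \<inter> range (\<lambda>c. c \<circ>\<^sub>r v)"
  have "ratfun_subfield E"
    using ratfun_subfield_range[OF du(1)] ratfun_subfield_range[OF du(2)]
    unfolding E_def by (rule ratfun_subfield_Int)
  moreover have "s \<circ>\<^sub>r u \<in> E" unfolding E_def using st by (metis IntI rangeI)
  moreover have "ratfun_degree (s \<circ>\<^sub>r u) \<ge> 1" using s du by (simp add: ratfun_degree_compose)
  ultimately obtain w where w: "ratfun_degree w \<ge> 1" "E = range (\<lambda>c. c \<circ>\<^sub>r w)"
    using lueroth by blast
  have "w \<in> E" unfolding w(2) using w(1) by (metis X_compose rangeI)
  then obtain s' t' where st': "w = s' \<circ>\<^sub>r u" "w = t' \<circ>\<^sub>r v" unfolding E_def by blast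
  have s'1: "ratfun_degree s' \<ge> 1" using w(1) du by (auto simp: st'(1) ratfun_degree_compose)
  obtain e where e: "s \<circ>\<^sub>r u = e \<circ>\<^sub>r w" using \<open>s \<circ>\<^sub>r u \<in> E\<close> w(2) by auto
  hence "s \<circ>\<^sub>r u = (e \<circ>\<^sub>r s') \<circ>\<^sub>r u" using s'1 by (simp add: st'(1) compose_assoc[OF du(1)])
  hence "s = e \<circ>\<^sub>r s'" by (simp add: compose_inj[OF du(1)])
  hence "ratfun_degree s = ratfun_degree e * ratfun_degree s'" by (simp add: ratfun_degree_compose[OF s'1])
  moreover have "ratfun_degree s \<le> ratfun_degree s'"
    using diamond_degrees(3)[of s' t'] st' s'1 diamond_degrees(1) by simp
  ultimately have "ratfun_degree e = 1" using s s'1 by (cases "ratfun_degree e") auto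
  then obtain \<epsilon> where \<epsilon>: "ratfun_degree \<epsilon> = 1" "\<epsilon> \<circ>\<^sub>r e = ratfun_X" using mobius_inverse by blast
  have su1: "ratfun_degree (s \<circ>\<^sub>r u) \<ge> 1" by fact
  have w\<epsilon>: "w = \<epsilon> \<circ>\<^sub>r (s \<circ>\<^sub>r u)"
    using \<epsilon> w(1) \<open>ratfun_degree e = 1\<close> by (simp add: e X_compose flip: compose_assoc)
  have "a \<circ>\<^sub>r u \<in> E" unfolding E_def using ab by (metis IntI rangeI)
  then obtain c' where "a \<circ>\<^sub>r u = c' \<circ>\<^sub>r w" using w(2) by auto
  hence c: "a \<circ>\<^sub>r u = (c' \<circ>\<^sub>r \<epsilon>) \<circ>\<^sub>r (s \<circ>\<^sub>r u)" using \<epsilon>(1) by (simp add: w\<epsilon> compose_assoc[OF su1])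
  have "a \<circ>\<^sub>r u = ((c' \<circ>\<^sub>r \<epsilon>) \<circ>\<^sub>r s) \<circ>\<^sub>r u" unfolding c using s by (simp add: compose_assoc[OF du(1)])
  hence "a = (c' \<circ>\<^sub>r \<epsilon>) \<circ>\<^sub>r s" by (simp add: compose_inj[OF du(1)])
  moreover have "b \<circ>\<^sub>r v = ((c' \<circ>\<^sub>r \<epsilon>) \<circ>\<^sub>r t) \<circ>\<^sub>r v"
    unfolding ab[symmetric] c using t1 by (simp add: st compose_assoc[OF du(2)])
  hence "b = (c' \<circ>\<^sub>r \<epsilon>) \<circ>\<^sub>r t" by (simp add: compose_inj[OF du(2)])
  ultimately show ?thesis by blast
qed

end

lemma diamond_indecomposable':
  assumes u: "indecomposable u" and v: "indecomposable v"
    and ne: "v \<notin> range (\<lambda>c. c \<circ>\<^sub>r u)"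
    and st: "s \<circ>\<^sub>r u = t \<circ>\<^sub>r v" and s: "1 \<le> ratfun_degree s" "ratfun_degree s \<le> ratfun_degree v"
  shows "indecomposable t"
  by (rule diamond_indecomposable[OF v u not_in_range_sym[OF u v ne] st[symmetric]])
    (use diamond_degrees[OF assms] indecomposable_degree[OF u] in auto)

subsection \<open>Multisets of degrees of complete decompositions\<close>

text \<open>All functions of degree \<open>1\<close> serve as the empty decomposition, so that the relation is invariant under fractional
linear changes of the factors.\<close>

inductive decomp_degrees :: "'a::field ratfun \<Rightarrow> nat multiset \<Rightarrow> bool" where
  mobius: "ratfun_degree f = 1 \<Longrightarrow> decomp_degrees f {#}"
| compose: "decomp_degrees a M \<Longrightarrow> indecomposable u \<Longrightarrow>
    decomp_degrees (a \<circ>\<^sub>r u) (add_mset (ratfun_degree u) M)"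

lemma decomp_degrees_pos: "decomp_degrees f M \<Longrightarrow> ratfun_degree f \<ge> 1"
proof (induction rule: decomp_degrees.induct)
  case (compose a M u)
  have "ratfun_degree u > 1" by (rule indecomposable_degree[OF compose.hyps(2)])
  thus ?case using compose.IH by (simp add: ratfun_degree_compose)
qed simp

lemma decomp_degrees_mobius_right:
  assumes "decomp_degrees f M" "ratfun_degree \<mu> = 1"
  shows "decomp_degrees (f \<circ>\<^sub>r \<mu>) M"
  using assms
proof (cases rule: decomp_degrees.cases)
  case mobius
  thus ?thesis using assms(2) by (auto intro!: decomp_degrees.mobius simp: ratfun_degree_compose)
next
  case (compose a M' u)
  have "ratfun_degree u > 1" by (rule indecomposable_degree[OF compose(4)])
  hence "f \<circ>\<^sub>r \<mu> = a \<circ>\<^sub>r (u \<circ>\<^sub>r \<mu>)" using assms(2) by (simp add: compose(1) compose_assoc)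
  moreover have "ratfun_degree (u \<circ>\<^sub>r \<mu>) = ratfun_degree u" using assms(2) by (simp add: ratfun_degree_compose)
  ultimately show ?thesis
    using decomp_degrees.compose[OF compose(3) indecomposable_compose_mobius(1)[OF compose(4) assms(2)]]
    by (simp add: compose(2))
qed

lemma decomp_degrees_exists: "ratfun_degree f \<ge> 1 \<Longrightarrow> \<exists>M. decomp_degrees f M"
proof (induction "ratfun_degree f" arbitrary: f rule: less_induct)
  case less
  consider "ratfun_degree f = 1" | "ratfun_degree f > 1" using less.prems by linarith
  thus ?case
  proof cases
    case 2
    define P where "P = (\<lambda>u. ratfun_degree u > 1 \<and> (\<exists>a. f = a \<circ>\<^sub>r u))"
    have "P f" using 2 X_compose[of f] unfolding P_def by (metis less_imp_le)
    then obtain u where u: "P u" and min: "\<And>u'. P u' \<Longrightarrow> ratfun_degree u \<le> ratfun_degree u'"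
      using ex_has_least_nat[of P f ratfun_degree] by auto
    then obtain a where a: "f = a \<circ>\<^sub>r u" and u1: "ratfun_degree u > 1" by (auto simp: P_def)
    have "indecomposable u" unfolding indecomposable_def
    proof (intro conjI notI)
      assume "\<exists>y z. 1 < ratfun_degree y \<and> 1 < ratfun_degree z \<and> u = y \<circ>\<^sub>r z"
      then obtain y z where yz: "1 < ratfun_degree y" "1 < ratfun_degree z" "u = y \<circ>\<^sub>r z" by blast
      have "f = (a \<circ>\<^sub>r y) \<circ>\<^sub>r z" using yz by (simp add: a compose_assoc)
      hence "P z" using yz unfolding P_def by blast
      hence "ratfun_degree u \<le> ratfun_degree z" by (rule min)
      thus False using yz by (simp add: ratfun_degree_compose)
    qed fact
    have d: "ratfun_degree f = ratfun_degree a * ratfun_degree u"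
      using u1 by (simp add: a ratfun_degree_compose)
    have "ratfun_degree a \<noteq> 0" using d 2 by (metis less_nat_zero_code mult_0)
    moreover have "ratfun_degree a * 1 < ratfun_degree a * ratfun_degree u"
      using \<open>ratfun_degree a \<noteq> 0\<close> u1 by (intro mult_strict_left_mono) simp_all
    ultimately obtain M where "decomp_degrees a M" using less.hyps[of a] d by auto
    thus ?thesis using decomp_degrees.compose[OF _ \<open>indecomposable u\<close>] a by blast
  qed (use decomp_degrees.mobius in blast)
qed

definition unique_degrees :: "'a::field ratfun \<Rightarrow> bool" where
  "unique_degrees f \<longleftrightarrow> (\<forall>M M'. decomp_degrees f M \<longrightarrow> decomp_degrees f M' \<longrightarrow> M = M')"

text \<open>If \<open>K(u) = K(v)\<close>, then \<open>a\<close> and \<open>b\<close> differ by a function of degree \<open>1\<close>. Otherwise \<open>a = c \<circ> s\<close> and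
\<open>b = c \<circ> t\<close>, and a decomposition of \<open>c\<close> extends to one of \<open>a\<close> and one of \<open>b\<close>.\<close>

theorem unique_degrees_step:
  assumes u: "indecomposable u" and v: "indecomposable v" and ab: "a \<circ>\<^sub>r u = b \<circ>\<^sub>r v"
    and uniq: "unique_degrees a" "unique_degrees b"
    and D: "decomp_degrees a Ma" "decomp_degrees b Mb"
    and alt: "v \<in> range (\<lambda>c. c \<circ>\<^sub>r u) \<or>
      (\<exists>s t. s \<circ>\<^sub>r u = t \<circ>\<^sub>r v \<and> 1 \<le> ratfun_degree s \<and> ratfun_degree s \<le> ratfun_degree v)"
  shows "add_mset (ratfun_degree u) Ma = add_mset (ratfun_degree v) Mb"
proof (cases "v \<in> range (\<lambda>c. c \<circ>\<^sub>r u)")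
  case True
  then obtain \<mu> where \<mu>: "v = \<mu> \<circ>\<^sub>r u" by blast
  have u1: "ratfun_degree u > 1" by (rule indecomposable_degree[OF u])
  hence d\<mu>: "ratfun_degree \<mu> = 1" using indecomposable_compose_cases[of \<mu> u] v by (auto simp: \<mu>)
  have "a \<circ>\<^sub>r u = (b \<circ>\<^sub>r \<mu>) \<circ>\<^sub>r u" using u1 d\<mu> by (simp add: ab \<mu> compose_assoc)
  hence "a = b \<circ>\<^sub>r \<mu>" using u1 by (simp add: compose_inj)
  hence "decomp_degrees a Mb" using decomp_degrees_mobius_right[OF D(2) d\<mu>] by simp
  hence "Ma = Mb" using uniq(1) D(1) by (auto simp: unique_degrees_def)
  moreover have "ratfun_degree v = ratfun_degree u" using u1 d\<mu> by (simp add: \<mu> ratfun_degree_compose)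
  ultimately show ?thesis by simp
next
  case ne: False
  then obtain s t where st: "s \<circ>\<^sub>r u = t \<circ>\<^sub>r v" "1 \<le> ratfun_degree s" "ratfun_degree s \<le> ratfun_degree v"
    using alt by blast
  note prem = u v ne st
  obtain c where c: "a = c \<circ>\<^sub>r s" "b = c \<circ>\<^sub>r t" using diamond_factor[OF prem ab] by blast
  have deg: "ratfun_degree s = ratfun_degree v" "ratfun_degree t = ratfun_degree u"
    by (rule diamond_degrees[OF prem])+
  have "ratfun_degree a \<ge> 1" using D(1) by (rule decomp_degrees_pos)
  hence "ratfun_degree c \<ge> 1" using st(2) by (auto simp: c ratfun_degree_compose)
  then obtain Mc where Mc: "decomp_degrees c Mc" using decomp_degrees_exists by blast
  have "decomp_degrees a (add_mset (ratfun_degree v) Mc)" "decomp_degrees b (add_mset (ratfun_degree u) Mc)"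
    using decomp_degrees.compose[OF Mc diamond_indecomposable[OF prem]]
      decomp_degrees.compose[OF Mc diamond_indecomposable'[OF prem]] deg by (simp_all add: c)
  hence "Ma = add_mset (ratfun_degree v) Mc" "Mb = add_mset (ratfun_degree u) Mc"
    using uniq D unfolding unique_degrees_def by blast+
  thus ?thesis by (simp add: add_mset_commute)
qed

lemma compose_list_degree:
  "\<forall>a\<in>set as. ratfun_degree a \<ge> 1 \<Longrightarrow> ratfun_degree (ratfun_compose_list as) \<ge> 1"
  by (induction as) (auto simp: ratfun_compose_list_def ratfun_degree_compose)

lemma compose_list_snoc:
  assumes "\<forall>a\<in>set as. ratfun_degree a \<ge> 1" "ratfun_degree u \<ge> 1"
  shows "ratfun_compose_list (as @ [u]) = ratfun_compose_list as \<circ>\<^sub>r u"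
  using assms(1)
proof (induction as)
  case (Cons a as)
  thus ?case using compose_list_degree[of as]
    by (simp add: ratfun_compose_list_def compose_assoc[OF assms(2)])
qed (simp add: ratfun_compose_list_def X_compose[OF assms(2)] ratfun_compose_X)

lemma decomp_degrees_list:
  "\<forall>a\<in>set as. indecomposable a \<Longrightarrow> decomp_degrees (ratfun_compose_list as) (mset (map ratfun_degree as))"
proof (induction as rule: rev_induct)
  case Nil
  show ?case by (simp add: ratfun_compose_list_def decomp_degrees.mobius)
next
  case (snoc u as)
  have "\<forall>a\<in>set (as @ [u]). ratfun_degree a \<ge> 1" using snoc.prems indecomposable_degree by (metis less_imp_le)
  thus ?case using snoc decomp_degrees.compose by (auto simp: compose_list_snoc)
qed

unbundle fps_syntax

section \<open>Leading terms of formal Laurent series\<close>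

text \<open>The series is \<open>c t\<^sup>-\<^sup>N\<close> plus terms of higher order in \<open>t\<close>. The coefficient \<open>c\<close> may be \<open>0\<close>: this makes the
relation additive, and \<open>leads N 0 y\<close> says that \<open>y\<close> has a pole of order less than \<open>N\<close>.\<close>

definition leads :: "int \<Rightarrow> 'a::field \<Rightarrow> 'a fls \<Rightarrow> bool" where
  "leads N c y \<longleftrightarrow> (\<forall>i < -N. y $$ i = 0) \<and> y $$ (-N) = c"

lemma leads_nth: "leads N c y \<Longrightarrow> i < -N \<Longrightarrow> y $$ i = 0" "leads N c y \<Longrightarrow> y $$ (-N) = c"
  by (auto simp: leads_def)

lemma leads_unique: "leads N c y \<Longrightarrow> leads N d y \<Longrightarrow> c = d"
  by (auto simp: leads_def)

lemma leads_0 [simp]: "leads N c 0 \<longleftrightarrow> c = 0"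
  by (auto simp: leads_def)

lemma leads_const: "leads 0 c (fls_const c)"
  by (simp add: leads_def)

lemma leads_add: "leads N c y \<Longrightarrow> leads N d z \<Longrightarrow> leads N (c + d) (y + z)"
  and leads_diff: "leads N c y \<Longrightarrow> leads N d z \<Longrightarrow> leads N (c - d) (y - z)"
  and leads_uminus: "leads N c y \<Longrightarrow> leads N (- c) (- y)"
  by (auto simp: leads_def)

lemma leads_less: "leads M c y \<Longrightarrow> M < N \<Longrightarrow> leads N 0 y"
  by (auto simp: leads_def)

lemma leads_pred: "leads N 0 y \<longleftrightarrow> (\<exists>c. leads (N - 1) c y)"
proof
  assume y: "leads N 0 y"
  have "y $$ i = 0" if "i < - (N - 1)" for i
  proof (cases "i = - N")
    case False
    thus ?thesis using leads_nth(1)[OF y, of i] that by simp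
  qed (use leads_nth(2)[OF y] in simp)
  thus "\<exists>c. leads (N - 1) c y" by (auto simp: leads_def)
qed (use leads_less in force)

lemma leads_subdegree:
  assumes "y \<noteq> 0"
  shows "leads (- fls_subdegree y) (y $$ fls_subdegree y) y"
  using assms by (auto simp: leads_def)

lemma leads_exists:
  assumes "y \<noteq> 0"
  shows "\<exists>N c. c \<noteq> 0 \<and> leads N c y"
  using leads_subdegree[OF assms] nth_fls_subdegree_nonzero[OF assms] by blast

lemma leads_nonzero: "leads N c y \<Longrightarrow> c \<noteq> 0 \<Longrightarrow> y \<noteq> 0"
  by (auto simp: leads_def)

lemma leads_order_unique:
  assumes "leads N c y" "leads M d y" "c \<noteq> 0" "d \<noteq> 0"
  shows "N = M" "c = d"
proof -
  show "N = M"
  proof (rule linorder_cases[of N M])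
    assume "N < M" thus ?thesis using leads_unique[OF leads_less[OF assms(1)] assms(2)] assms(4) by blast
  next
    assume "M < N" thus ?thesis using leads_unique[OF leads_less[OF assms(2)] assms(1)] assms(3) by blast
  qed
  thus "c = d" using assms leads_unique by blast
qed

lemma leads_le:
  assumes "leads N c y" "leads M d y" "c \<noteq> 0"
  shows "N \<le> M"
  using leads_less[OF assms(2), of N] leads_unique[OF _ assms(1), of 0] assms(3) by fastforce

lemma leads_mult:
  assumes y: "leads N c y" and z: "leads M d z"
  shows "leads (N + M) (c * d) (y * z)"
proof (cases "y = 0 \<or> z = 0")
  case True
  thus ?thesis using y z by auto
next
  case False
  hence nz: "y \<noteq> 0" "z \<noteq> 0" by auto
  have sd: "fls_subdegree y \<ge> - N" "fls_subdegree z \<ge> - M"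
    using nz y z by (auto intro!: fls_subdegree_geI simp: leads_def)
  have eq: "fls_subdegree (y * z) = fls_subdegree y + fls_subdegree z" by (rule fls_subdegree_mult[OF nz])
  show ?thesis
  proof (cases "fls_subdegree y = - N \<and> fls_subdegree z = - M")
    case True
    hence "leads (N + M) ((y * z) $$ (fls_subdegree y + fls_subdegree z)) (y * z)"
      using leads_subdegree[of "y * z"] nz eq by (simp add: add.commute)
    thus ?thesis unfolding fls_times_base using True y z by (simp add: leads_nth)
  next
    case False
    hence "fls_subdegree (y * z) > - (N + M)" using sd eq by linarith
    hence "leads (N + M) 0 (y * z)" by (simp add: leads_def)
    moreover have "c = 0 \<or> d = 0"
      using False sd leads_nth(2)[OF y] leads_nth(2)[OF z] fls_eq0_below_subdegree
      by (metis order_le_neq_trans)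
    ultimately show ?thesis by auto
  qed
qed

lemma leads_power: "leads N c y \<Longrightarrow> leads (int k * N) (c ^ k) (y ^ k)"
proof (induction k)
  case (Suc k)
  thus ?case using leads_mult[of N c y "int k * N" "c ^ k" "y ^ k"] by (simp add: algebra_simps)
qed (use leads_const[of 1] in simp)

lemma leads_inverse:
  assumes "leads N c y" "c \<noteq> 0"
  shows "leads (- N) (inverse c) (inverse y)"
proof -
  have y: "y \<noteq> 0" using assms leads_nonzero by blast
  then obtain M d where d: "d \<noteq> 0" "leads M d (inverse y)" using leads_exists[of "inverse y"] by auto
  have "leads (N + M) (c * d) 1" using leads_mult[OF assms(1) d(2)] y by simp
  moreover have "leads 0 1 (1 :: 'a fls)" using leads_const[of 1] by simp
  ultimately have "N + M = 0" "c * d = 1" using leads_order_unique[of "N + M" "c * d" 1 0 1] assms(2) d(1) by auto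
  hence "M = - N" "d = inverse c" using assms(2) by (auto simp: field_simps)
  thus ?thesis using d by simp
qed

lemma leads_sum: "(\<And>i. i \<in> A \<Longrightarrow> leads N (c i) (y i)) \<Longrightarrow> leads N (\<Sum>i\<in>A. c i) (\<Sum>i\<in>A. y i)"
  by (induction A rule: infinite_finite_induct) (auto intro: leads_add)

lemma poly_eval_fls: "poly_eval fls_const"
  by unfold_locales (auto simp: fls_plus_const fls_const_mult_const)

lemma leads_poly:
  assumes y: "leads N \<beta> y" and N: "N > 0" and p: "degree p \<le> k"
  shows "leads (int k * N) (coeff p k * \<beta> ^ k) (poly (map_poly fls_const p) y)"
  using p
proof (induction k arbitrary: p)
  case 0
  then obtain a where "p = [:a:]" by (auto elim: degree_eq_zeroE)
  thus ?case using leads_const[of a] by (simp add: map_poly_pCons)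
next
  case (Suc k)
  obtain a q where p: "p = pCons a q" by (cases p)
  have "degree q \<le> k" using Suc.prems by (cases "q = 0") (auto simp: p)
  from leads_mult[OF y Suc.IH[OF this]]
  have "leads (int (Suc k) * N) (coeff p (Suc k) * \<beta> ^ Suc k) (y * poly (map_poly fls_const q) y)"
    by (simp add: p algebra_simps)
  moreover have "leads (int (Suc k) * N) 0 (fls_const a)"
    by (rule leads_less[OF leads_const]) (use N in simp)
  ultimately show ?case using leads_add[of "int (Suc k) * N" 0 "fls_const a"] by (simp add: p map_poly_pCons)
qed

lemma leads_poly_regular: "leads 0 c y \<Longrightarrow> \<exists>d. leads 0 d (poly (map_poly fls_const p) y)"
proof (induction p)
  case (pCons b p)
  then obtain d where d: "leads 0 d (poly (map_poly fls_const p) y)" by blast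
  have "leads 0 (b + c * d) (fls_const b + y * poly (map_poly fls_const p) y)"
    using leads_add[OF leads_const[of b] leads_mult[OF pCons.prems d, unfolded add_0]] by simp
  thus ?case by (auto simp: map_poly_pCons)
qed auto

text \<open>In \<open>U\<^sup>k - V\<^sup>k = (U - V) (U\<^sup>k\<^sup>-\<^sup>1 + \<dots> + V\<^sup>k\<^sup>-\<^sup>1)\<close> the second factor has leading coefficient
  \<open>k \<beta>\<^sup>k\<^sup>-\<^sup>1\<close>; this is where tameness enters.\<close>

lemma leads_power_diff:
  assumes "leads N \<beta> U" "leads N \<beta> V" "leads M c (U - V)" "k > 0"
  shows "leads (M + int (k - 1) * N) (c * (of_nat k * \<beta> ^ (k - 1))) (U ^ k - V ^ k)"
proof -
  have "leads (int (k - 1) * N) (\<Sum>i<k. \<beta> ^ (k - 1)) (\<Sum>i<k. V ^ (k - Suc i) * U ^ i)"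
  proof (rule leads_sum)
    fix i assume i: "i \<in> {..<k}"
    have "leads (int (k - Suc i) * N + int i * N) (\<beta> ^ (k - Suc i) * \<beta> ^ i) (V ^ (k - Suc i) * U ^ i)"
      by (intro leads_mult leads_power assms)
    moreover have "int (k - Suc i) * N + int i * N = int (k - 1) * N" using i by (simp flip: distrib_right) 
    moreover have "\<beta> ^ (k - Suc i) * \<beta> ^ i = \<beta> ^ (k - 1)" using i by (simp flip: power_add)
    ultimately show "leads (int (k - 1) * N) (\<beta> ^ (k - 1)) (V ^ (k - Suc i) * U ^ i)" by simp
  qed
  hence "leads (int (k - 1) * N) (of_nat k * \<beta> ^ (k - 1)) (\<Sum>i<k. V ^ (k - Suc i) * U ^ i)" by simp
  from leads_mult[OF assms(3) this] show ?thesis by (simp add: power_diff_sumr2)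
qed

text \<open>A \<open>k\<close>-th root with given leading coefficient is determined by its \<open>k\<close>-th power, up to an error controlled by that of the
power.\<close>

lemma leads_power_diff_cancel:
  assumes U: "leads N \<beta> U" and V: "leads N \<beta> V" and k: "k > 0" "of_nat k \<noteq> (0::'a::field)" and \<beta>: "\<beta> \<noteq> (0::'a)"
    and small: "leads (L + int (k - 1) * N) 0 (U ^ k - V ^ k)"
  shows "leads L 0 (U - V)"
proof (cases "U = V")
  case False
  then obtain M c where M: "c \<noteq> 0" "leads M c (U - V)" using leads_exists[of "U - V"] by auto
  have nz: "c * (of_nat k * \<beta> ^ (k - 1)) \<noteq> 0" using M k \<beta> by simp
  obtain d where "leads (L + int (k - 1) * N - 1) d (U ^ k - V ^ k)" using small leads_pred by blast
  from leads_le[OF leads_power_diff[OF U V M(2) k(1)] this nz] have "M < L" by simp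
  thus ?thesis using leads_less[OF M(2)] by blast
qed simp

section \<open>Expansions at infinity and at zero\<close>

lemma coeff_peval_X:
  fixes p :: "'a::field poly"
  shows
  "poly (map_poly fls_const p) fls_X $$ i = (if i < 0 then 0 else coeff p (nat i))"
proof (induction p arbitrary: i)
  case (pCons a p)
  have "poly (map_poly fls_const (pCons a p)) fls_X $$ i = 
      (if i = 0 then a else 0) + poly (map_poly fls_const p) fls_X $$ (i - 1)"
    using fls_X_times_conv_shift(1)[of "poly (map_poly fls_const p) fls_X"] by (simp add: map_poly_pCons)
  thus ?case by (auto simp: pCons.IH coeff_pCons nat_diff_distrib split: nat.splits)
qed simp

lemma coeff_peval_X_inv:
  fixes p :: "'a::field poly"
  shows
  "poly (map_poly fls_const p) fls_X_inv $$ i = (if i > 0 then 0 else coeff p (nat (- i)))"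
proof (induction p arbitrary: i)
  case (pCons a p)
  have "poly (map_poly fls_const (pCons a p)) fls_X_inv $$ i = 
      (if i = 0 then a else 0) + poly (map_poly fls_const p) fls_X_inv $$ (i + 1)"
    using fls_X_inv_times_conv_shift(1)[of "poly (map_poly fls_const p) fls_X_inv"]
    by (simp add: map_poly_pCons)
  moreover have "nat (- i) = Suc (nat (- (i + 1)))" if "i < 0" using that by simp
  ultimately show ?case by (auto simp: pCons.IH coeff_pCons split: nat.splits)
qed simp

text \<open>The local parameter \<open>t\<close> stands for \<open>x\<close> at zero and for \<open>1/x\<close> at infinity.\<close>

interpretation zer: ratfun_eval fls_const "fls_X :: 'a::field fls"
proof (unfold ratfun_eval_def ratfun_eval_axioms_def, intro conjI allI impI)
  fix p :: "'a poly" assume z: "poly (map_poly fls_const p) fls_X = 0"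
  show "p = 0"
    by (rule poly_eqI) (use coeff_peval_X[of p "int n" for n] z in \<open>metis coeff_0 fls_zero_nth nat_int of_nat_less_0_iff\<close>)
qed (rule poly_eval_fls)

interpretation inf: ratfun_eval fls_const "fls_X_inv :: 'a::field fls"
proof (unfold ratfun_eval_def ratfun_eval_axioms_def, intro conjI allI impI)
  fix p :: "'a poly" assume z: "poly (map_poly fls_const p) fls_X_inv = 0"
  have "coeff p n = 0" for n using coeff_peval_X_inv[of p "- int n"] z by simp
  thus "p = 0" by (intro poly_eqI) simp
qed (rule poly_eval_fls)

abbreviation at_zero :: "'a::field ratfun \<Rightarrow> 'a fls" where "at_zero \<equiv> zer.eval"
abbreviation at_inf :: "'a::field ratfun \<Rightarrow> 'a fls" where "at_inf \<equiv> inf.eval"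

lemma (in ratfun_eval) eval_poly_const: "eval (poly (map_poly ratfun_const p) u) = poly (map_poly h p) (eval u)"
  by (induction p) (auto simp: map_poly_pCons eval_add eval_mult eval_const)

lemma (in ratfun_eval) eval_compose_poly:
  "ratfun_degree u \<ge> 1 \<Longrightarrow> eval (to_fract p \<circ>\<^sub>r u) = poly (map_poly h p) (eval u)"
  by (simp add: to_fract_compose eval_poly_const)

lemma at_inf_to_fract: "p \<noteq> 0 \<Longrightarrow> leads (int (degree p)) (lead_coeff p) (at_inf (to_fract p))"
  by (auto simp: leads_def inf.eval_to_fract inf.peval_def coeff_peval_X_inv coeff_eq_0)

lemma at_zero_to_fract: "leads 0 (coeff p 0) (at_zero (to_fract p))"
  by (auto simp: leads_def zer.eval_to_fract zer.peval_def coeff_peval_X)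

lemma at_inf_X: "leads 1 1 (at_inf ratfun_X)" and at_zero_X: "leads (-1) 1 (at_zero ratfun_X)"
  by (auto simp: leads_def inf.eval_X zer.eval_X)

lemma at_inf_const: "leads 0 c (at_inf (ratfun_const c))" and at_zero_const: "leads 0 c (at_zero (ratfun_const c))"
  by (auto simp: inf.eval_const zer.eval_const leads_const)

section \<open>Laurent polynomials\<close>

lemma laurent_iff: "laurent_polynomial f \<longleftrightarrow> (\<exists>p n. f * ratfun_X ^ n = to_fract p)"
proof -
  have "f = Fract p (monom 1 n) \<longleftrightarrow> f * ratfun_X ^ n = to_fract p" for p n
  proof -
    have "Fract p (monom 1 n) = to_fract p / ratfun_X ^ n" by (simp add: X_power to_fract_def)
    moreover have "ratfun_X ^ n \<noteq> (0 :: 'a ratfun)" by (simp add: X_power)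
    ultimately show ?thesis by (metis nonzero_eq_divide_eq)
  qed
  thus ?thesis by (simp add: laurent_polynomial_def)
qed

lemma ratfun_X_nonzero [simp]: "ratfun_X \<noteq> 0"
  by (simp add: ratfun_X_def)

lemma laurent_raise:
  fixes f :: "'a::field ratfun"
  assumes "f * ratfun_X ^ n = to_fract p" "n \<le> m"
  shows "f * ratfun_X ^ m = to_fract (p * monom 1 (m - n))"
proof -
  have "ratfun_X ^ m = ratfun_X ^ n * (ratfun_X ^ (m - n) :: 'a ratfun)"
    using assms(2) by (simp flip: power_add)
  hence "f * ratfun_X ^ m = f * ratfun_X ^ n * ratfun_X ^ (m - n)" by (simp only: mult.assoc)
  thus ?thesis unfolding assms(1) by (simp add: X_power)
qed

lemma laurent_to_fract [intro]: "laurent_polynomial (to_fract p)"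
  unfolding laurent_iff by (intro exI[of _ p] exI[of _ 0]) simp

lemma laurent_const [intro]: "laurent_polynomial (ratfun_const c)"
  unfolding ratfun_const_def by (rule laurent_to_fract)

lemma laurent_add:
  assumes "laurent_polynomial f" "laurent_polynomial g"
  shows "laurent_polynomial (f + g)"
proof -
  obtain p n q m where "f * ratfun_X ^ n = to_fract p" "g * ratfun_X ^ m = to_fract q"
    using assms by (auto simp: laurent_iff)
  hence "(f + g) * ratfun_X ^ max n m = to_fract (p * monom 1 (max n m - n) + q * monom 1 (max n m - m))"
    using laurent_raise[of f n p "max n m"] laurent_raise[of g m q "max n m"] by (simp add: distrib_right)
  thus ?thesis unfolding laurent_iff by blast
qed

lemma laurent_mult:
  assumes "laurent_polynomial f" "laurent_polynomial g"
  shows "laurent_polynomial (f * g)"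
proof -
  obtain p n q m where "f * ratfun_X ^ n = to_fract p" "g * ratfun_X ^ m = to_fract q"
    using assms by (auto simp: laurent_iff)
  moreover have "f * g * ratfun_X ^ (n + m) = (f * ratfun_X ^ n) * (g * ratfun_X ^ m)"
    by (simp add: power_add mult_ac)
  ultimately have "f * g * ratfun_X ^ (n + m) = to_fract (p * q)" by simp
  thus ?thesis unfolding laurent_iff by blast
qed

lemma laurent_uminus: "laurent_polynomial f \<Longrightarrow> laurent_polynomial (- f)"
  using laurent_mult[OF laurent_const[of "-1"], of f] by (simp add: ratfun_const_minus)

lemma laurent_diff: "laurent_polynomial f \<Longrightarrow> laurent_polynomial g \<Longrightarrow> laurent_polynomial (f - g)"
  using laurent_add[of f "- g"] laurent_uminus[of g] by simp

lemma laurent_power: "laurent_polynomial f \<Longrightarrow> laurent_polynomial (f ^ n)"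
  using laurent_const[of 1] by (induction n) (auto intro: laurent_mult)

lemma laurent_poly: "laurent_polynomial f \<Longrightarrow> laurent_polynomial (poly (map_poly ratfun_const p) f)"
proof (induction p)
  case (pCons a p)
  thus ?case by (auto simp: map_poly_pCons intro!: laurent_add laurent_mult)
qed (use laurent_const[of 0] in simp)

lemma laurent_compose_poly:
  "laurent_polynomial u \<Longrightarrow> ratfun_degree u \<ge> 1 \<Longrightarrow> laurent_polynomial (to_fract p \<circ>\<^sub>r u)"
  by (simp add: to_fract_compose laurent_poly)

lemma laurent_X [intro]: "laurent_polynomial ratfun_X"
  unfolding ratfun_X_def by (rule laurent_to_fract)

lemma laurent_inverse_X [intro]: "laurent_polynomial (inverse ratfun_X)"
  unfolding laurent_iff by (rule exI[of _ 1], rule exI[of _ 1]) simp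

lemma at_zero_nth:
  assumes "f * ratfun_X ^ n = to_fract p"
  shows "at_zero f $$ i = (if i + int n < 0 then 0 else coeff p (nat (i + int n)))"
proof -
  have "at_zero f * fls_X ^ n = zer.peval p"
    using arg_cong[OF assms, of at_zero] by (simp add: zer.eval_mult zer.eval_power zer.eval_X zer.eval_to_fract)
  hence "(at_zero f * fls_X ^ n) $$ (i + int n) = zer.peval p $$ (i + int n)" by simp
  thus ?thesis by (simp add: fls_X_power_times_conv_shift zer.peval_def coeff_peval_X)
qed

lemma at_inf_nth:
  assumes "f * ratfun_X ^ n = to_fract p"
  shows "at_inf f $$ i = (if - i + int n < 0 then 0 else coeff p (nat (- i + int n)))"
proof -
  have "at_inf f * fls_X_inv ^ n = inf.peval p"
    using arg_cong[OF assms, of at_inf] by (simp add: inf.eval_mult inf.eval_power inf.eval_X inf.eval_to_fract)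
  hence "(at_inf f * fls_X_inv ^ n) $$ (i - int n) = inf.peval p $$ (i - int n)" by simp
  thus ?thesis by (simp add: fls_X_inv_power_times_conv_shift inf.peval_def coeff_peval_X_inv)
qed

lemma laurent_nth:
  assumes "laurent_polynomial f"
  shows "at_inf f $$ i = at_zero f $$ (- i)"
proof -
  obtain p n where "f * ratfun_X ^ n = to_fract p" using assms by (auto simp: laurent_iff)
  thus ?thesis by (simp add: at_zero_nth at_inf_nth)
qed

text \<open>The expansion at infinity rules out the exponents \<open>\<ge> 0\<close>, the expansion at zero the negative ones.\<close>

lemma laurent_eq_0:
  assumes "laurent_polynomial f" "leads 0 0 (at_inf f)" "leads 0 c (at_zero f)"
  shows "f = 0"
proof -
  have "at_zero f $$ i = 0" for i
  proof (cases "i < 0")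
    case False
    hence "at_inf f $$ (- i) = 0" using leads_nth[OF assms(2)] by (cases "i = 0") auto
    thus ?thesis using laurent_nth[OF assms(1), of "- i"] by simp
  qed (use leads_nth(1)[OF assms(3)] in simp)
  hence "at_zero f = 0" by (intro fls_eqI) simp
  thus ?thesis by simp
qed

lemma coeff_pcompose_monom:
  fixes p :: "'a::field poly"
  assumes "q > 0"
  shows "coeff (pcompose p (monom 1 q)) j = (if q dvd j then coeff p (j div q) else 0)"
proof (induction p arbitrary: j)
  case (pCons a p)
  show ?case
  proof (cases "j < q")
    case True
    hence "q dvd j \<longleftrightarrow> j = 0" using nat_dvd_not_less by auto
    thus ?thesis using True assms by (auto simp: pcompose_pCons coeff_monom_mult coeff_pCons split: nat.splits)
  next
    case False
    then obtain i where i: "j = q + i" using le_Suc_ex not_less by blast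
    have "j \<noteq> 0" using i assms by simp
    hence "coeff (pcompose (pCons a p) (monom 1 q)) j = coeff (pcompose p (monom 1 q)) i"
      by (simp add: pcompose_pCons coeff_monom_mult coeff_pCons i split: nat.splits)
        (use assms in auto)
    thus ?thesis using assms by (simp add: pCons.IH i)
  qed
qed simp

lemma laurent_in_power:
  assumes w: "laurent_polynomial w" and q: "q > 0" and nth: "\<And>i. at_zero w $$ i \<noteq> 0 \<Longrightarrow> int q dvd i"
  shows "\<exists>\<phi>. laurent_polynomial \<phi> \<and> w = \<phi> \<circ>\<^sub>r (ratfun_X ^ q)"
proof -
  obtain p0 n where "w * ratfun_X ^ n = to_fract p0" using w by (auto simp: laurent_iff)
  hence w': "w * ratfun_X ^ (q * n) = to_fract (p0 * monom 1 (q * n - n))" (is "_ = to_fract ?p")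
    using q by (intro laurent_raise) auto
  define P where "P = Poly (map (\<lambda>i. coeff ?p (q * i)) [0..<Suc (degree ?p)])"
  have cP: "coeff P i = coeff ?p (q * i)" for i
  proof (cases "i \<le> degree ?p")
    case False
    moreover have "i \<le> q * i" using q by simp
    ultimately have "degree ?p < q * i" by linarith
    thus ?thesis using False by (simp add: P_def nth_default_def coeff_eq_0 del: upt_Suc)
  qed (simp add: P_def nth_default_def del: upt_Suc)
  have "?p = pcompose P (monom 1 q)"
  proof (rule poly_eqI)
    fix j
    show "coeff ?p j = coeff (pcompose P (monom 1 q)) j"
    proof (cases "q dvd j")
      case True
      thus ?thesis by (simp add: coeff_pcompose_monom[OF q] cP)
    next
      case False
      have "coeff ?p j = at_zero w $$ (int j - int (q * n))" using at_zero_nth[OF w'] by simp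
      moreover have "\<not> int q dvd (int j - int (q * n))" using False
        by (simp add: dvd_diff_left_iff)
      ultimately show ?thesis using nth False by (auto simp: coeff_pcompose_monom[OF q])
    qed
  qed
  define \<phi> where "\<phi> = to_fract P / ratfun_X ^ n"
  have Xq: "ratfun_degree (ratfun_X ^ q :: 'a ratfun) \<ge> 1" using q
    by (simp add: X_power ratfun_degree_to_fract degree_monom_eq)
  have "(\<phi> \<circ>\<^sub>r ratfun_X ^ q) * (ratfun_X ^ q) ^ n = to_fract P \<circ>\<^sub>r ratfun_X ^ q"
    by (simp add: \<phi>_def compose_divide[OF Xq] compose_power[OF Xq] X_compose[OF Xq])
  also have "\<dots> = to_fract (pcompose P (monom 1 q))"
    unfolding to_fract_compose[OF Xq] by (simp only: X_power poly_const_to_fract)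
  also have "\<dots> = w * (ratfun_X ^ q) ^ n" using w' \<open>?p = _\<close> by (simp add: power_mult)
  finally have "w = \<phi> \<circ>\<^sub>r ratfun_X ^ q" by simp
  moreover have "laurent_polynomial \<phi>" unfolding laurent_iff
    by (intro exI[of _ P] exI[of _ n]) (simp add: \<phi>_def)
  ultimately show ?thesis by blast
qed

lemma laurent_in_power_nth:
  assumes b: "laurent_polynomial b" and q: "q > 0"
  shows "at_zero (b \<circ>\<^sub>r (ratfun_X ^ q)) $$ i \<noteq> 0 \<Longrightarrow> int q dvd i"
    and "laurent_polynomial (b \<circ>\<^sub>r (ratfun_X ^ q))"
proof -
  obtain P n where P: "b * ratfun_X ^ n = to_fract P" using b by (auto simp: laurent_iff)
  have Xq: "ratfun_degree (ratfun_X ^ q :: 'a ratfun) \<ge> 1" using q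
    by (simp add: X_power ratfun_degree_to_fract degree_monom_eq)
  have "(b \<circ>\<^sub>r ratfun_X ^ q) * (ratfun_X ^ q) ^ n = to_fract P \<circ>\<^sub>r ratfun_X ^ q"
    by (simp flip: P add: compose_mult[OF Xq] compose_power[OF Xq] X_compose[OF Xq])
  also have "\<dots> = to_fract (pcompose P (monom 1 q))"
    unfolding to_fract_compose[OF Xq] by (simp only: X_power poly_const_to_fract)
  finally have eq: "(b \<circ>\<^sub>r ratfun_X ^ q) * ratfun_X ^ (q * n) = to_fract (pcompose P (monom 1 q))"
    by (simp add: power_mult)
  show "laurent_polynomial (b \<circ>\<^sub>r (ratfun_X ^ q))" using eq laurent_iff by blast
  assume "at_zero (b \<circ>\<^sub>r (ratfun_X ^ q)) $$ i \<noteq> 0"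
  hence *: "i + int (q * n) \<ge> 0" "q dvd nat (i + int (q * n))"
    unfolding at_zero_nth[OF eq] by (auto simp: coeff_pcompose_monom[OF q] split: if_splits)
  hence "int q dvd i + int (q * n)" by (metis int_dvd_int_iff nat_0_le)
  thus "int q dvd i" by (simp add: dvd_add_left_iff)
qed

section \<open>Right factors of Laurent polynomials\<close>

lemma nonconst_iff: "ratfun_degree f \<ge> 1 \<longleftrightarrow> (\<forall>c. f \<noteq> ratfun_const c)"
  using degree_eq_0_iff_const[of f] by (cases "ratfun_degree f = 0") auto

lemma dvd_monom_imp_monom:
  fixes p r :: "'a::field poly"
  assumes "p * r = monom 1 s"
  shows "\<exists>c i. p = monom c i"
  using assms
proof (induction s arbitrary: p r)
  case 0
  hence "p * r = 1" by (simp add: monom_0 one_pCons)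
  hence "is_unit p" by (metis dvd_triv_left)
  hence "degree p = 0" by (metis is_unit_iff_degree not_is_unit_0)
  thus ?case by (metis degree_eq_zeroE monom_0)
next
  case (Suc s)
  have m: "monom (1::'a) (Suc s) = pCons 0 (monom 1 s)" by (simp add: monom_Suc)
  obtain a p' where p: "p = pCons a p'" by (cases p)
  obtain b r' where r: "r = pCons b r'" by (cases r)
  have "coeff (p * r) 0 = 0" unfolding Suc.prems by simp
  hence "a = 0 \<or> b = 0" by (auto simp: p r mult_pCons_left)
  thus ?case
  proof
    assume "a = 0"
    hence "p' * r = monom 1 s" using Suc.prems by (simp add: p m)
    from Suc.IH[OF this] obtain c i where "p' = monom c i" by blast
    thus ?case using \<open>a = 0\<close> by (metis p monom_Suc)
  next
    assume "b = 0"
    hence "p * r' = monom 1 s" using Suc.prems by (simp add: r m)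
    from Suc.IH[OF this] show ?case .
  qed
qed

lemma laurent_denom:
  assumes "laurent_polynomial f"
  shows "denom f = monom 1 (pole_order_zero f)"
proof -
  obtain p j where p: "f * ratfun_X ^ j = to_fract p" using assms by (auto simp: laurent_iff)
  have feq: "f * to_fract (denom f) = to_fract (numer f)" using denom_nonzero[of f] by (subst (1) ratfun_quot) simp
  have "to_fract (numer f * monom 1 j) = to_fract (p * denom f)"
    by (simp flip: feq p X_power)
  hence "numer f * monom 1 j = p * denom f" by (simp only: to_fract_eq_iff)
  hence "denom f dvd numer f * monom 1 j" by simp
  hence "denom f dvd monom 1 j" by (rule coprime_dvd_cancel[OF numer_denom(2)])
  then obtain r where "denom f * r = monom 1 j" by (metis dvdE)
  then obtain k i where ki: "denom f = monom k i" using dvd_monom_imp_monom by blast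
  have "k = 1" using numer_denom(3)[of f] denom_nonzero[of f] ki by (auto simp: degree_monom_eq)
  hence "denom f = monom 1 i" using ki by simp
  thus ?thesis by (simp add: pole_order_zero_def order_0_monom)
qed

lemma laurent_unit:
  assumes "laurent_polynomial y" "laurent_polynomial (inverse y)" "y \<noteq> 0"
  shows "\<exists>c i n. c \<noteq> 0 \<and> y * ratfun_X ^ n = ratfun_const c * ratfun_X ^ i"
proof -
  obtain p n where p: "y * ratfun_X ^ n = to_fract p" using assms(1) by (auto simp: laurent_iff)
  obtain r m where r: "inverse y * ratfun_X ^ m = to_fract r" using assms(2) by (auto simp: laurent_iff)
  have "to_fract (p * r) = (y * inverse y) * ratfun_X ^ (n + m)" 
    by (simp add: power_add mult_ac flip: p r)
  hence "to_fract (p * r) = to_fract (monom 1 (n + m))" using assms(3) by (simp add: X_power)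
  hence "p * r = monom 1 (n + m)" by (simp only: to_fract_eq_iff)
  then obtain c i where c: "p = monom c i" using dvd_monom_imp_monom by blast
  have "p \<noteq> 0" using p assms(3) by auto
  hence "c \<noteq> 0" using c by auto
  moreover have "p = smult c (monom 1 i)" by (simp add: c smult_monom)
  ultimately show ?thesis using p by (metis X_power to_fract_smult)
qed

lemma ratfun_degree_inverse_X: "ratfun_degree (inverse ratfun_X :: 'a::field ratfun) = 1"
proof -
  have "inverse ratfun_X = Fract 1 ([:0, 1:] :: 'a poly)" by (simp add: ratfun_X_def to_fract_def)
  thus ?thesis by (simp add: ratfun_degree_Fract)
qed

lemma ratfun_degree_linear:
  fixes b :: "'a::field"
  assumes "b \<noteq> 0"
  shows "ratfun_degree (ratfun_const b * ratfun_X + ratfun_const c) = 1"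
proof -
  have "ratfun_const b * ratfun_X + ratfun_const c = to_fract [:c, b:]"
    by (simp add: ratfun_const_def ratfun_X_def flip: to_fract_mult to_fract_add)
  thus ?thesis using assms by (simp add: ratfun_degree_to_fract)
qed

lemma pole_at_infinity_normal:
  fixes u :: "'a::field ratfun"
  assumes u: "ratfun_degree u \<ge> 1"
  shows "\<exists>\<mu> u1 N. ratfun_degree \<mu> = 1 \<and> ratfun_degree u1 \<ge> 1 \<and> u = \<mu> \<circ>\<^sub>r u1 \<and> N > 0 \<and> leads (int N) 1 (at_inf u1)"
proof -
  have pole: "\<exists>\<mu> u1 N. ratfun_degree \<mu> = 1 \<and> ratfun_degree u1 \<ge> 1 \<and> u = \<mu> \<circ>\<^sub>r u1 \<and> N > 0 \<and> leads (int N) 1 (at_inf u1)"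
    if u: "ratfun_degree u \<ge> 1" and N: "leads N \<beta> (at_inf u)" "N > 0" "\<beta> \<noteq> 0" for u :: "'a ratfun" and N \<beta>
  proof -
    define u1 where "u1 = u / ratfun_const \<beta>"
    have eq: "u = ratfun_const \<beta> * u1" using N(3) by (simp add: u1_def)
    have d: "ratfun_degree u1 \<ge> 1" using u unfolding nonconst_iff eq by (metis ratfun_const_mult)
    have "u = (ratfun_const \<beta> * ratfun_X + ratfun_const 0) \<circ>\<^sub>r u1"
      using eq by (simp add: compose_mult[OF d] compose_const[OF d] X_compose[OF d])
    moreover have "leads N 1 (at_inf u1)"
      using leads_mult[OF leads_inverse[OF at_inf_const[of \<beta>] N(3)] N(1)] N(3)
      by (simp add: u1_def inf.eval_mult inf.eval_inverse divide_inverse mult.commute)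
    ultimately show ?thesis using ratfun_degree_linear[OF N(3), of 0] d N(2)
      by (intro exI[of _ "ratfun_const \<beta> * ratfun_X + ratfun_const 0"] exI[of _ u1] exI[of _ "nat N"]) auto
  qed
  have "u \<noteq> 0" using u by (metis nonconst_iff ratfun_const_0)
  then obtain N \<beta> where N: "\<beta> \<noteq> 0" "leads N \<beta> (at_inf u)" using leads_exists[of "at_inf u"] by auto
  show ?thesis
  proof (cases "N > 0")
    case True
    thus ?thesis using pole[OF u N(2)] N(1) by blast
  next
    case False
    \<comment> \<open>Move the finite value of \<open>u\<close> at infinity to infinity.\<close>
    define c where "c = (if N = 0 then \<beta> else 0)"
    define w where "w = u - ratfun_const c"
    have w0: "w \<noteq> 0" using u unfolding nonconst_iff w_def by auto
    then obtain M \<gamma> where M: "\<gamma> \<noteq> 0" "leads M \<gamma> (at_inf w)" using leads_exists[of "at_inf w"] by auto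
    have "leads 0 0 (at_inf w)"
    proof (cases "N = 0")
      case True
      thus ?thesis using leads_diff[OF N(2)[unfolded True] at_inf_const[of \<beta>]]
        by (simp add: w_def c_def inf.eval_diff)
    next
      case 2: False
      hence "N < 0" using False by simp
      thus ?thesis using leads_less[OF N(2), of 0] by (simp add: w_def c_def)
    qed
    then obtain d where "leads (0 - 1) d (at_inf w)" using leads_pred by blast
    hence "M < 0" using leads_le[OF M(2) _ M(1), of "0 - 1" d] by simp
    define v where "v = inverse w"
    have v1: "ratfun_degree v \<ge> 1" unfolding nonconst_iff
    proof (intro allI notI)
      fix e assume "v = ratfun_const e"
      hence "w = ratfun_const (inverse e)" by (metis v_def inverse_inverse_eq ratfun_const_inverse)
      hence "u = ratfun_const (inverse e + c)" by (simp add: w_def ratfun_const_add algebra_simps)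
      thus False using u by (metis nonconst_iff)
    qed
    have vl: "leads (- M) (inverse \<gamma>) (at_inf v)"
      unfolding v_def inf.eval_inverse by (rule leads_inverse[OF M(2) M(1)])
    obtain \<mu> u1 K where \<mu>: "ratfun_degree \<mu> = 1" "ratfun_degree u1 \<ge> 1" "v = \<mu> \<circ>\<^sub>r u1" "K > 0" "leads (int K) 1 (at_inf u1)"
      using pole[OF v1 vl] M(1) \<open>M < 0\<close> by auto
    define \<kappa> :: "'a ratfun" where "\<kappa> = (ratfun_const 1 * ratfun_X + ratfun_const c) \<circ>\<^sub>r inverse ratfun_X"
    have iX: "ratfun_degree (inverse ratfun_X :: 'a ratfun) \<ge> 1" by (simp add: ratfun_degree_inverse_X)
    have d\<kappa>: "ratfun_degree \<kappa> = 1"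
      unfolding \<kappa>_def by (simp only: ratfun_degree_compose[OF iX] ratfun_degree_linear[OF one_neq_zero] ratfun_degree_inverse_X mult_1)
    have \<kappa>eq: "\<kappa> = inverse ratfun_X + ratfun_const c"
      by (simp add: \<kappa>_def compose_add[OF iX] compose_const[OF iX] X_compose[OF iX])
    have "u = \<kappa> \<circ>\<^sub>r v"
      by (simp add: \<kappa>eq compose_add[OF v1] compose_inverse[OF v1] X_compose[OF v1] compose_const[OF v1])
        (simp add: v_def w_def)
    hence "u = (\<kappa> \<circ>\<^sub>r \<mu>) \<circ>\<^sub>r u1" using \<mu> by (simp add: compose_assoc)
    moreover have "ratfun_degree (\<kappa> \<circ>\<^sub>r \<mu>) = 1" using d\<kappa> \<mu>(1) by (simp add: ratfun_degree_compose)
    ultimately show ?thesis using \<mu> by blast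
  qed
qed

text \<open>A right factor \<open>u\<close> with a pole at infinity. Then \<open>a\<close> has a pole at infinity too, which is why its numerator has the
larger degree.\<close>

context
  fixes f a u :: "'a::field ratfun" and n N :: nat and \<phi> :: 'a
  assumes lf: "laurent_polynomial f" and fpole: "leads (int n) \<phi> (at_inf f)" "n > 0" "\<phi> \<noteq> 0"
    and fau: "f = a \<circ>\<^sub>r u" and u1: "ratfun_degree u \<ge> 1"
    and upole: "leads (int N) 1 (at_inf u)" "N > 0"
begin

lemma quot_compose: "f * (to_fract (denom a) \<circ>\<^sub>r u) = to_fract (numer a) \<circ>\<^sub>r u"
proof -
  have "a * to_fract (denom a) = to_fract (numer a)"
    using denom_nonzero[of a] by (subst (1) ratfun_quot) simp
  thus ?thesis unfolding fau by (simp flip: compose_mult[OF u1])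
qed

lemma at_inf_poly_compose:
  assumes "p \<noteq> 0"
  shows "leads (int (degree p) * int N) (lead_coeff p) (at_inf (to_fract p \<circ>\<^sub>r u))"
  using leads_poly[OF upole(1) _ order_refl, of p] upole(2) by (simp add: inf.eval_compose_poly[OF u1])

lemma numer_nonzero: "numer a \<noteq> 0"
proof
  assume "numer a = 0"
  hence "f * (to_fract (denom a) \<circ>\<^sub>r u) = 0" unfolding quot_compose by (simp add: compose_0[OF u1])
  hence "f = 0" using compose_eq_0_iff[OF u1, of "to_fract (denom a)"] denom_nonzero[of a] by simp
  thus False using fpole by simp
qed

lemma numer_degree_greater: "degree (denom a) < degree (numer a)"
proof -
  have "leads (int n + int (degree (denom a)) * int N) (\<phi> * lead_coeff (denom a))
      (at_inf (f * (to_fract (denom a) \<circ>\<^sub>r u)))"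
    unfolding inf.eval_mult by (intro leads_mult fpole at_inf_poly_compose denom_nonzero)
  moreover have "leads (int (degree (numer a)) * int N) (lead_coeff (numer a))
      (at_inf (f * (to_fract (denom a) \<circ>\<^sub>r u)))"
    unfolding quot_compose by (intro at_inf_poly_compose numer_nonzero)
  ultimately have "int n + int (degree (denom a)) * int N = int (degree (numer a)) * int N"
    by (rule leads_order_unique) (use fpole numer_nonzero numer_denom(3)[of a] in auto)
  hence "int (degree (denom a)) * int N < int (degree (numer a)) * int N" using fpole(2) by linarith
  thus ?thesis by (simp add: mult_less_cancel_right)
qed

text \<open>\<open>u\<close> is integral over \<open>K[f] \<subseteq> K[x, 1/x]\<close>, hence a Laurent polynomial.\<close>

lemma right_factor_laurent: "laurent_polynomial u"
proof -
  define p q g h D where "p = numer a" and "q = denom a" and "g = numer u" and "h = denom u" and "D = degree p"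
  have h0: "h \<noteq> 0" by (simp add: h_def denom_nonzero)
  have cop: "coprime g h" unfolding g_def h_def by (rule numer_denom)
  have ueq: "u = to_fract g / to_fract h" unfolding g_def h_def by (rule ratfun_quot)
  have deg: "degree q \<le> D" "coeff q D = 0" "p \<noteq> 0"
    using numer_degree_greater numer_nonzero by (auto simp: D_def p_def q_def coeff_eq_0)
  have c: "(to_fract r \<circ>\<^sub>r u) * to_fract h ^ D = to_fract (homog r D g h)" if "degree r \<le> D" for r
    using poly_const_homog[OF that h0, of g] by (simp add: to_fract_compose[OF u1] flip: ueq)
  have cp: "(to_fract p \<circ>\<^sub>r u) * to_fract h ^ D = to_fract (homog p D g h)" by (rule c) (simp add: D_def)
  obtain P j where P: "f * ratfun_X ^ j = to_fract P" using lf by (auto simp: laurent_iff)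
  have "to_fract (P * homog q D g h) = f * (to_fract q \<circ>\<^sub>r u) * to_fract h ^ D * ratfun_X ^ j"
    by (simp add: mult_ac flip: P c[OF deg(1)])
  also have "\<dots> = to_fract (homog p D g h * monom 1 j)"
    unfolding q_def quot_compose p_def[symmetric] cp by (simp add: X_power)
  finally have eq: "P * homog q D g h = homog p D g h * monom 1 j" by (simp only: to_fract_eq_iff)
  have "h dvd homog q D g h" using homog_cong_mod[of h q D g] deg(2) by simp
  hence 1: "h dvd homog p D g h * monom 1 j" unfolding eq[symmetric] by (rule dvd_mult)
  have "h dvd (homog p D g h - smult (coeff p D) (g ^ D)) * monom 1 j"
    by (intro dvd_mult2 homog_cong_mod)
  from dvd_diff[OF 1 this] have "h dvd smult (coeff p D) (monom 1 j * g ^ D)"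
    by (simp add: algebra_simps)
  hence "h dvd monom 1 j * g ^ D" using deg(3) by (simp add: dvd_smult_iff D_def)
  hence "h dvd monom 1 j" by (rule poly_coprime_dvd_power[OF cop])
  then obtain r where "h * r = monom 1 j" by (metis dvdE)
  then obtain c i where ci: "h = monom c i" using dvd_monom_imp_monom by blast
  moreover have "c \<noteq> 0" using h0 ci by auto
  moreover have "lead_coeff h = 1" unfolding h_def by (rule numer_denom)
  ultimately have "h = monom 1 i" by (simp add: degree_monom_eq)
  hence "u * ratfun_X ^ i = to_fract g" by (simp add: ueq X_power)
  thus ?thesis unfolding laurent_iff by blast
qed

text \<open>From \<open>\<alpha> p + \<beta> q = 1\<close> follows \<open>1/q(u) = \<alpha>(u) f + \<beta>(u)\<close>.\<close>

lemma denom_compose_unit: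
  "\<exists>c i m. c \<noteq> 0 \<and> (to_fract (denom a) \<circ>\<^sub>r u) * ratfun_X ^ m = ratfun_const c * ratfun_X ^ i"
proof (rule laurent_unit)
  let ?q = "to_fract (denom a) \<circ>\<^sub>r u"
  show q0: "?q \<noteq> 0" using compose_eq_0_iff[OF u1, of "to_fract (denom a)"] denom_nonzero[of a] by simp
  show "laurent_polynomial ?q" by (intro laurent_compose_poly right_factor_laurent u1)
  obtain \<alpha> \<beta> where bez: "\<alpha> * numer a + \<beta> * denom a = 1" using coprime_bezout[OF numer_denom(2)[of a]] by blast
  have "1 = to_fract (\<alpha> * numer a + \<beta> * denom a) \<circ>\<^sub>r u" unfolding bez by (simp add: compose_1[OF u1])
  also have "\<dots> = (to_fract \<alpha> \<circ>\<^sub>r u) * (f * ?q) + (to_fract \<beta> \<circ>\<^sub>r u) * ?q"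
    unfolding quot_compose by (simp add: compose_add[OF u1] compose_mult[OF u1])
  also have "\<dots> = ((to_fract \<alpha> \<circ>\<^sub>r u) * f + (to_fract \<beta> \<circ>\<^sub>r u)) * ?q" by (simp add: algebra_simps)
  finally have "inverse ?q = (to_fract \<alpha> \<circ>\<^sub>r u) * f + (to_fract \<beta> \<circ>\<^sub>r u)"
    by (metis inverse_unique mult.commute)
  thus "laurent_polynomial (inverse ?q)"
    by (auto intro!: laurent_add laurent_mult laurent_compose_poly right_factor_laurent lf u1)
qed

lemma at_zero_poly_compose:
  assumes "leads (int i) \<gamma> (at_zero u)" "i > 0"
  shows "leads (int (degree p) * int i) (lead_coeff p * \<gamma> ^ degree p) (at_zero (to_fract p \<circ>\<^sub>r u))"
  using leads_poly[OF assms(1) _ order_refl, of p] assms(2) by (simp add: zer.eval_compose_poly[OF u1])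

lemma denom_order_at_zero:
  assumes "leads e \<delta> (at_zero (to_fract (denom a) \<circ>\<^sub>r u))" "\<delta> \<noteq> 0"
  shows "e = - (int (degree (denom a)) * int N)"
proof -
  let ?q = "to_fract (denom a) \<circ>\<^sub>r u"
  obtain c i m where c: "c \<noteq> 0" "?q * ratfun_X ^ m = ratfun_const c * ratfun_X ^ i"
    using denom_compose_unit by blast
  have "leads (e + int m * (-1)) (\<delta> * 1 ^ m) (at_zero (?q * ratfun_X ^ m))"
    unfolding zer.eval_mult zer.eval_power by (intro leads_mult leads_power at_zero_X assms(1))
  moreover have "leads (0 + int i * (-1)) (c * 1 ^ i) (at_zero (?q * ratfun_X ^ m))"
    unfolding c(2) zer.eval_mult zer.eval_power by (intro leads_mult leads_power at_zero_X at_zero_const)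
  ultimately have 1: "e + int m * (-1) = 0 + int i * (-1)"
    by (rule leads_order_unique) (use assms(2) c(1) in auto)
  have "leads (int (degree (denom a)) * int N + int m * 1) (lead_coeff (denom a) * 1 ^ m) (at_inf (?q * ratfun_X ^ m))"
    unfolding inf.eval_mult inf.eval_power by (intro leads_mult leads_power at_inf_X at_inf_poly_compose denom_nonzero)
  moreover have "leads (0 + int i * 1) (c * 1 ^ i) (at_inf (?q * ratfun_X ^ m))"
    unfolding c(2) inf.eval_mult inf.eval_power by (intro leads_mult leads_power at_inf_X at_inf_const)
  ultimately have "int (degree (denom a)) * int N + int m * 1 = 0 + int i * 1"
    by (rule leads_order_unique) (use numer_denom(3)[of a] c(1) in auto)
  thus ?thesis using 1 by simp
qed

lemma left_factor_poly:
  assumes "degree (denom a) = 0"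
  shows "a = to_fract (numer a)"
proof -
  obtain c where "denom a = [:c:]" using assms by (auto elim: degree_eq_zeroE)
  hence "denom a = 1" using numer_denom(3)[of a] by (simp add: one_pCons)
  thus ?thesis using ratfun_quot[of a] by simp
qed

text \<open>Let \<open>q\<close> be the denominator of \<open>a\<close>. The unit \<open>q(u) = c x\<^sup>k\<close> has opposite orders at zero and infinity. If \<open>u\<close> has
poles at both ends, so has \<open>q(u)\<close> unless \<open>q\<close> is constant. If \<open>u\<close> has no pole at zero, it is a polynomial, and \<open>q(u)\<close>
vanishes at zero.\<close>

lemma left_factor_cases:
  "(\<exists>p. a = to_fract p) \<or>
   (\<exists>g c. u = to_fract g \<and> coeff g 0 = c \<and> poly (denom a) c = 0)"
proof (cases "degree (denom a) = 0")
  case True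
  thus ?thesis using left_factor_poly by blast
next
  case False
  let ?q = "to_fract (denom a) \<circ>\<^sub>r u"
  have "u \<noteq> 0" using upole by auto
  then obtain e \<gamma> where e: "\<gamma> \<noteq> 0" "leads e \<gamma> (at_zero u)" using leads_exists[of "at_zero u"] by auto
  have "e \<le> 0"
  proof (rule ccontr)
    assume "\<not> e \<le> 0"
    hence "leads (int (degree (denom a)) * int (nat e)) (lead_coeff (denom a) * \<gamma> ^ degree (denom a)) (at_zero ?q)"
      using e(2) by (intro at_zero_poly_compose) auto
    from denom_order_at_zero[OF this]
    have "int (degree (denom a)) * e = - (int (degree (denom a)) * int N)"
      using e(1) denom_nonzero[of a] \<open>\<not> e \<le> 0\<close> by simp
    moreover have "int (degree (denom a)) * e > 0" "int (degree (denom a)) * int N > 0"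
      using False upole(2) \<open>\<not> e \<le> 0\<close> by simp_all
    ultimately show False by linarith
  qed
  hence e0: "leads 0 (at_zero u $$ 0) (at_zero u)"
    using e(2) by (auto simp: leads_def)
  \<comment> \<open>Without a pole at \<open>0\<close>, \<open>u\<close> is a polynomial.\<close>
  obtain P n where P: "u * ratfun_X ^ n = to_fract P" using right_factor_laurent by (auto simp: laurent_iff)
  define g where "g = poly_shift n P"
  have "coeff P i = 0" if "i < n" for i
    using at_zero_nth[OF P, of "int i - int n"] leads_nth(1)[OF e0, of "int i - int n"] that by simp
  hence "P = g * monom 1 n"
    by (intro poly_eqI) (auto simp: g_def mult.commute[of _ "monom 1 n"] coeff_monom_mult coeff_poly_shift not_less)
  hence "u * ratfun_X ^ n = to_fract g * ratfun_X ^ n" using P by (simp add: X_power)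
  hence ug: "u = to_fract g" by simp
  have "leads 0 (coeff (pcompose (denom a) g) 0) (at_zero ?q)"
    unfolding to_fract_compose[OF u1] unfolding ug poly_const_to_fract by (rule at_zero_to_fract)
  hence "coeff (pcompose (denom a) g) 0 = 0"
    using denom_order_at_zero[of 0] False upole(2) by auto
  hence "poly (denom a) (coeff g 0) = 0" by (simp add: poly_0_coeff_0[symmetric] poly_pcompose)
  thus ?thesis using ug by blast
qed

text \<open>\<open>g\<close> divides the monomial \<open>q(g)\<close>, hence is itself a monomial; then \<open>q\<close> can have only one term.\<close>

lemma right_factor_monomial:
  assumes g: "u = to_fract g" "coeff g 0 = 0" and q: "poly (denom a) 0 = 0"
  shows "u = ratfun_X ^ N" and "laurent_polynomial a"
proof -
  let ?q = "denom a"
  obtain c i m where c: "c \<noteq> 0" "(to_fract ?q \<circ>\<^sub>r u) * ratfun_X ^ m = ratfun_const c * ratfun_X ^ i"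
    using denom_compose_unit by blast
  have "to_fract (pcompose ?q g * monom 1 m) = to_fract (smult c (monom 1 i))"
    using c(2) unfolding to_fract_compose[OF u1] unfolding g(1) poly_const_to_fract
    by (simp add: X_power to_fract_smult)
  hence eq: "pcompose ?q g * monom 1 m = smult c (monom 1 i)" by (simp only: to_fract_eq_iff)
  obtain q' where q': "?q = [:0, 1:] * q'" using q by (metis dvdE poly_eq_0_iff_dvd minus_zero)
  have "pcompose ?q g = g * pcompose q' g" by (simp add: q' pcompose_mult pcompose_pCons)
  hence "g * smult (inverse c) (pcompose q' g * monom 1 m) = smult (inverse c) (smult c (monom 1 i))"
    using eq by (simp add: mult.assoc)
  hence "g * smult (inverse c) (pcompose q' g * monom 1 m) = monom 1 i" using c(1) by simp
  then obtain d k where gk: "g = monom d k" using dvd_monom_imp_monom by blast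
  have g0: "g \<noteq> 0" using upole g by auto
  have "leads (int (degree g)) (lead_coeff g) (at_inf u)" unfolding g(1) by (rule at_inf_to_fract[OF g0])
  hence "int (degree g) = int N" "lead_coeff g = 1"
    using leads_order_unique[OF _ upole(1)] g0 by auto
  hence gN: "g = monom 1 N" using gk g0 by (auto simp: degree_monom_eq)
  thus "u = ratfun_X ^ N" by (simp add: g X_power)
  have "coeff ?q j = 0" if "j \<noteq> degree ?q" for j
  proof (rule ccontr)
    assume j: "coeff ?q j \<noteq> 0"
    have cf: "coeff (pcompose ?q g * monom 1 m) (N * l + m) = coeff ?q l" for l
      using upole(2) by (simp add: gN mult.commute[of _ "monom 1 m"] coeff_monom_mult coeff_pcompose_monom)
    have "N * l + m = i" if "coeff ?q l \<noteq> 0" for l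
      using cf[of l] that c(1) by (auto simp: eq split: if_splits)
    hence "N * j + m = N * degree ?q + m" using j denom_nonzero[of a] by force
    thus False using upole(2) that by simp
  qed
  hence "?q = monom 1 (degree ?q)" using numer_denom(3)[of a] by (intro poly_eqI) auto
  thus "laurent_polynomial a"
    unfolding laurent_polynomial_def using numer_denom(1)[of a] by metis
qed

end

text \<open>The poles of \<open>f\<close> are at zero and infinity, so those of \<open>a\<close> are among \<open>u(0)\<close> and \<open>u(\<infinity>)\<close>. If they are one point, it is
moved to infinity and \<open>a\<close> becomes a polynomial. If they are two points, \<open>u\<close> takes each of them only once, and moving
them to zero and infinity makes \<open>u\<close> a power of \<open>x\<close>.\<close>

theorem laurent_factor_normal_form:
  fixes f a u :: "'a::field ratfun"
  assumes lf: "laurent_polynomial f" and fpole: "leads (int n) \<phi> (at_inf f)" "n > 0" "\<phi> \<noteq> 0"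
    and fau: "f = a \<circ>\<^sub>r u" and u1: "ratfun_degree u \<ge> 1"
  shows "\<exists>\<mu> u'. ratfun_degree \<mu> = 1 \<and> ratfun_degree u' \<ge> 1 \<and> u = \<mu> \<circ>\<^sub>r u' \<and>
    ((\<exists>p N. a \<circ>\<^sub>r \<mu> = to_fract p \<and> laurent_polynomial u' \<and> N > 0 \<and> leads (int N) 1 (at_inf u')) \<or>
     (laurent_polynomial (a \<circ>\<^sub>r \<mu>) \<and> (\<exists>k\<ge>1. u' = ratfun_X ^ k)))"
proof -
  obtain \<mu> u' N where \<mu>: "ratfun_degree \<mu> = 1" "ratfun_degree u' \<ge> 1" "u = \<mu> \<circ>\<^sub>r u'" "N > 0" "leads (int N) 1 (at_inf u')"
    using pole_at_infinity_normal[OF u1] by blast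
  have f': "f = (a \<circ>\<^sub>r \<mu>) \<circ>\<^sub>r u'" using \<mu> by (simp add: fau compose_assoc)
  note ctx = lf fpole f' \<mu>(2,5,4)
  have lu: "laurent_polynomial u'" by (rule right_factor_laurent[OF ctx])
  from left_factor_cases[OF ctx] show ?thesis
  proof
    assume "\<exists>p. a \<circ>\<^sub>r \<mu> = to_fract p"
    thus ?thesis using \<mu> lu by blast
  next
    assume "\<exists>g c. u' = to_fract g \<and> coeff g 0 = c \<and> poly (denom (a \<circ>\<^sub>r \<mu>)) c = 0"
    then obtain g c where g: "u' = to_fract g" "coeff g 0 = c" by blast
    \<comment> \<open>Translate \<open>u'\<close> so that it vanishes at \<open>0\<close>.\<close>
    define u2 where "u2 = to_fract (g - [:c:])"
    define \<tau> where "\<tau> = ratfun_const 1 * ratfun_X + ratfun_const c"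
    have u2': "u' = u2 + ratfun_const c" by (simp add: g u2_def ratfun_const_def to_fract_diff)
    have d2: "ratfun_degree u2 \<ge> 1" using \<mu>(2) unfolding nonconst_iff u2' by (metis ratfun_const_add)
    have \<tau>: "ratfun_degree \<tau> = 1" unfolding \<tau>_def by (rule ratfun_degree_linear) simp
    have u': "u' = \<tau> \<circ>\<^sub>r u2"
      by (simp add: \<tau>_def u2' compose_add[OF d2] compose_const[OF d2] X_compose[OF d2])
    define \<kappa> where "\<kappa> = \<mu> \<circ>\<^sub>r \<tau>"
    have \<kappa>: "ratfun_degree \<kappa> = 1" "u = \<kappa> \<circ>\<^sub>r u2" using \<mu> \<tau> d2
      by (simp_all add: \<kappa>_def ratfun_degree_compose u' compose_assoc)
    have "leads (int N) 0 (at_inf (ratfun_const c))" using leads_less[OF at_inf_const[of c], of "int N"] \<mu>(4) by simp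
    from leads_diff[OF \<mu>(5) this] have l2: "leads (int N) 1 (at_inf u2)" by (simp add: u2' inf.eval_add)
    have f2: "f = (a \<circ>\<^sub>r \<kappa>) \<circ>\<^sub>r u2" using \<kappa> d2 by (simp add: fau compose_assoc)
    note ctx2 = lf fpole f2 d2 l2 \<mu>(4)
    have g2: "coeff (g - [:c:]) 0 = 0" using g by simp
    from left_factor_cases[OF ctx2] consider p where "a \<circ>\<^sub>r \<kappa> = to_fract p" | "poly (denom (a \<circ>\<^sub>r \<kappa>)) 0 = 0"
      using g2 by (auto simp: u2_def simp del: to_fract_diff)
    thus ?thesis
    proof cases
      case 1
      thus ?thesis using \<kappa> d2 \<mu>(4) l2 right_factor_laurent[OF ctx2] by blast
    next
      case 2
      have "u2 = ratfun_X ^ N" "laurent_polynomial (a \<circ>\<^sub>r \<kappa>)"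
        by (rule right_factor_monomial[OF ctx2 _ g2 2]; simp add: u2_def)+
      thus ?thesis using \<kappa> d2 \<mu>(4) by (metis Suc_leI One_nat_def)
    qed
  qed
qed

section \<open>Approximate roots\<close>

text \<open>Take \<open>C\<close> with the least degree of \<open>g - C\<^sup>k\<close>. Adding \<open>\<delta> x\<^sup>i\<close> to \<open>C\<close> changes the coefficient of degree
\<open>i + (k - 1) r\<close> of \<open>C\<^sup>k\<close> by \<open>k \<beta>\<^sup>k\<^sup>-\<^sup>1 \<delta>\<close>, so an error of degree at least \<open>(k - 1) r\<close> could be
improved.\<close>

lemma approximate_root:
  fixes g :: "'a::field poly"
  assumes k: "k > 0" "of_nat k \<noteq> (0::'a)" and \<beta>: "\<beta> \<noteq> 0"
    and g: "degree g = k * r" "lead_coeff g = \<beta> ^ k"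
  shows "\<exists>C. degree C = r \<and> lead_coeff C = \<beta> \<and>
    degree (g - C ^ k) \<le> (k - 1) * r \<and> coeff (g - C ^ k) ((k - 1) * r) = 0"
proof (rule ccontr)
  assume no: "\<not> ?thesis"
  define P where "P = (\<lambda>C. degree C = r \<and> lead_coeff C = \<beta>)"
  have "P (monom \<beta> r)" using \<beta> by (simp add: P_def degree_monom_eq)
  then obtain C where C: "P C" and min: "\<And>C'. P C' \<Longrightarrow> degree (g - C ^ k) \<le> degree (g - C' ^ k)"
    using ex_has_least_nat[of P _ "\<lambda>C. degree (g - C ^ k)"] by blast
  define R e where "R = g - C ^ k" and "e = degree R"
  have top: "degree (C ^ k) \<le> k * r" "coeff (C ^ k) (k * r) = \<beta> ^ k"
    using coeff_power_top[of C r k] C by (auto simp: P_def)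
  have noC: "\<not> (degree R \<le> (k - 1) * r \<and> coeff R ((k - 1) * r) = 0)"
    using no C by (auto simp: P_def R_def)
  hence R0: "R \<noteq> 0" by auto
  have e1: "(k - 1) * r \<le> e"
  proof (rule ccontr)
    assume "\<not> ?thesis"
    thus False using noC by (simp add: e_def coeff_eq_0)
  qed
  have "degree R \<le> k * r" unfolding R_def by (intro degree_diff_le) (use g top in auto)
  moreover have "coeff R (k * r) = 0" using g top by (simp add: R_def)
  ultimately have e2: "e < k * r" using R0 unfolding e_def by (metis leading_coeff_0_iff le_neq_implies_less)
  define i where "i = e - (k - 1) * r"
  have kr: "k * r = (k - 1) * r + r" using k(1) by (cases k) auto
  have i: "i < r" "e = i + (k - 1) * r" using e1 e2 kr by (auto simp: i_def)
  define \<delta> where "\<delta> = lead_coeff R / (of_nat k * \<beta> ^ (k - 1))"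
  define C' where "C' = C + monom \<delta> i"
  have dC': "degree C' \<le> r" "coeff C' r = \<beta>"
    using C i(1) by (auto simp: C'_def P_def intro!: degree_add_le order_trans[OF degree_monom_le])
  hence PC': "P C'" using \<beta> le_degree[of C' r] by (auto simp: P_def)
  define S where "S = (\<Sum>j<k. C ^ (k - Suc j) * C' ^ j)"
  have Sj: "degree (C ^ (k - Suc j) * C' ^ j) \<le> (k - 1) * r \<and>
      coeff (C ^ (k - Suc j) * C' ^ j) ((k - 1) * r) = \<beta> ^ (k - 1)" if "j < k" for j
  proof -
    have C1: "degree (C ^ (k - Suc j)) \<le> (k - Suc j) * r" "coeff (C ^ (k - Suc j)) ((k - Suc j) * r) = \<beta> ^ (k - Suc j)"
      using coeff_power_top[of C r "k - Suc j"] C by (auto simp: P_def)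
    have C2: "degree (C' ^ j) \<le> j * r" "coeff (C' ^ j) (j * r) = \<beta> ^ j"
      using coeff_power_top[of C' r j] dC' by auto
    have eq: "(k - Suc j) * r + j * r = (k - 1) * r" "\<beta> ^ (k - Suc j) * \<beta> ^ j = \<beta> ^ (k - 1)"
      using that by (simp_all flip: add_mult_distrib power_add)
    show ?thesis using coeff_mult_top[OF C1(1) C2(1)] C1 C2 eq
      degree_mult_le[of "C ^ (k - Suc j)" "C' ^ j"] by auto
  qed
  have S: "degree S \<le> (k - 1) * r" unfolding S_def by (intro degree_sum_le) (use Sj in auto)
  have "coeff S ((k - 1) * r) = (\<Sum>j<k. \<beta> ^ (k - 1))"
    unfolding S_def coeff_sum by (intro sum.cong refl) (use Sj in auto)
  hence cS: "coeff S ((k - 1) * r) = of_nat k * \<beta> ^ (k - 1)" by simp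
  have "C' ^ k - C ^ k = monom \<delta> i * S"
    by (simp add: power_diff_sumr2 S_def) (simp add: C'_def)
  hence R': "g - C' ^ k = R - monom \<delta> i * S" by (simp add: R_def algebra_simps)
  have "coeff (monom \<delta> i * S) e = \<delta> * (of_nat k * \<beta> ^ (k - 1))"
    using coeff_mult_top[of "monom \<delta> i" i S "(k - 1) * r"] S cS by (simp add: i(2) degree_monom_le)
  hence "coeff (monom \<delta> i * S) e = lead_coeff R" using k(2) \<beta> by (simp add: \<delta>_def)
  moreover have "degree (monom \<delta> i * S) \<le> e"
    using degree_mult_le[of "monom \<delta> i" S] S degree_monom_le[of \<delta> i] i(2) by linarith
  ultimately have "degree (g - C' ^ k) \<le> e" "coeff (g - C' ^ k) e = 0"
    unfolding R' by (auto simp: e_def intro!: degree_diff_le)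
  moreover have "e \<le> degree (g - C' ^ k)" using min[OF PC'] by (simp add: e_def R_def)
  ultimately have "g - C' ^ k = 0" by (metis antisym leading_coeff_0_iff)
  moreover have "\<not> (degree (g - C' ^ k) \<le> (k - 1) * r \<and> coeff (g - C' ^ k) ((k - 1) * r) = 0)"
    using no PC' by (auto simp: P_def)
  ultimately show False by simp
qed

section \<open>Factors of \<open>f\<close> when \<open>f\<close> is a function of \<open>x\<^sup>q\<close>\<close>

definition supported_on :: "nat \<Rightarrow> 'a::field fls \<Rightarrow> bool" where
  "supported_on q F \<longleftrightarrow> (\<forall>i. F $$ i \<noteq> 0 \<longrightarrow> int q dvd i)"

lemma supported_on_mult:
  assumes "supported_on q F" "supported_on q G"
  shows "supported_on q (F * G)"
  unfolding supported_on_def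
proof (intro allI impI)
  fix n assume "(F * G) $$ n \<noteq> 0"
  then obtain i where "F $$ i * G $$ (n - i) \<noteq> 0"
    unfolding fls_times_nth(2) by (metis (mono_tags, lifting) sum.neutral)
  hence "int q dvd i" "int q dvd n - i" using assms by (auto simp: supported_on_def)
  thus "int q dvd n" by (metis diff_add_cancel dvd_add)
qed

lemma supported_on_power: "supported_on q F \<Longrightarrow> supported_on q (F ^ k)"
proof (induction k)
  case (Suc k)
  thus ?case by (simp add: supported_on_mult)
qed (simp add: supported_on_def)

text \<open>Let \<open>V\<close> be the part of \<open>W\<close> with exponents divisible by \<open>q\<close>. The first term of \<open>W - V\<close> produces the first
term of \<open>W\<^sup>k - V\<^sup>k\<close>, whose exponent is not divisible by \<open>q\<close>; this term is too large to be part of the error.\<close>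

lemma root_supported_on:
  assumes F: "supported_on q F" and W: "leads (int R) \<beta> W" "\<beta> \<noteq> (0::'a::field)" and q: "q dvd R"
    and c: "c \<noteq> 0" and k: "k > 0" "of_nat k \<noteq> (0::'a)"
    and small: "leads (int ((k - 1) * R)) 0 (F - fls_const c * W ^ k)"
    and i: "i \<le> 0" "W $$ i \<noteq> 0"
  shows "int q dvd i"
proof (rule ccontr)
  assume ni: "\<not> int q dvd i"
  define V where "V = Abs_fls (\<lambda>j. if int q dvd j then W $$ j else 0)"
  have V: "V $$ j = (if int q dvd j then W $$ j else 0)" for j
    unfolding V_def by (rule nth_Abs_fls_lower_bound[of "- int R"]) (use leads_nth(1)[OF W(1)] in auto)
  have "supported_on q V" by (auto simp: supported_on_def V)
  hence Vk: "supported_on q (V ^ k)" by (rule supported_on_power)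
  have lV: "leads (int R) \<beta> V" using W(1) q by (auto simp: leads_def V)
  have D: "(W - V) $$ j = (if int q dvd j then 0 else W $$ j)" for j by (simp add: V)
  define i0 where "i0 = fls_subdegree (W - V)"
  have nz: "W - V \<noteq> 0" using D[of i] ni i(2) by auto
  hence "(W - V) $$ i0 \<noteq> 0" unfolding i0_def by (rule nth_fls_subdegree_nonzero)
  hence i0: "\<not> int q dvd i0" "W $$ i0 \<noteq> 0" using D[of i0] by (auto split: if_splits)
  have "i0 \<le> i" unfolding i0_def by (rule fls_subdegree_leI) (use D[of i] ni i(2) in simp)
  have "leads (- i0) (W $$ i0) (W - V)" using leads_subdegree[OF nz] D[of i0] i0(1) by (simp add: i0_def)
  from leads_power_diff[OF W(1) lV this k(1)]
  have l: "leads (- i0 + int (k - 1) * int R) (W $$ i0 * (of_nat k * \<beta> ^ (k - 1))) (W ^ k - V ^ k)" .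
  define j where "j = i0 - int (k - 1) * int R"
  have nj: "\<not> int q dvd j"
  proof
    assume "int q dvd j"
    moreover have "int q dvd int (k - 1) * int R" using q by simp
    ultimately have "int q dvd j + int (k - 1) * int R" by (rule dvd_add)
    thus False using i0(1) by (simp add: j_def)
  qed
  have "(W ^ k - V ^ k) $$ j = W $$ i0 * (of_nat k * \<beta> ^ (k - 1))"
    using leads_nth(2)[OF l] by (simp add: j_def)
  hence "(W ^ k - V ^ k) $$ j \<noteq> 0" using i0(2) k(2) W(2) by simp
  moreover have "(V ^ k) $$ j = 0" using Vk nj by (auto simp: supported_on_def)
  ultimately have "(W ^ k) $$ j \<noteq> 0" by simp
  moreover have "F $$ j = 0" using F nj by (auto simp: supported_on_def)
  moreover have "(F - fls_const c * W ^ k) $$ j = 0"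
    using leads_nth[OF small] \<open>i0 \<le> i\<close> i(1) by (cases "i0 = 0") (auto simp: j_def)
  ultimately show False using c by simp
qed

definition tame_laurent :: "'a::field ratfun \<Rightarrow> bool" where
  "tame_laurent f \<longleftrightarrow> laurent_polynomial f \<and>
     (\<exists>n \<phi>. n > 0 \<and> \<phi> \<noteq> 0 \<and> of_nat n \<noteq> (0::'a) \<and> leads (int n) \<phi> (at_inf f))"

context
  fixes u :: "'a::field ratfun" and N :: nat
  assumes lu: "laurent_polynomial u" and u1: "ratfun_degree u \<ge> 1"
    and upole: "leads (int N) 1 (at_inf u)" "N > 0"
begin

lemma composite_in_power:
  fixes a C :: "'a poly"
  assumes a: "degree C = r" "lead_coeff C = 1" "c \<noteq> 0" "k > 0" "of_nat k \<noteq> (0::'a)"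
      "degree (a - smult c (C ^ k)) \<le> (k - 1) * r" "coeff (a - smult c (C ^ k)) ((k - 1) * r) = 0"
    and f: "to_fract a \<circ>\<^sub>r u = b \<circ>\<^sub>r (ratfun_X ^ q)" "laurent_polynomial b" and q: "q > 0"
    and qN: "q dvd r * N"
    and qM: "\<And>M \<gamma>. M > 0 \<Longrightarrow> \<gamma> \<noteq> 0 \<Longrightarrow> leads (int M) \<gamma> (at_zero u) \<Longrightarrow> q dvd r * M"
  shows "\<exists>\<psi>. laurent_polynomial \<psi> \<and> to_fract C \<circ>\<^sub>r u = \<psi> \<circ>\<^sub>r (ratfun_X ^ q)"
proof (rule laurent_in_power[OF laurent_compose_poly[OF lu u1] q])
  let ?f = "to_fract a \<circ>\<^sub>r u" and ?w = "to_fract C \<circ>\<^sub>r u"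
  have lf: "laurent_polynomial ?f" by (rule laurent_compose_poly[OF lu u1])
  have lw: "laurent_polynomial ?w" by (rule laurent_compose_poly[OF lu u1])
  have supp0: "supported_on q (at_zero ?f)"
    using laurent_in_power_nth(1)[OF f(2) q] by (simp add: supported_on_def f(1))
  hence suppi: "supported_on q (at_inf ?f)"
    by (auto simp: supported_on_def laurent_nth[OF lf])
  have diff: "?f - ratfun_const c * ?w ^ k = to_fract (a - smult c (C ^ k)) \<circ>\<^sub>r u"
    by (simp add: compose_diff[OF u1] compose_mult[OF u1] compose_const[OF u1] compose_power[OF u1]
      to_fract_smult to_fract_power)
  have inf: "int q dvd i" if "i \<le> 0" "at_inf ?w $$ i \<noteq> 0" for i
  proof (rule root_supported_on[OF suppi _ _ qN a(3-5) _ that])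
    show "leads (int (r * N)) 1 (at_inf ?w)"
      using leads_poly[OF upole(1) _ order_refl, of C] upole(2) a(1,2)
      by (simp add: inf.eval_compose_poly[OF u1])
    have "leads (int ((k - 1) * r) * int N) 0 (at_inf (?f - ratfun_const c * ?w ^ k))"
      unfolding diff inf.eval_compose_poly[OF u1]
      using leads_poly[OF upole(1) _ a(6)] upole(2) unfolding a(7) by simp
    thus "leads (int ((k - 1) * (r * N))) 0 (at_inf ?f - fls_const c * at_inf ?w ^ k)"
      by (simp add: inf.eval_diff inf.eval_mult inf.eval_power inf.eval_const mult.assoc)
  qed simp
  fix i assume i: "at_zero ?w $$ i \<noteq> 0"
  show "int q dvd i"
  proof (cases "i \<ge> 0")
    case True
    hence "at_inf ?w $$ (- i) \<noteq> 0" using i laurent_nth[OF lw, of "- i"] by simp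
    thus ?thesis using inf[of "- i"] True by simp
  next
    case neg: False
    have "u \<noteq> 0" using upole by auto
    then obtain e \<gamma> where e: "\<gamma> \<noteq> 0" "leads e \<gamma> (at_zero u)" using leads_exists[of "at_zero u"] by auto
    have "e > 0"
    proof (rule ccontr)
      assume "\<not> e > 0"
      hence u0: "leads 0 (at_zero u $$ 0) (at_zero u)" using e(2) by (auto simp: leads_def)
      obtain d where "leads 0 d (at_zero ?w)"
        using leads_poly_regular[OF u0, of C] by (auto simp: zer.eval_compose_poly[OF u1])
      thus False using leads_nth(1) i neg by fastforce
    qed
    define M where "M = nat e"
    have M: "M > 0" "leads (int M) \<gamma> (at_zero u)" using e \<open>e > 0\<close> by (auto simp: M_def)
    show ?thesis
    proof (rule root_supported_on[OF supp0 _ _ qM[OF M(1) e(1) M(2)] a(3-5) _ _ i])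
      show "leads (int (r * M)) (\<gamma> ^ r) (at_zero ?w)"
        using leads_poly[OF M(2) _ order_refl, of C] M(1) a(1,2)
        by (simp add: zer.eval_compose_poly[OF u1])
      have "leads (int ((k - 1) * r) * int M) 0 (at_zero (?f - ratfun_const c * ?w ^ k))"
        unfolding diff zer.eval_compose_poly[OF u1]
        using leads_poly[OF M(2) _ a(6)] M(1) unfolding a(7) by simp
      thus "leads (int ((k - 1) * (r * M))) 0 (at_zero ?f - fls_const c * at_zero ?w ^ k)"
        by (simp add: zer.eval_diff zer.eval_mult zer.eval_power zer.eval_const mult.assoc)
    qed (use neg e(1) in auto)
  qed
qed

text \<open>The approximate root must have degree \<open>r\<close> such that \<open>q\<close> divides \<open>r\<close> times the pole orders of \<open>u\<close>. If \<open>q\<close> does not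
divide \<open>deg p\<close>, it divides the pole orders of \<open>u\<close> already, and \<open>r = 1\<close> will do.\<close>

lemma common_multiple_with_power:
  assumes tame: "tame_laurent f" and f: "f = to_fract p \<circ>\<^sub>r u" "f = b \<circ>\<^sub>r (ratfun_X ^ q)" "laurent_polynomial b"
    and q: "prime q"
  shows "\<exists>s t. to_fract s \<circ>\<^sub>r u = t \<circ>\<^sub>r (ratfun_X ^ q) \<and> degree s = (if q dvd degree p then q else 1)"
proof -
  obtain n \<phi> where n: "n > 0" "\<phi> \<noteq> 0" "of_nat n \<noteq> (0::'a)" "leads (int n) \<phi> (at_inf f)"
    using tame by (auto simp: tame_laurent_def)
  have lf: "laurent_polynomial f" using tame by (simp add: tame_laurent_def)
  define d where "d = degree p"
  have p0: "p \<noteq> 0"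
  proof
    assume "p = 0"
    hence "f = 0" by (simp add: f(1) compose_0[OF u1])
    thus False using n by simp
  qed
  have fd: "leads (int d * int N) (lead_coeff p) (at_inf f)"
    using leads_poly[OF upole(1) _ order_refl, of p] upole(2) by (simp add: f(1) inf.eval_compose_poly[OF u1] d_def)
  have nd: "n = d * N"
    using leads_order_unique(1)[OF n(4) fd n(2)] p0 by (simp flip: of_nat_mult)
  have supp: "q dvd m" if "leads (int m) \<chi> (at_zero f)" "\<chi> \<noteq> 0" for m \<chi>
    using laurent_in_power_nth(1)[OF f(3) prime_gt_0_nat[OF q], of "- int m"] leads_nth(2)[OF that(1)] that(2)
    by (simp add: f(2))
  have "at_zero f $$ int n \<noteq> 0" using leads_nth(2)[OF n(4)] laurent_nth[OF lf, of "- int n"] n(2) by simp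
  hence qn: "q dvd n"
    using laurent_in_power_nth(1)[OF f(3) prime_gt_0_nat[OF q], of "int n"] by (simp add: f(2))
  define r where "r = (if q dvd d then q else 1)"
  have rd: "r dvd d" by (simp add: r_def)
  then obtain k where k: "d = k * r" by (metis dvdE mult.commute)
  have k0: "k > 0" "of_nat k \<noteq> (0::'a)" using n(1,3) by (auto simp: nd k)
  define c where "c = lead_coeff p"
  have c: "c \<noteq> 0" using p0 by (simp add: c_def)
  obtain C where C: "degree C = r" "lead_coeff C = 1"
    "degree (smult (inverse c) p - C ^ k) \<le> (k - 1) * r" "coeff (smult (inverse c) p - C ^ k) ((k - 1) * r) = 0"
    using approximate_root[OF k0, of 1 "smult (inverse c) p" r] c k unfolding d_def
    by (metis c_def degree_smult_eq left_inverse inverse_zero_imp_zero lead_coeff_smult one_neq_zero power_one)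
  have eq: "p - smult c (C ^ k) = smult c (smult (inverse c) p - C ^ k)" using c by (simp add: smult_diff_right)
  have div: "q dvd r * M" if "q dvd d * M" for M
    using that q by (auto simp: r_def prime_dvd_mult_iff)
  have "\<exists>\<psi>. laurent_polynomial \<psi> \<and> to_fract C \<circ>\<^sub>r u = \<psi> \<circ>\<^sub>r (ratfun_X ^ q)"
  proof (rule composite_in_power[OF C(1,2) c k0])
    show "degree (p - smult c (C ^ k)) \<le> (k - 1) * r" unfolding eq using C(3) degree_smult_le order_trans by blast
    show "coeff (p - smult c (C ^ k)) ((k - 1) * r) = 0" unfolding eq coeff_smult C(4) by simp
    show "to_fract p \<circ>\<^sub>r u = b \<circ>\<^sub>r (ratfun_X ^ q)" using f by simp
    show "q dvd r * N" using qn div by (simp add: nd)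
    fix M \<gamma> assume M: "M > 0" "\<gamma> \<noteq> 0" "leads (int M) \<gamma> (at_zero u)"
    have "leads (int (d * M)) (lead_coeff p * \<gamma> ^ d) (at_zero f)"
      using leads_poly[OF M(3) _ order_refl, of p] M(1) by (simp add: f(1) zer.eval_compose_poly[OF u1] d_def)
    hence "q dvd d * M" by (rule supp) (use p0 M(2) in simp)
    thus "q dvd r * M" by (rule div)
  qed (use f prime_gt_0_nat[OF q] in auto)
  thus ?thesis using C(1) by (auto simp: r_def d_def)
qed

end

section \<open>Local structure of tame Laurent series\<close>

text \<open>With the compositional inverse \<open>L\<close> of \<open>(1 + X)\<^sup>D - 1\<close>, which exists as \<open>D\<close> is invertible, the root is
\<open>1 + L(H - 1)\<close>.\<close>

lemma fps_root_exists:
  fixes H :: "'a::field fps"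
  assumes H: "fps_nth H 0 = 1" and D: "of_nat D \<noteq> (0::'a)"
  shows "\<exists>R. fps_nth R 0 = 1 \<and> R ^ D = H"
proof -
  define a where "a = (1 + fps_X :: 'a fps) ^ D - 1"
  have a0: "fps_nth a 0 = 0" by (simp add: a_def fps_power_zeroth)
  have "fps_nth ((1 + fps_X :: 'a fps) ^ k) (Suc 0) = of_nat k" for k
    by (induction k) (auto simp: fps_mult_nth fps_power_zeroth)
  hence a1: "fps_nth a 1 \<noteq> 0" using D by (simp add: a_def)
  define L h where "L = fps_inv a" and "h = H - 1"
  have h0: "fps_nth h 0 = 0" using H by (simp add: h_def)
  have L0: "fps_nth L 0 = 0" by (simp add: L_def fps_inv_def)
  define z where "z = fps_compose L h"
  have z0: "fps_nth z 0 = 0" by (simp add: z_def fps_compose_nth_0 L0)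
  have "fps_compose a L = fps_X" unfolding L_def by (rule fps_inv_right[OF a0 a1])
  hence "fps_compose (fps_compose a L) h = h" using h0 by simp
  hence "fps_compose a z = h" using fps_compose_assoc[OF h0 L0, of a] by (simp add: z_def)
  moreover have "fps_compose a z = (1 + z) ^ D - 1"
    using z0 by (simp add: a_def fps_compose_sub_distrib fps_compose_add_distrib flip: fps_compose_power)
  ultimately have "(1 + z) ^ D = H" by (simp add: h_def)
  moreover have "fps_nth (1 + z) 0 = 1" by (simp add: z0)
  ultimately show ?thesis by blast
qed

lemma fls_root_exists:
  fixes G :: "'a::field fls"
  assumes G: "leads (int (D * g)) 1 G" and D: "of_nat D \<noteq> (0::'a)"
  shows "\<exists>\<theta>. leads (int g) 1 \<theta> \<and> \<theta> ^ D = G"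
proof -
  define H where "H = fls_regpart (G * fls_X ^ (D * g))"
  have nth: "(G * fls_X ^ (D * g)) $$ i = G $$ (i - int (D * g))" for i
    by (simp add: fls_X_power_times_conv_shift)
  have "fls_subdegree (G * fls_X ^ (D * g)) \<ge> 0"
    by (rule fls_subdegree_ge0I) (use leads_nth(1)[OF G] in \<open>simp add: nth\<close>)
  hence GH: "fps_to_fls H = G * fls_X ^ (D * g)" unfolding H_def by simp
  have "fps_nth H 0 = 1" using leads_nth(2)[OF G] by (simp add: H_def nth)
  then obtain R where R: "fps_nth R 0 = 1" "R ^ D = H" using fps_root_exists D by blast
  define \<theta> where "\<theta> = fps_to_fls R * fls_X_inv ^ g"
  have "\<theta> ^ D = fps_to_fls H * fls_X_inv ^ (D * g)"
    by (simp add: \<theta>_def power_mult_distrib R(2)[symmetric] fps_to_fls_power mult.commute flip: power_mult)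
  also have "\<dots> = G * (fls_X ^ (D * g) * fls_X_inv ^ (D * g))" by (simp add: GH mult.assoc)
  also have "fls_X ^ (D * g) * fls_X_inv ^ (D * g) = (1 :: 'a fls)"
  proof -
    have "fls_X * fls_X_inv = (1 :: 'a fls)" by (simp add: fls_X_times_conv_shift)
    thus ?thesis by (simp flip: power_mult_distrib)
  qed
  finally have "\<theta> ^ D = G" by simp
  moreover have "leads (int g) 1 \<theta>"
    using R(1) by (auto simp: leads_def \<theta>_def fls_X_inv_power_times_conv_shift)
  ultimately show ?thesis by blast
qed

lemma leads_all: "\<exists>N c. leads N c y"
  using leads_exists[of y] by (cases "y = 0") auto

lemma ratfun_eval_fls:
  assumes "leads N \<beta> \<theta>" "N > 0" "\<beta> \<noteq> 0"
  shows "ratfun_eval fls_const \<theta>"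
  unfolding ratfun_eval_def ratfun_eval_axioms_def
proof (intro conjI poly_eval_fls allI impI)
  fix p assume z: "poly (map_poly fls_const p) \<theta> = 0"
  have "leads (int (degree p) * N) (lead_coeff p * \<beta> ^ degree p) (poly (map_poly fls_const p) \<theta>)"
    by (rule leads_poly[OF assms(1,2) order_refl])
  thus "p = 0" using assms(3) unfolding z by simp
qed

lemma leads_poly_diff:
  assumes U: "leads N \<beta> U" and V: "leads N \<beta> V" and N: "N > 0" and D: "leads M c (U - V)" and p: "degree p = d" "d > 0"
  shows "leads (M + int (d - 1) * N) (c * (of_nat d * \<beta> ^ (d - 1) * lead_coeff p))
    (poly (map_poly fls_const p) U - poly (map_poly fls_const p) V)"
proof -
  interpret PU: poly_eval fls_const U by (rule poly_eval_fls)
  interpret PV: poly_eval fls_const V by (rule poly_eval_fls)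
  have "leads (M + int (d - 1) * N) (\<Sum>i\<le>d. if i = d then c * (of_nat d * \<beta> ^ (d - 1) * lead_coeff p) else 0)
      (\<Sum>i\<le>d. fls_const (coeff p i) * (U ^ i - V ^ i))"
  proof (rule leads_sum)
    fix i assume i: "i \<in> {..d}"
    show "leads (M + int (d - 1) * N) (if i = d then c * (of_nat d * \<beta> ^ (d - 1) * lead_coeff p) else 0)
      (fls_const (coeff p i) * (U ^ i - V ^ i))"
    proof (cases "i = 0")
      case False
      hence l: "leads (0 + (M + int (i - 1) * N)) (coeff p i * (c * (of_nat i * \<beta> ^ (i - 1)))) (fls_const (coeff p i) * (U ^ i - V ^ i))"
        by (intro leads_mult leads_const leads_power_diff[OF U V D]) simp
      show ?thesis
      proof (cases "i = d")
        case True
        thus ?thesis using l p by (simp add: mult_ac)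
      next
        case False
        hence "int (i - 1) * N < int (d - 1) * N" using i \<open>i \<noteq> 0\<close> N by (intro mult_strict_right_mono) auto
        thus ?thesis using leads_less[OF l, of "M + int (d - 1) * N"] False by simp
      qed
    qed (use p in auto)
  qed
  moreover have "(\<Sum>i\<le>d. if i = d then c * (of_nat d * \<beta> ^ (d - 1) * lead_coeff p) else 0) = c * (of_nat d * \<beta> ^ (d - 1) * lead_coeff p)"
    by simp
  moreover have "(\<Sum>i\<le>d. fls_const (coeff p i) * (U ^ i - V ^ i)) = PU.peval p - PV.peval p"
    by (simp add: PU.peval_altdef PV.peval_altdef p sum_subtractf right_diff_distrib)
  ultimately show ?thesis by (simp add: PU.peval_def PV.peval_def)
qed

context
  fixes \<theta> :: "'a::field fls" and g :: nat
  assumes \<theta>: "leads (int g) 1 \<theta>" and g: "g > 0"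
begin

interpretation th: ratfun_eval fls_const \<theta>
  by (rule ratfun_eval_fls[OF \<theta>]) (use g in auto)

text \<open>The closure of \<open>K(\<theta>)\<close> among the Laurent series. It is a field, and the orders of its elements are multiples of that of
\<open>\<theta>\<close>.\<close>

definition theta_closure :: "'a fls set" where
  "theta_closure = {y. \<forall>L. \<exists>h. leads L 0 (y - th.eval h)}"

lemma theta_closureD: "y \<in> theta_closure \<Longrightarrow> \<exists>h. leads L 0 (y - th.eval h)"
  by (simp add: theta_closure_def)

lemma eval_in_closure: "th.eval h \<in> theta_closure"
  unfolding theta_closure_def by (auto intro!: exI[of _ h])

lemma eval_order:
  assumes "h \<noteq> 0"
  shows "\<exists>k c. c \<noteq> 0 \<and> leads (k * int g) c (th.eval h)"
proof -
  have l: "leads (int (degree p) * int g) (lead_coeff p) (th.peval p)" for p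
    using leads_poly[OF \<theta> _ order_refl, of p] g by (simp add: th.peval_def)
  have n: "numer h \<noteq> 0" using assms ratfun_quot[of h] by auto
  have d: "lead_coeff (denom h) \<noteq> 0" using denom_nonzero by simp
  have "leads (int (degree (numer h)) * int g + - (int (degree (denom h)) * int g))
      (lead_coeff (numer h) * inverse (lead_coeff (denom h))) (th.peval (numer h) * inverse (th.peval (denom h)))"
    by (intro leads_mult leads_inverse l d)
  hence "leads ((int (degree (numer h)) - int (degree (denom h))) * int g)
      (lead_coeff (numer h) * inverse (lead_coeff (denom h))) (th.eval h)"
    by (simp add: th.eval_def divide_inverse left_diff_distrib)
  moreover have "lead_coeff (numer h) * inverse (lead_coeff (denom h)) \<noteq> 0" using n d by simp
  ultimately show ?thesis by blast
qed

lemma closure_order: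
  assumes "y \<in> theta_closure" "leads N c y" "c \<noteq> 0"
  shows "int g dvd N"
proof -
  obtain h where h: "leads N 0 (y - th.eval h)" using theta_closureD[OF assms(1)] by blast
  have l: "leads N c (th.eval h)" using leads_diff[OF assms(2) h] by simp
  hence "h \<noteq> 0" using assms(3) by auto
  then obtain k d where "d \<noteq> 0" "leads (k * int g) d (th.eval h)" using eval_order by blast
  hence "N = k * int g" using leads_order_unique(1)[OF l] assms(3) by blast
  thus ?thesis by simp
qed

lemma closure_add:
  assumes "y \<in> theta_closure" "z \<in> theta_closure"
  shows "y + z \<in> theta_closure"
  unfolding theta_closure_def
proof (intro CollectI allI)
  fix L
  obtain h k where "leads L 0 (y - th.eval h)" "leads L 0 (z - th.eval k)"
    using theta_closureD assms by metis
  from leads_add[OF this] show "\<exists>h. leads L 0 (y + z - th.eval h)"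
    by (intro exI[of _ "h + k"]) (simp add: th.eval_add algebra_simps)
qed

lemma closure_mult:
  assumes "y \<in> theta_closure" "z \<in> theta_closure"
  shows "y * z \<in> theta_closure"
  unfolding theta_closure_def
proof (intro CollectI allI)
  fix L
  obtain N c where N: "leads N c z" using leads_all by blast
  obtain h where h: "leads (L - N) 0 (y - th.eval h)" using theta_closureD[OF assms(1)] by blast
  obtain M d where M: "leads M d (th.eval h)" using leads_all by blast
  obtain k where k: "leads (L - M) 0 (z - th.eval k)" using theta_closureD[OF assms(2)] by blast
  have "leads L 0 ((y - th.eval h) * z + th.eval h * (z - th.eval k))"
    using leads_add[OF leads_mult[OF h N, simplified] leads_mult[OF M k, simplified]] by simp
  moreover have "(y - th.eval h) * z + th.eval h * (z - th.eval k) = y * z - th.eval (h * k)"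
    by (simp add: th.eval_mult algebra_simps)
  ultimately show "\<exists>h. leads L 0 (y * z - th.eval h)" by metis
qed

lemma closure_inverse:
  assumes "y \<in> theta_closure"
  shows "inverse y \<in> theta_closure"
proof (cases "y = 0")
  case True
  thus ?thesis using assms by simp
next
  case False
  then obtain N c where N: "c \<noteq> 0" "leads N c y" using leads_exists by blast
  show ?thesis unfolding theta_closure_def
  proof (intro CollectI allI)
    fix L
    define L' where "L' = min N (L + 2 * N)"
    obtain h where h: "leads L' 0 (y - th.eval h)" using theta_closureD[OF assms] by blast
    have less: "leads K 0 (y - th.eval h)" if "L' \<le> K" for K
      using h leads_less[OF h, of K] that by (cases "L' = K") auto
    have l: "leads N c (th.eval h)" using leads_diff[OF N(2) less[of N]] by (simp add: L'_def)
    have "th.eval h \<noteq> 0" using leads_nonzero[OF l N(1)] .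
    have "leads ((L + 2 * N) + (- N + - N)) (0 * (inverse c * inverse c)) ((y - th.eval h) * (inverse y * inverse (th.eval h)))"
      by (intro leads_mult leads_inverse less l N) (simp add: L'_def)
    moreover have "(y - th.eval h) * (inverse y * inverse (th.eval h)) = - (inverse y - th.eval (inverse h))"
      unfolding th.eval_inverse using False \<open>th.eval h \<noteq> 0\<close>
      by (simp add: left_diff_distrib) (simp flip: mult.assoc)
    ultimately have "leads L 0 (- (inverse y - th.eval (inverse h)))" by simp
    from leads_uminus[OF this] have "leads L 0 (inverse y - th.eval (inverse h))" by simp
    thus "\<exists>h. leads L 0 (inverse y - th.eval h)" by blast
  qed
qed

text \<open>If a polynomial in \<open>U\<close> lies in \<open>K(\<theta>)\<close>, then \<open>U\<close> can be approximated by elements of \<open>K(\<theta>)\<close>: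
  improve an approximation one term at a time.\<close>

lemma root_in_closure:
  fixes a :: "'a poly"
  assumes U: "leads (int (k * g)) \<beta> U" "\<beta> \<noteq> 0" "k > 0" and d: "of_nat (degree a) \<noteq> (0::'a)"
    and F: "poly (map_poly fls_const a) U = th.eval F"
  shows "U \<in> theta_closure"
proof (rule ccontr)
  let ?N = "int (k * g)" and ?d = "degree a"
  assume "U \<notin> theta_closure"
  then obtain L where L: "\<And>h. \<not> leads L 0 (U - th.eval h)" by (auto simp: theta_closure_def)
  have N: "?N > 0" using U(3) g by simp
  have d0: "?d > 0" using d by (cases "?d = 0") auto
  have la: "lead_coeff a \<noteq> 0" using d0 by auto
  define P where "P = (\<lambda>h. leads ?N \<beta> (th.eval h))"
  define o' where "o' = (\<lambda>h. - fls_subdegree (U - th.eval h))"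
  have ord: "\<exists>c. c \<noteq> 0 \<and> leads (o' h) c (U - th.eval h)" "L \<le> o' h" for h
  proof -
    have nz: "U - th.eval h \<noteq> 0" using L[of h] by auto
    have l: "leads (o' h) ((U - th.eval h) $$ fls_subdegree (U - th.eval h)) (U - th.eval h)"
      unfolding o'_def by (rule leads_subdegree[OF nz])
    show "\<exists>c. c \<noteq> 0 \<and> leads (o' h) c (U - th.eval h)" using l nz nth_fls_subdegree_nonzero[OF nz] by blast
    show "L \<le> o' h" using leads_less[OF l, of L] L[of h] by force
  qed
  have "leads ?N \<beta> (th.eval (ratfun_const \<beta> * ratfun_X ^ k))"
    using leads_mult[OF leads_const[of \<beta>] leads_power[OF \<theta>, of k]]
    by (simp add: th.eval_mult th.eval_const th.eval_power th.eval_X)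
  then obtain h where h: "P h" and min: "\<And>h'. P h' \<Longrightarrow> nat (o' h - L) \<le> nat (o' h' - L)"
    using ex_has_least_nat[of P _ "\<lambda>h. nat (o' h - L)"] by (auto simp: P_def)
  obtain c where c: "c \<noteq> 0" "leads (o' h) c (U - th.eval h)" using ord by blast
  have lh: "leads ?N \<beta> (th.eval h)" using h by (simp add: P_def)
  have oN: "o' h < ?N"
  proof -
    have "leads ?N 0 (U - th.eval h)" using leads_diff[OF U(1) lh] by simp
    then obtain e where "leads (?N - 1) e (U - th.eval h)" using leads_pred by blast
    thus ?thesis using leads_le[OF c(2) _ c(1), of "?N - 1" e] by simp
  qed
  have "leads (o' h + int (?d - 1) * ?N) (c * (of_nat ?d * \<beta> ^ (?d - 1) * lead_coeff a))
      (th.eval F - poly (map_poly fls_const a) (th.eval h))"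
    unfolding F[symmetric] by (rule leads_poly_diff[OF U(1) lh N c(2) refl d0])
  moreover have "th.eval F - poly (map_poly fls_const a) (th.eval h) =
      th.eval (F - poly (map_poly ratfun_const a) h)"
    by (simp add: th.eval_diff th.eval_poly_const)
  moreover have "c * (of_nat ?d * \<beta> ^ (?d - 1) * lead_coeff a) \<noteq> 0" using c d U(2) la by simp
  ultimately have "int g dvd o' h + int (?d - 1) * ?N"
    using closure_order[OF eval_in_closure] by metis
  moreover have "int g dvd int (?d - 1) * ?N" by simp
  ultimately have "int g dvd o' h" by (simp add: dvd_add_left_iff)
  then obtain j where j: "o' h = int g * j" by blast
  define h' where "h' = h + ratfun_const c * ratfun_X powi j"
  have lt: "leads (o' h) c (th.eval (ratfun_const c * ratfun_X powi j))"
  proof -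
    have "leads (j * int g) 1 (\<theta> powi j)"
    proof (cases "j \<ge> 0")
      case True
      thus ?thesis using leads_power[OF \<theta>, of "nat j"] by (simp add: power_int_def)
    next
      case False
      thus ?thesis using leads_power[OF leads_inverse[OF \<theta>], of "nat (- j)"] by (simp add: power_int_def)
    qed
    from leads_mult[OF leads_const[of c] this] show ?thesis
      by (simp add: th.eval_mult th.eval_const th.eval_power_int th.eval_X j mult.commute)
  qed
  have "P h'" unfolding P_def h'_def th.eval_add
    using leads_add[OF lh leads_less[OF lt oN]] by simp
  moreover have "o' h' < o' h"
  proof -
    have "leads (o' h) 0 (U - th.eval h')"
      using leads_diff[OF c(2) lt] by (simp add: h'_def th.eval_add algebra_simps)
    then obtain e where e: "leads (o' h - 1) e (U - th.eval h')" using leads_pred by blast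
    obtain c' where "c' \<noteq> 0" "leads (o' h') c' (U - th.eval h')" using ord by blast
    thus ?thesis using leads_le[OF _ e] by force
  qed
  ultimately show False using min[of h'] ord(2)[of h'] by simp
qed

end

text \<open>Let \<open>\<theta>\<close> be a \<open>D\<close>-th root of the expansion of \<open>a(u) = b(v)\<close>; it has a pole of order \<open>g\<close>. Both \<open>u\<close> and \<open>v\<close> lie
in the closure of \<open>K(\<theta>)\<close>, and so does the field that they generate.\<close>

theorem generator_order_dvd:
  fixes u v z :: "'a::field ratfun" and a b :: "'a poly"
  assumes E: "ratfun_eval fls_const y0" and u: "ratfun_degree u \<ge> 1" and v: "ratfun_degree v \<ge> 1"
    and lu: "leads (int (e' * g)) \<beta> (ratfun_eval.eval fls_const y0 u)" "\<beta> \<noteq> 0" "e' > 0"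
    and lv: "leads (int (e * g)) \<gamma> (ratfun_eval.eval fls_const y0 v)" "\<gamma> \<noteq> 0" "e > 0"
    and ab: "to_fract a \<circ>\<^sub>r u = to_fract b \<circ>\<^sub>r v"
    and deg: "degree a * e' = D" "degree b * e = D" "of_nat D \<noteq> (0::'a)" and g: "g > 0"
    and z: "z \<in> range (\<lambda>q. coeval u q v)" "leads N c (ratfun_eval.eval fls_const y0 z)" "c \<noteq> 0"
  shows "int g dvd N"
proof -
  interpret E: ratfun_eval fls_const y0 by (rule E)
  define F where "F = E.eval (to_fract a \<circ>\<^sub>r u)"
  have Fu: "F = poly (map_poly fls_const a) (E.eval u)" by (simp add: F_def E.eval_compose_poly[OF u])
  have Fv: "F = poly (map_poly fls_const b) (E.eval v)" by (simp add: F_def ab E.eval_compose_poly[OF v])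
  have D0: "D > 0" using deg(3) by (cases "D = 0") auto
  hence da: "degree a > 0" using deg(1) by (cases "degree a = 0") auto
  define \<chi> where "\<chi> = lead_coeff a * \<beta> ^ degree a"
  have \<chi>: "\<chi> \<noteq> 0" using lu(2) da by (auto simp: \<chi>_def)
  have "leads (int (degree a) * int (e' * g)) \<chi> F"
    unfolding Fu \<chi>_def by (rule leads_poly[OF lu(1) _ order_refl]) (use lu(3) g in simp)
  hence "leads (int (D * g)) \<chi> F" by (simp add: deg(1)[symmetric] mult.assoc)
  hence "leads (0 + int (D * g)) (inverse \<chi> * \<chi>) (fls_const (inverse \<chi>) * F)"
    by (intro leads_mult leads_const)
  hence "leads (int (D * g)) 1 (fls_const (inverse \<chi>) * F)" using \<chi> by simp
  then obtain \<theta> where \<theta>: "leads (int g) 1 \<theta>" "\<theta> ^ D = fls_const (inverse \<chi>) * F"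
    using fls_root_exists deg(3) by blast
  interpret th: ratfun_eval fls_const \<theta> by (rule ratfun_eval_fls[OF \<theta>(1)]) (use g in auto)
  have "fls_const \<chi> * \<theta> ^ D = F" using \<chi> unfolding \<theta>(2) by (simp add: mult.assoc[symmetric] fls_const_mult_const)
  hence FF: "F = th.eval (ratfun_const \<chi> * ratfun_X ^ D)"
    by (simp add: th.eval_mult th.eval_const th.eval_power th.eval_X)
  let ?S = "theta_closure \<theta>"
  define T where "T = {f. E.eval f \<in> ?S}"
  have T: "ratfun_subfield T" unfolding ratfun_subfield_def T_def
  proof (intro conjI allI ballI)
    show "ratfun_const k \<in> {f. E.eval f \<in> ?S}" for k
      using eval_in_closure[OF \<theta>(1) g, of "ratfun_const k"] by (simp add: E.eval_const th.eval_const)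
  qed (auto simp: E.eval_add E.eval_mult E.eval_inverse closure_add[OF \<theta>(1) g] closure_mult[OF \<theta>(1) g] closure_inverse[OF \<theta>(1) g])
  have "of_nat (degree a) \<noteq> (0::'a)" "of_nat (degree b) \<noteq> (0::'a)"
    using deg(3) by (auto simp flip: deg(1)) (metis deg(2,3) mult_eq_0_iff of_nat_mult)
  hence uv: "u \<in> T" "v \<in> T" unfolding T_def
    using root_in_closure[OF \<theta>(1) g lu(1,2,3) _ Fu[symmetric, unfolded FF]]
      root_in_closure[OF \<theta>(1) g lv(1,2,3) _ Fv[symmetric, unfolded FF]] by blast+
  have "coeval u q v \<in> T" for q
    unfolding coeval_def
    by (intro ratfun_subfield_poly[OF T uv(2)])
      (simp add: coeff_map_poly compose_0[OF u] ratfun_subfield_compose[OF T uv(1)])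
  hence "E.eval z \<in> ?S" using z(1) by (auto simp: T_def)
  thus ?thesis using closure_order[OF \<theta>(1) g] z(2,3) by blast
qed

section \<open>Relations between two right factors\<close>

lemma laurent_degree:
  fixes v :: "'a::field ratfun"
  assumes lv: "laurent_polynomial v" and N: "leads (int N) c (at_inf v)" "c \<noteq> 0"
  shows "N \<le> ratfun_degree v"
    and "leads (int M) d (at_zero v) \<Longrightarrow> M > 0 \<Longrightarrow> d \<noteq> 0 \<Longrightarrow> ratfun_degree v = N + M"
proof -
  define g h where "g = numer v" and "h = denom v"
  have h0: "h \<noteq> 0" by (simp add: h_def denom_nonzero)
  have veq: "v * to_fract h = to_fract g" unfolding g_def h_def using denom_nonzero[of v] by (subst (1) ratfun_quot) simp
  have v0: "v \<noteq> 0" using N by auto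
  hence g0: "g \<noteq> 0" using veq h0 by auto
  have "leads (int N + int (degree h)) (c * lead_coeff h) (at_inf (v * to_fract h))"
    unfolding inf.eval_mult by (intro leads_mult N at_inf_to_fract h0)
  hence "int N + int (degree h) = int (degree g)"
    unfolding veq by (rule leads_order_unique(1)[OF _ at_inf_to_fract[OF g0]]) (use N(2) h0 g0 in auto)
  hence gN: "degree g = N + degree h" by simp
  thus "N \<le> ratfun_degree v" by (simp add: ratfun_degree_def g_def)
  assume M: "leads (int M) d (at_zero v)" "M > 0" "d \<noteq> 0"
  define i where "i = pole_order_zero v"
  have hi: "h = monom 1 i" unfolding h_def i_def by (rule laurent_denom[OF lv])
  have l: "leads (int M + int i * (-1)) (d * 1 ^ i) (at_zero (v * ratfun_X ^ i))"
    unfolding zer.eval_mult zer.eval_power by (intro leads_mult leads_power at_zero_X M)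
  have "v * ratfun_X ^ i = to_fract g" using veq by (simp add: hi X_power)
  hence l': "leads (int M - int i) d (at_zero (to_fract g))" using l by simp
  have "int M - int i \<le> 0" by (rule leads_le[OF l' at_zero_to_fract M(3)])
  hence "i > 0" using M(2) by simp
  hence "poly h 0 = 0" by (simp add: hi poly_0_coeff_0)
  hence "coeff g 0 \<noteq> 0" using coprime_no_common_root[OF numer_denom(2)[of v], of 0]
    by (simp add: g_def h_def poly_0_coeff_0)
  hence "int M - int i = 0" using leads_order_unique(1)[OF l' at_zero_to_fract M(3)] by simp
  hence "i = M" by simp
  thus "ratfun_degree v = N + M" using gN by (simp add: ratfun_degree_def flip: g_def h_def) (simp add: hi degree_monom_eq)
qed

text \<open>The value \<open>A(u, v)\<close>, where \<open>v\<close> is substituted for the outer variable.\<close>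

definition bieval :: "'a::field ratfun \<Rightarrow> 'a ratfun \<Rightarrow> 'a poly poly \<Rightarrow> 'a ratfun" where
  "bieval u v A = coeval u (map_poly to_fract A) v"

context
  fixes u v :: "'a::field ratfun"
  assumes u1: "ratfun_degree u \<ge> 1"
begin

interpretation U: poly_eval "\<lambda>c. c \<circ>\<^sub>r u" v by (rule poly_eval_compose[OF u1])

lemma coeval_eq_peval: "coeval u p v = U.peval p"
  by (simp add: coeval_def U.peval_def)

lemma bieval_add: "bieval u v (A + B) = bieval u v A + bieval u v B"
  and bieval_diff: "bieval u v (A - B) = bieval u v A - bieval u v B"
  and bieval_mult: "bieval u v (A * B) = bieval u v A * bieval u v B"
  by (simp_all add: bieval_def coeval_eq_peval U.peval_add U.peval_diff U.peval_mult)

lemma bieval_smult: "bieval u v (smult c A) = (to_fract c \<circ>\<^sub>r u) * bieval u v A"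
  by (simp add: bieval_def coeval_eq_peval U.peval_smult)

lemma bieval_const: "bieval u v [:c:] = to_fract c \<circ>\<^sub>r u"
  by (simp add: bieval_def coeval_eq_peval map_poly_pCons)

lemma bieval_poly:
  assumes v1: "ratfun_degree v \<ge> 1"
  shows "bieval u v (map_poly (\<lambda>c. [:c:]) b) = to_fract b \<circ>\<^sub>r v"
proof (induction b)
  case (pCons c b)
  have "to_fract [:c:] = ratfun_const c" by (simp add: ratfun_const_def)
  thus ?case using pCons.IH
    by (simp add: bieval_def coeval_eq_peval map_poly_pCons to_fract_compose[OF v1] compose_const[OF u1])
qed (simp add: bieval_def coeval_eq_peval compose_0[OF v1])

lemma bieval_sum:
  assumes "degree A < n \<or> A = 0"
  shows "bieval u v A = (\<Sum>i<n. (to_fract (coeff A i) \<circ>\<^sub>r u) * v ^ i)"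
  unfolding bieval_def
  by (subst coeval_sum_le[OF u1, of _ n]) (use assms in \<open>auto simp: degree_map_poly coeff_map_poly\<close>)

end

text \<open>\<open>v\<close> is integral over \<open>K[u]\<close> as \<open>b(v) \<in> K[u]\<close>; Gauss's lemma makes its minimal polynomial integral.\<close>

lemma integral_relation:
  fixes u v :: "'a::field ratfun"
  assumes u: "indecomposable u" and v1: "ratfun_degree v \<ge> 1" and ne: "v \<notin> range (\<lambda>c. c \<circ>\<^sub>r u)"
    and ab: "to_fract a \<circ>\<^sub>r u = to_fract b \<circ>\<^sub>r v" and b: "degree b > 0"
  shows "\<exists>P. degree P = ratfun_degree u \<and> lead_coeff P = 1 \<and> bieval u v P = 0"
proof -
  have u1: "ratfun_degree u \<ge> 1" using indecomposable_degree[OF u] by simp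
  interpret U: poly_eval "\<lambda>c. c \<circ>\<^sub>r u" v by (rule poly_eval_compose[OF u1])
  note ce = coeval_eq_peval[OF u1]
  obtain p where p: "p \<noteq> 0" "degree p \<le> ratfun_degree u" "coeval u p v = 0"
    using algebraic_relation_exists[OF u1] by blast
  have dp: "degree p = ratfun_degree u" using indecomposable_relation_degree(1)[OF u ne p(1,3)] p(2) by simp
  define A where "A = map_poly (\<lambda>c. [:c:]) b - [:a:]"
  have "coeval u (map_poly to_fract A) v = 0"
    using bieval_diff[OF u1, of v "map_poly (\<lambda>c. [:c:]) b" "[:a:]"] ab
    unfolding A_def bieval_def[symmetric] by (simp add: bieval_poly[OF u1 v1] bieval_const[OF u1])
  hence F0: "U.peval (map_poly to_fract A) = 0" by (simp add: ce)
  have "U.peval (map_poly to_fract A mod p) = 0"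
    using U.peval_mod[of p "map_poly to_fract A"] p(3) F0 by (simp add: ce)
  hence "map_poly to_fract A mod p = 0"
    using indecomposable_relation_degree(1)[OF u ne, of "map_poly to_fract A mod p"] dp
      degree_mod_less[OF p(1), of "map_poly to_fract A"] by (metis ce not_le)
  hence "map_poly to_fract A = p * (map_poly to_fract A div p)"
    by (metis mod_eq_0_iff_dvd dvd_mult_div_cancel)
  then obtain P Q c where PQ: "c \<noteq> 0" "A = P * Q" "map_poly to_fract P = smult c p"
    using gauss_lemma by blast
  have dA: "degree A = degree b" "lead_coeff A = [:lead_coeff b:]"
  proof -
    have cf: "coeff A i = [:coeff b i:]" if "i > 0" for i
      using that by (cases i) (simp_all add: A_def coeff_map_poly)
    have "degree A \<le> degree b" unfolding A_def
      by (intro degree_diff_le) (auto simp: degree_map_poly)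
    moreover have "coeff A (degree b) \<noteq> 0" using cf[OF b] b by auto
    ultimately show "degree A = degree b" using le_degree by (metis antisym)
    thus "lead_coeff A = [:lead_coeff b:]" using cf[OF b] by simp
  qed
  have "lead_coeff P * lead_coeff Q = [:lead_coeff b:]" using dA(2) by (simp add: PQ(2) lead_coeff_mult)
  moreover have "lead_coeff b \<noteq> 0" using b by auto
  ultimately have "is_unit (lead_coeff P)"
    by (metis dvd_triv_left dvd_trans is_unit_pCons_iff pCons_eq_0_iff is_unit_const_poly_iff dvd_field_iff)
  then obtain k where k: "lead_coeff P = [:k:]" "k \<noteq> 0"
    by (metis is_unit_iff_degree degree_eq_zeroE not_is_unit_0 pCons_0_0)
  define R where "R = smult [:inverse k:] P"
  have P0: "P \<noteq> 0" using k by auto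
  have "degree R = degree P" using k(2) by (simp add: R_def)
  also have "degree P = degree p" using PQ(1,3) by (metis degree_smult_eq degree_map_poly to_fract_eq_0_iff)
  finally have "degree R = ratfun_degree u" using dp by simp
  moreover have "lead_coeff R = 1" using k \<open>degree R = degree P\<close> by (simp add: R_def one_pCons)
  moreover have "bieval u v R = 0"
    unfolding R_def bieval_smult[OF u1] unfolding bieval_def PQ(3) ce U.peval_smult
    using p(3) by (simp add: ce)
  ultimately show ?thesis by blast
qed

lemma bieval_reduce:
  fixes u v :: "'a::field ratfun"
  assumes u1: "ratfun_degree u \<ge> 1" and P: "degree P > 0" "lead_coeff P = 1" "bieval u v P = 0"
  shows "\<exists>R. (R = 0 \<or> degree R < degree P) \<and> bieval u v S = bieval u v R"
proof -
  obtain Q R where QR: "pseudo_divmod S P = (Q, R)" by (cases "pseudo_divmod S P")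
  have "P \<noteq> 0" using P by auto
  from pseudo_divmod[OF this QR] have "S = P * Q + R" "R = 0 \<or> degree R < degree P" using P(2) by auto
  thus ?thesis using P(3) by (auto simp: bieval_add[OF u1] bieval_mult[OF u1])
qed

section \<open>Right factors with poles of equal order at both ends\<close>

text \<open>Here \<open>A1\<close>, \<open>B1\<close> are approximate \<open>l\<close>-th roots of \<open>a\<close>, \<open>b\<close>. The functions \<open>A = A1(u)\<close> and \<open>B = B1(v)\<close> have poles
of order \<open>N = e e'\<close> at both ends, with leading coefficient \<open>1\<close> at infinity and \<open>\<alpha> = \<mu>\<^sup>e\<close>,
\<open>\<beta> = \<nu>\<^sup>e\<^sup>'\<close> at zero. Therefore \<open>P = A - B\<close> has no pole at infinity, and \<open>Q = \<beta> A - \<alpha> B\<close> none at zero.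
The aim is that \<open>P\<close> and \<open>Q\<close> are monomials, so that \<open>A\<close> and \<open>B\<close> are functions of \<open>x\<^sup>N\<close>. The hypotheses are
symmetric in \<open>u\<close> and \<open>v\<close>.\<close>

locale two_ended =
  fixes u v :: "'a::field ratfun" and a b A1 B1 :: "'a poly" and e e' l :: nat and \<mu> \<nu> :: 'a
  assumes u: "indecomposable u" and v: "indecomposable v" and ne: "v \<notin> range (\<lambda>c. c \<circ>\<^sub>r u)"
    and lu: "laurent_polynomial u" and lv: "laurent_polynomial v"
    and ui: "leads (int e') 1 (at_inf u)" and uz: "leads (int e') \<mu> (at_zero u)"
    and vi: "leads (int e) 1 (at_inf v)" and vz: "leads (int e) \<nu> (at_zero v)"
    and nz: "\<mu> \<noteq> 0" "\<nu> \<noteq> 0" and pos: "e > 0" "e' > 0" and cop: "coprime e e'"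
    and ab: "to_fract a \<circ>\<^sub>r u = to_fract b \<circ>\<^sub>r v"
    and deg_ab: "degree a > 0" "degree b > 0"
    and A1: "degree A1 = e" "lead_coeff A1 = 1"
      "degree (a - A1 ^ l) \<le> (l - 1) * e" "coeff (a - A1 ^ l) ((l - 1) * e) = 0"
    and B1: "degree B1 = e'" "lead_coeff B1 = 1"
      "degree (b - B1 ^ l) \<le> (l - 1) * e'" "coeff (b - B1 ^ l) ((l - 1) * e') = 0"
    and l3: "l \<ge> 3" and lK: "of_nat l \<noteq> (0::'a)"
    and root: "(\<mu> ^ e) ^ l = (\<nu> ^ e') ^ l" and noroot: "(\<mu> ^ e) ^ 2 \<noteq> (\<nu> ^ e') ^ 2"
begin

lemma swap: "two_ended v u b a B1 A1 e' e l \<nu> \<mu>"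
  by unfold_locales
    (use not_in_range_sym[OF u v ne] u v lu lv ui uz vi vz nz pos cop ab deg_ab A1 B1 l3 lK root noroot
      in \<open>simp_all add: coprime_commute\<close>)

abbreviation "\<alpha> \<equiv> \<mu> ^ e"
abbreviation "\<beta> \<equiv> \<nu> ^ e'"
abbreviation "N \<equiv> e * e'"

definition "A = to_fract A1 \<circ>\<^sub>r u"
definition "B = to_fract B1 \<circ>\<^sub>r v"
definition "P = A - B"
definition "Q = ratfun_const \<beta> * A - ratfun_const \<alpha> * B"
definition "\<rho> = a - A1 ^ l"
definition "\<sigma> = b - B1 ^ l"
definition "i0 = degree \<rho>"
definition "j0 = degree \<sigma>"

lemma \<alpha>\<beta>: "\<alpha> \<noteq> 0" "\<beta> \<noteq> 0" "\<alpha> \<noteq> \<beta>" "\<alpha> \<noteq> - \<beta>"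
  using nz noroot by (auto simp: power2_eq_square)

lemma u1: "ratfun_degree u \<ge> 1" and v1: "ratfun_degree v \<ge> 1"
  using indecomposable_degree[OF u] indecomposable_degree[OF v] by simp_all

lemma deg_u: "ratfun_degree u = 2 * e'" and deg_v: "ratfun_degree v = 2 * e"
  using laurent_degree(2)[OF lu ui _ uz] laurent_degree(2)[OF lv vi _ vz] pos nz by simp_all

lemma laurent_AB: "laurent_polynomial A" "laurent_polynomial B" "laurent_polynomial P" "laurent_polynomial Q"
  unfolding P_def Q_def A_def B_def
  by (intro laurent_diff laurent_mult laurent_const laurent_compose_poly lu lv u1 v1)+

lemma poly_u_inf: "leads (int (degree p * e')) (lead_coeff p) (at_inf (to_fract p \<circ>\<^sub>r u))"
  and poly_u_zero: "leads (int (degree p * e')) (lead_coeff p * \<mu> ^ degree p) (at_zero (to_fract p \<circ>\<^sub>r u))"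
  using leads_poly[OF ui _ order_refl, of p] leads_poly[OF uz _ order_refl, of p] pos
  by (simp_all add: inf.eval_compose_poly[OF u1] zer.eval_compose_poly[OF u1])

lemma poly_v_inf: "leads (int (degree p * e)) (lead_coeff p) (at_inf (to_fract p \<circ>\<^sub>r v))"
  and poly_v_zero: "leads (int (degree p * e)) (lead_coeff p * \<nu> ^ degree p) (at_zero (to_fract p \<circ>\<^sub>r v))"
  using leads_poly[OF vi _ order_refl, of p] leads_poly[OF vz _ order_refl, of p] pos
  by (simp_all add: inf.eval_compose_poly[OF v1] zer.eval_compose_poly[OF v1])

lemma A_leads: "leads (int N) 1 (at_inf A)" "leads (int N) \<alpha> (at_zero A)"
  using poly_u_inf[of A1] poly_u_zero[of A1] A1 by (simp_all add: A_def)

lemma B_leads: "leads (int N) 1 (at_inf B)" "leads (int N) \<beta> (at_zero B)"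
  using poly_v_inf[of B1] poly_v_zero[of B1] B1 by (simp_all add: B_def mult.commute)

lemma difference: "A ^ l - B ^ l = (to_fract \<sigma> \<circ>\<^sub>r v) - (to_fract \<rho> \<circ>\<^sub>r u)"
  using ab by (simp add: A_def B_def \<rho>_def \<sigma>_def to_fract_power compose_diff[OF u1] compose_diff[OF v1]
    compose_power[OF u1] compose_power[OF v1] algebra_simps)

lemma \<rho>_less: "i0 * e' < (l - 1) * N" and \<sigma>_less: "j0 * e < (l - 1) * N"
proof -
  have *: "degree r < (l - 1) * m" if "degree r \<le> (l - 1) * m" "coeff r ((l - 1) * m) = 0" "m > 0" for r :: "'a poly" and m
  proof (cases "r = 0")
    case True
    thus ?thesis using that(3) l3 by simp
  next
    case False
    thus ?thesis using that(1,2) by (metis le_neq_implies_less leading_coeff_0_iff)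
  qed
  show "i0 * e' < (l - 1) * N" using *[OF A1(3,4) pos(1)] pos(2) by (simp add: i0_def \<rho>_def flip: mult.assoc)
  have "degree \<sigma> * e < (l - 1) * e' * e" using *[OF B1(3,4) pos(2)] pos(1) by (simp add: \<sigma>_def)
  thus "j0 * e < (l - 1) * N" by (simp add: j0_def mult_ac)
qed

lemma difference_small:
  "leads (int ((l - 1) * N)) 0 (at_inf (A ^ l - B ^ l))" "leads (int ((l - 1) * N)) 0 (at_zero (A ^ l - B ^ l))"
  unfolding difference inf.eval_diff zer.eval_diff
  using leads_diff[OF leads_less[OF poly_v_inf[of \<sigma>]] leads_less[OF poly_u_inf[of \<rho>]], of "int ((l - 1) * N)"]
    leads_diff[OF leads_less[OF poly_v_zero[of \<sigma>]] leads_less[OF poly_u_zero[of \<rho>]], of "int ((l - 1) * N)"]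
    \<rho>_less \<sigma>_less unfolding i0_def j0_def by (simp_all del: of_nat_mult)

lemma P_inf_small: "leads 0 0 (at_inf P)"
proof -
  have "leads (0 + int (l - 1) * int N) 0 (at_inf A ^ l - at_inf B ^ l)"
    using difference_small(1) by (simp add: inf.eval_diff inf.eval_power)
  thus ?thesis using leads_power_diff_cancel[OF A_leads(1) B_leads(1) _ lK one_neq_zero] l3
    by (simp add: P_def inf.eval_diff)
qed

lemma Q_zero_leads: "leads (int N) (\<beta> * \<alpha>) (at_zero (ratfun_const \<beta> * A))" "leads (int N) (\<beta> * \<alpha>) (at_zero (ratfun_const \<alpha> * B))"
  using leads_mult[OF at_zero_const[of \<beta>] A_leads(2)] leads_mult[OF at_zero_const[of \<alpha>] B_leads(2)]
  by (simp_all add: zer.eval_mult mult.commute)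

lemma scaled_difference: 
  "(ratfun_const \<beta> * A) ^ l - (ratfun_const \<alpha> * B) ^ l = ratfun_const (\<beta> ^ l) * (A ^ l - B ^ l)"
proof -
  have "ratfun_const \<alpha> ^ l = ratfun_const (\<beta> ^ l)" unfolding ratfun_const_power[symmetric] root ..
  moreover have "ratfun_const \<beta> ^ l = ratfun_const (\<beta> ^ l)" by (rule ratfun_const_power[symmetric])
  ultimately show ?thesis unfolding power_mult_distrib by (simp only: right_diff_distrib)
qed

lemma Q_zero_small: "leads 0 0 (at_zero Q)"
proof -
  have "leads (0 + int ((l - 1) * N)) (\<beta> ^ l * 0) (at_zero (ratfun_const (\<beta> ^ l) * (A ^ l - B ^ l)))"
    unfolding zer.eval_mult by (intro leads_mult at_zero_const difference_small)
  hence "leads (0 + int (l - 1) * int N) 0 (at_zero (ratfun_const \<beta> * A) ^ l - at_zero (ratfun_const \<alpha> * B) ^ l)"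
    unfolding scaled_difference[symmetric] by (simp add: zer.eval_diff zer.eval_power)
  thus ?thesis using leads_power_diff_cancel[OF Q_zero_leads _ lK] l3 \<alpha>\<beta>
    by (simp add: Q_def zer.eval_diff)
qed

lemma P_zero: "leads (int N) (\<alpha> - \<beta>) (at_zero P)"
  using leads_diff[OF A_leads(2) B_leads(2)] by (simp add: P_def zer.eval_diff)

lemma Q_inf: "leads (int N) (\<beta> - \<alpha>) (at_inf Q)"
  using leads_diff[OF leads_mult[OF at_inf_const[of \<beta>] A_leads(1)] leads_mult[OF at_inf_const[of \<alpha>] B_leads(1)]]
  by (simp add: Q_def inf.eval_diff inf.eval_mult)

lemma P_inf_order: "\<exists>t p. p \<noteq> 0 \<and> t > 0 \<and> leads (- int t) p (at_inf P)"
  and Q_zero_order: "\<exists>s q. q \<noteq> 0 \<and> s > 0 \<and> leads (- int s) q (at_zero Q)"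
proof -
  have *: "\<exists>t p. p \<noteq> 0 \<and> t > 0 \<and> leads (- int t) p y" if y: "leads 0 0 y" "y \<noteq> 0" for y :: "'a fls"
  proof -
    obtain M c where M: "c \<noteq> 0" "leads M c y" using leads_exists \<open>y \<noteq> 0\<close> by blast
    obtain d where "leads (0 - 1) d y" using leads_pred[THEN iffD1, OF y(1)] by blast
    hence "M < 0" using leads_le[OF M(2) _ M(1), of "0 - 1" d] by simp
    thus ?thesis using M by (intro exI[of _ "nat (- M)"] exI[of _ c]) auto
  qed
  have "at_zero P \<noteq> 0" "at_inf Q \<noteq> 0" using leads_nonzero[OF P_zero] leads_nonzero[OF Q_inf] \<alpha>\<beta> by auto
  hence "at_inf P \<noteq> 0" "at_zero Q \<noteq> 0" by auto
  thus "\<exists>t p. p \<noteq> 0 \<and> t > 0 \<and> leads (- int t) p (at_inf P)" "\<exists>s q. q \<noteq> 0 \<and> s > 0 \<and> leads (- int s) q (at_zero Q)"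
    using * P_inf_small Q_zero_small by blast+
qed

text \<open>A monomial \<open>u\<^sup>i v\<^sup>j\<close> has order \<open>i e' + j e\<close> at both ends. For \<open>j < 2 e'\<close> only the pairs \<open>(i + e, j)\<close> and
\<open>(i, j + e')\<close> share an order. Their leading terms can cancel at one of the ends, but not at both, because
\<open>\<alpha> \<noteq> \<beta>\<close>; and their order is at least \<open>N\<close>.\<close>

lemma leading_monomial:
  fixes c :: "nat \<Rightarrow> 'a poly"
  defines "y \<equiv> (\<Sum>j<2 * e'. (to_fract (c j) \<circ>\<^sub>r u) * v ^ j)"
  assumes small: "leads (int N) 0 (at_inf y)" "leads (int N) 0 (at_zero y)" and y0: "y \<noteq> 0"
  shows "\<exists>i j k. k \<noteq> 0 \<and> i * e' + j * e < N \<and> leads (int (i * e' + j * e)) k (at_inf y) \<and>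
    leads (int (i * e' + j * e)) (k * (\<mu> ^ i * \<nu> ^ j)) (at_zero y)"
proof -
  define J where "J = {j \<in> {..<2 * e'}. c j \<noteq> 0}"
  define wt where "wt = (\<lambda>j. degree (c j) * e' + j * e)"
  have J0: "J \<noteq> {}"
  proof
    assume "J = {}"
    hence "y = 0" unfolding y_def J_def
      by (intro sum.neutral ballI) (auto simp: compose_0[OF u1])
    thus False using y0 by blast
  qed
  have fJ: "finite J" by (simp add: J_def)
  define W where "W = Max (wt ` J)"
  have Wmax: "wt j \<le> W" if "j \<in> J" for j using fJ that by (simp add: W_def)
  have "W \<in> wt ` J" unfolding W_def using fJ J0 by (intro Max_in) auto
  then obtain m where m: "m \<in> J" "wt m = W" by blast
  define ci where "ci = (\<lambda>j. if wt j = W then lead_coeff (c j) else 0)"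
  define cz where "cz = (\<lambda>j. if wt j = W then lead_coeff (c j) * (\<mu> ^ degree (c j) * \<nu> ^ j) else 0)"
  have ti: "leads (int W) (if j \<in> J then ci j else 0) (at_inf ((to_fract (c j) \<circ>\<^sub>r u) * v ^ j))"
    and tz: "leads (int W) (if j \<in> J then cz j else 0) (at_zero ((to_fract (c j) \<circ>\<^sub>r u) * v ^ j))"
    if "j < 2 * e'" for j
  proof -
    have i: "leads (int (wt j)) (lead_coeff (c j)) (at_inf ((to_fract (c j) \<circ>\<^sub>r u) * v ^ j))"
      using leads_mult[OF poly_u_inf[of "c j"] leads_power[OF vi, of j]]
      by (simp add: inf.eval_mult inf.eval_power wt_def)
    have z: "leads (int (wt j)) (lead_coeff (c j) * (\<mu> ^ degree (c j) * \<nu> ^ j)) (at_zero ((to_fract (c j) \<circ>\<^sub>r u) * v ^ j))"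
      using leads_mult[OF poly_u_zero[of "c j"] leads_power[OF vz, of j]]
      by (simp add: zer.eval_mult zer.eval_power wt_def mult_ac)
    show "leads (int W) (if j \<in> J then ci j else 0) (at_inf ((to_fract (c j) \<circ>\<^sub>r u) * v ^ j))"
      "leads (int W) (if j \<in> J then cz j else 0) (at_zero ((to_fract (c j) \<circ>\<^sub>r u) * v ^ j))"
      using i z Wmax[of j] leads_less[OF i, of "int W"] leads_less[OF z, of "int W"] that
      by (cases "wt j = W"; cases "j \<in> J"; force simp: ci_def cz_def J_def compose_0[OF u1])+
  qed
  have sumJ: "(\<Sum>j<2 * e'. if j \<in> J then g j else 0) = sum g J" for g :: "nat \<Rightarrow> 'a"
  proof -
    have "(\<Sum>j<2 * e'. if j \<in> J then g j else 0) = sum g ({..<2 * e'} \<inter> J)" by (simp add: sum.inter_restrict)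
    also have "{..<2 * e'} \<inter> J = J" by (auto simp: J_def)
    finally show ?thesis .
  qed
  have yi: "leads (int W) (sum ci J) (at_inf y)" and yz: "leads (int W) (sum cz J) (at_zero y)"
    unfolding y_def inf.eval_sum zer.eval_sum sumJ[symmetric] by (intro leads_sum ti tz; simp)+
  \<comment> \<open>Maximal weight is attained at most twice, for \<open>j\<close> and \<open>j + e'\<close>.\<close>
  have two: "\<exists>i. degree (c j) = e + i \<and> degree (c j') = i \<and> j' = j + e'"
    if "j \<in> J" "j' \<in> J" "wt j = W" "wt j' = W" "j < j'" for j j'
  proof -
    have eq: "degree (c j) * e' + j * e = degree (c j') * e' + j' * e" using that by (simp add: wt_def)
    have "j' * e = j * e + (j' - j) * e" using that(5) by (simp flip: add_mult_distrib)
    hence eq': "degree (c j) * e' = degree (c j') * e' + (j' - j) * e" using eq by simp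
    hence "e' dvd (j' - j) * e" by (metis dvd_add_right_iff dvd_triv_right)
    hence "e' dvd j' - j" using cop by (metis coprime_commute coprime_dvd_mult_left_iff)
    moreover have "0 < j' - j" "j' - j < 2 * e'" using that by (auto simp: J_def)
    ultimately have jj: "j' - j = e'"
    proof -
      obtain k where k: "j' - j = e' * k" using \<open>e' dvd j' - j\<close> by (elim dvdE)
      have "e' * k < e' * 2" using \<open>j' - j < 2 * e'\<close> by (simp add: k mult.commute)
      hence "k < 2" using pos by simp
      moreover have "k \<noteq> 0" using k \<open>0 < j' - j\<close> by auto
      ultimately have "k = 1" by simp
      thus ?thesis using k by simp
    qed
    hence "degree (c j) * e' = (degree (c j') + e) * e'" using eq' by (simp add: algebra_simps)
    hence "degree (c j) = degree (c j') + e" using pos by simp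
    thus ?thesis using jj that(5) by auto
  qed
  have nonzero: "sum ci J \<noteq> 0 \<or> sum cz J \<noteq> 0"
  proof (cases "\<exists>m'\<in>J. wt m' = W \<and> m' \<noteq> m")
    case False
    have "sum ci J = sum ci {m}"
    proof (intro sum.mono_neutral_right ballI)
      fix x assume "x \<in> J - {m}"
      hence "wt x \<noteq> W" using False by blast
      thus "ci x = 0" by (simp add: ci_def)
    qed (use m(1) fJ in simp_all)
    also have "\<dots> = lead_coeff (c m)" using m(2) by (simp add: ci_def)
    finally show ?thesis using m(1) by (simp add: J_def)
  next
    case True
    then obtain j j' where jj: "j \<in> J" "j' \<in> J" "wt j = W" "wt j' = W" "j < j'"
      using m by (metis linorder_neqE_nat)
    then obtain i where i: "degree (c j) = e + i" "degree (c j') = i" "j' = j + e'" using two by blast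
    have only: "x = j \<or> x = j'" if "x \<in> J" "wt x = W" for x
    proof (rule ccontr)
      assume x: "\<not> (x = j \<or> x = j')"
      consider "x < j" | "j < x" using x by linarith
      thus False
      proof cases
        case 1
        thus False using two[OF that(1) jj(1) that(2) jj(3) 1] two[of x j'] that jj i pos by auto
      next
        case 2
        thus False using two[OF jj(1) that(1) jj(3) that(2) 2] i(3) x by auto
      qed
    qed
    have s: "sum g J = g j + g j'" if "\<And>x. wt x \<noteq> W \<Longrightarrow> g x = 0" for g :: "nat \<Rightarrow> 'a"
    proof -
      have "sum g J = sum g {j, j'}" using jj only that fJ by (intro sum.mono_neutral_right) auto
      thus ?thesis using jj(5) by simp
    qed
    let ?k = "lead_coeff (c j)" and ?k' = "lead_coeff (c j')"
    have k: "?k \<noteq> 0" using jj by (auto simp: J_def)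
    have si: "sum ci J = ?k + ?k'" using s[of ci] jj by (simp add: ci_def)
    have "sum cz J = ?k * (\<mu> ^ (e + i) * \<nu> ^ j) + ?k' * (\<mu> ^ i * \<nu> ^ (j + e'))"
      using s[of cz] jj i by (simp add: cz_def)
    hence sz: "sum cz J = (?k * \<alpha> + ?k' * \<beta>) * (\<mu> ^ i * \<nu> ^ j)" by (simp add: power_add algebra_simps)
    show ?thesis
    proof (rule ccontr)
      assume "\<not> ?thesis"
      hence "?k' = - ?k" "?k * \<alpha> + ?k' * \<beta> = 0" using si sz nz by (auto simp: eq_neg_iff_add_eq_0 add.commute)
      hence "?k * (\<alpha> - \<beta>) = 0" by (simp add: right_diff_distrib)
      thus False using k \<alpha>\<beta> by simp
    qed
  qed
  have WN: "W < N"
  proof -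
    obtain d where d: "leads (int N - 1) d (at_inf y)" using leads_pred[THEN iffD1, OF small(1)] by blast
    obtain d' where d': "leads (int N - 1) d' (at_zero y)" using leads_pred[THEN iffD1, OF small(2)] by blast
    have "int W \<le> int N - 1" using nonzero leads_le[OF yi d] leads_le[OF yz d'] by blast
    thus ?thesis by linarith
  qed
  have single: "x = m" if x: "x \<in> J" "wt x = W" for x
  proof (rule ccontr)
    assume "x \<noteq> m"
    then obtain j j' where jj: "j \<in> J" "j' \<in> J" "wt j = W" "wt j' = W" "j < j'"
      using m x by (metis linorder_neqE_nat)
    then obtain i where "j' = j + e'" using two by blast
    hence "N \<le> j' * e" by (simp add: algebra_simps)
    also have "\<dots> \<le> W" unfolding jj(4)[symmetric] wt_def by simp
    finally show False using WN by simp
  qed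
  have "sum h J = sum h {m}" if h: "\<And>x. wt x \<noteq> W \<Longrightarrow> h x = 0" for h :: "nat \<Rightarrow> 'a"
  proof (intro sum.mono_neutral_right ballI)
    fix x assume x: "x \<in> J - {m}"
    show "h x = 0" by (rule h) (use single x in blast)
  qed (use m(1) fJ in simp_all)
  from this[of ci] this[of cz] have "sum ci J = sum ci {m}" "sum cz J = sum cz {m}"
    by (simp_all add: ci_def cz_def)
  hence "sum ci J = lead_coeff (c m)" "sum cz J = lead_coeff (c m) * (\<mu> ^ degree (c m) * \<nu> ^ m)"
    using m by (simp_all add: ci_def cz_def)
  moreover have "lead_coeff (c m) \<noteq> 0" using m by (simp add: J_def)
  moreover have "W = degree (c m) * e' + m * e" using m(2) by (simp add: wt_def)
  ultimately show ?thesis using yi yz WN by metis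
qed

text \<open>\<open>P Q\<close> is a polynomial in \<open>u\<close> and \<open>v\<close>. By the integral equation of \<open>v\<close> over \<open>K[u]\<close> it can be written with powers
\<open>v\<^sup>j\<close>, \<open>j < 2 e'\<close>, only.\<close>

lemma product_leading_monomial:
  assumes t: "p \<noteq> 0" "t > 0" "leads (- int t) p (at_inf P)" and s: "q \<noteq> 0" "s > 0" "leads (- int s) q (at_zero Q)"
  shows "\<exists>i j k. i * e' + j * e < N \<and> int (i * e' + j * e) = int N - int t \<and> int (i * e' + j * e) = int N - int s \<and>
     (\<beta> - \<alpha>) * p = k \<and> (\<alpha> - \<beta>) * q = k * (\<mu> ^ i * \<nu> ^ j)"
proof -
  have PQi: "leads (- int t + int N) (p * (\<beta> - \<alpha>)) (at_inf (P * Q))"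
    unfolding inf.eval_mult by (intro leads_mult t Q_inf)
  have PQz: "leads (int N + - int s) ((\<alpha> - \<beta>) * q) (at_zero (P * Q))"
    unfolding zer.eval_mult by (intro leads_mult s P_zero)
  have small: "leads (int N) 0 (at_inf (P * Q))" "leads (int N) 0 (at_zero (P * Q))"
    using leads_less[OF PQi, of "int N"] leads_less[OF PQz, of "int N"] t s by simp_all
  define BY where "BY = map_poly (\<lambda>c. [:c:]) B1"
  define S where "S = ([:A1:] - BY) * (smult [:\<beta>:] [:A1:] - smult [:\<alpha>:] BY)"
  have const: "to_fract [:x:] \<circ>\<^sub>r u = ratfun_const x" for x
    using compose_const[OF u1, of x] by (simp add: ratfun_const_def)
  have SPQ: "bieval u v S = P * Q"
    unfolding S_def bieval_mult[OF u1] bieval_diff[OF u1] bieval_smult[OF u1] BY_def bieval_poly[OF u1 v1]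
      bieval_const[OF u1] const P_def Q_def A_def B_def ..
  obtain R where R: "degree R = ratfun_degree u" "lead_coeff R = 1" "bieval u v R = 0"
    using integral_relation[OF u v1 ne ab deg_ab(2)] by blast
  obtain T where T: "T = 0 \<or> degree T < degree R" "bieval u v S = bieval u v T"
    using bieval_reduce[OF u1 _ R(2,3), of S] R(1) u1 by auto
  have PQ: "P * Q = (\<Sum>j<2 * e'. (to_fract (coeff T j) \<circ>\<^sub>r u) * v ^ j)"
    using bieval_sum[OF u1, of T "2 * e'"] T R(1) SPQ deg_u by auto
  have PQ0: "P * Q \<noteq> 0" using leads_nonzero[OF P_zero] leads_nonzero[OF Q_inf] \<alpha>\<beta> by auto
  obtain i j k where ijk: "k \<noteq> 0" "i * e' + j * e < N" "leads (int (i * e' + j * e)) k (at_inf (P * Q))"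
      "leads (int (i * e' + j * e)) (k * (\<mu> ^ i * \<nu> ^ j)) (at_zero (P * Q))"
    using leading_monomial[of "coeff T", folded PQ, OF small PQ0] by blast
  have knz: "k * (\<mu> ^ i * \<nu> ^ j) \<noteq> 0" "p * (\<beta> - \<alpha>) \<noteq> 0" "(\<alpha> - \<beta>) * q \<noteq> 0" using ijk(1) nz t s \<alpha>\<beta> by auto
  from leads_order_unique[OF ijk(3) PQi ijk(1) knz(2)] leads_order_unique[OF ijk(4) PQz knz(1,3)] ijk(2)
  show ?thesis by (intro exI[of _ i] exI[of _ j] exI[of _ k]) (auto simp: mult.commute)
qed

text \<open>If the remainder \<open>\<rho>(u)\<close> dominates, \<open>A\<^sup>l - B\<^sup>l\<close> has the leading term of \<open>-\<rho>(u)\<close>, hence of a multiple of \<open>u\<^sup>i\<^sup>0\<close>, at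
both ends, and \<open>P Q\<close> that of a multiple of \<open>u\<^sup>i\<close>. The quotient of the leading coefficients of \<open>A\<^sup>l - B\<^sup>l\<close> and
\<open>P Q\<close> is computed from \<open>A\<close> and \<open>B\<close> at each end; equating the two results gives \<open>\<alpha> = - \<beta>\<close>.\<close>

lemma no_remainder_u:
  assumes big: "(l - 2) * N < i0 * e'" "j0 * e < i0 * e'"
  shows False
proof -
  obtain t p where t: "p \<noteq> 0" "t > 0" "leads (- int t) p (at_inf P)" using P_inf_order by blast
  obtain s q where s: "q \<noteq> 0" "s > 0" "leads (- int s) q (at_zero Q)" using Q_zero_order by blast
  define c where "c = lead_coeff \<rho>"
  have "i0 > 0" using big by (cases "i0 = 0") auto
  hence c: "c \<noteq> 0" by (auto simp: c_def i0_def)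
  have di: "leads (int (i0 * e')) (0 - c) (at_inf (A ^ l - B ^ l))"
    unfolding difference inf.eval_diff c_def i0_def
    by (intro leads_diff poly_u_inf leads_less[OF poly_v_inf]) (use big in \<open>simp add: i0_def j0_def del: of_nat_mult\<close>)
  have dz: "leads (int (i0 * e')) (0 - c * \<mu> ^ i0) (at_zero (A ^ l - B ^ l))"
    unfolding difference zer.eval_diff c_def i0_def
    by (intro leads_diff poly_u_zero leads_less[OF poly_v_zero]) (use big in \<open>simp add: i0_def j0_def del: of_nat_mult\<close>)
  have "leads (- int t + int (l - 1) * int N) (p * (of_nat l * 1 ^ (l - 1))) (at_inf (A ^ l - B ^ l))"
    unfolding inf.eval_diff inf.eval_power
    by (rule leads_power_diff[OF A_leads(1) B_leads(1)]) (use t l3 in \<open>auto simp: P_def inf.eval_diff\<close>)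
  from leads_order_unique[OF this di] have ti: "- int t + int (l - 1) * int N = int (i0 * e')" "p * of_nat l = - c"
    using t lK c by simp_all
  have "leads (0 + int (i0 * e')) (\<beta> ^ l * (0 - c * \<mu> ^ i0)) (at_zero (ratfun_const (\<beta> ^ l) * (A ^ l - B ^ l)))"
    unfolding zer.eval_mult by (intro leads_mult at_zero_const dz)
  moreover have "leads (- int s + int (l - 1) * int N) (q * (of_nat l * (\<beta> * \<alpha>) ^ (l - 1)))
      (at_zero (ratfun_const (\<beta> ^ l) * (A ^ l - B ^ l)))"
    unfolding scaled_difference[symmetric] zer.eval_diff zer.eval_power
    by (rule leads_power_diff[OF Q_zero_leads]) (use s l3 in \<open>auto simp: Q_def zer.eval_diff\<close>)
  ultimately have "\<beta> ^ l * (0 - c * \<mu> ^ i0) = q * (of_nat l * (\<beta> * \<alpha>) ^ (l - 1))"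
    by (rule leads_order_unique(2)) (use s lK c nz \<alpha>\<beta> in auto)
  hence qz: "q * of_nat l * (\<beta> ^ (l - 1) * \<alpha> ^ (l - 1)) = - (c * \<mu> ^ i0 * \<beta> ^ l)"
    by (simp add: power_mult_distrib mult_ac)
  obtain i j k where ijk: "i * e' + j * e < N" "int (i * e' + j * e) = int N - int t"
      "(\<beta> - \<alpha>) * p = k" "(\<alpha> - \<beta>) * q = k * (\<mu> ^ i * \<nu> ^ j)"
    using product_leading_monomial[OF t s] by blast
  \<comment> \<open>Comparing orders, the leading monomial of \<open>P Q\<close> is \<open>u\<^sup>i\<close> with \<open>i0 = i + (l - 2) e\<close>.\<close>
  have l2: "l - 1 = Suc (l - 2)" "l = Suc (Suc (l - 2))" using l3 by simp_all
  have "int (l - 1) * int N = int ((l - 2) * N) + int N"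
    unfolding l2(1) by (simp add: distrib_right)
  hence "int (i * e' + j * e) + int ((l - 2) * N) = int (i0 * e')"
    using ti(1) ijk(2) by linarith
  hence eq: "i * e' + j * e + (l - 2) * N = i0 * e'" by linarith
  have "(l - 2) * N = (l - 2) * e * e'" by simp
  hence "e' dvd i * e' + (l - 2) * N" by simp
  moreover have "e' dvd (i * e' + (l - 2) * N) + j * e"
    using dvd_triv_right[of e' i0] unfolding eq[symmetric] by (simp add: add_ac)
  ultimately have "e' dvd j * e" by (metis dvd_add_right_iff)
  hence "e' dvd j" using cop by (metis coprime_commute coprime_dvd_mult_left_iff)
  moreover have "j < e'"
  proof -
    have "j * e < N" using ijk(1) by linarith
    thus ?thesis by (metis mult.commute mult_less_cancel2)
  qed
  ultimately have j0: "j = 0" by (metis dvd_imp_le not_le neq0_conv)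
  have "(i + (l - 2) * e) * e' = i0 * e'" using eq j0 by (simp add: algebra_simps)
  hence i0: "i0 = i + (l - 2) * e" using pos by simp
  have mu: "\<mu> ^ i0 = \<mu> ^ i * \<alpha> ^ (l - 2)" by (simp add: i0 power_add power_mult mult.commute)
  have "q * of_nat l * \<alpha> * (\<beta> ^ (l - 1) * \<alpha> ^ (l - 2)) = - (c * \<mu> ^ i * \<beta>) * (\<beta> ^ (l - 1) * \<alpha> ^ (l - 2))"
  proof -
    have pw: "\<alpha> ^ (l - 1) = \<alpha> * \<alpha> ^ (l - 2)" "\<beta> ^ l = \<beta> * \<beta> ^ (l - 1)"
    proof -
      show "\<alpha> ^ (l - 1) = \<alpha> * \<alpha> ^ (l - 2)" unfolding l2(1) by (rule power_Suc)
      have "l = Suc (l - 1)" using l3 by simp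
      thus "\<beta> ^ l = \<beta> * \<beta> ^ (l - 1)" by (metis power_Suc)
    qed
    show ?thesis using qz unfolding mu pw by (simp only: mult_ac mult_minus_left mult_minus_right)
  qed
  moreover have "\<beta> ^ (l - 1) * \<alpha> ^ (l - 2) \<noteq> 0" using nz by simp
  ultimately have q': "q * of_nat l * \<alpha> = - (c * \<mu> ^ i * \<beta>)" by (metis mult_cancel_right)
  have k1: "k * of_nat l = (\<beta> - \<alpha>) * (- c)" unfolding ijk(3)[symmetric] using ti(2) by (simp add: mult.assoc)
  have "(\<alpha> - \<beta>) * (q * of_nat l * \<alpha>) = (k * of_nat l) * \<mu> ^ i * \<alpha>" using ijk(4) j0 by (simp add: mult_ac)
  hence "(\<alpha> - \<beta>) * (c * \<mu> ^ i) * \<beta> = (\<beta> - \<alpha>) * (c * \<mu> ^ i) * \<alpha>" unfolding q' k1 by (simp add: mult_ac)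
  hence "(\<alpha> - \<beta>) * (c * \<mu> ^ i) * (\<alpha> + \<beta>) = 0" by (simp add: algebra_simps)
  moreover have "\<alpha> + \<beta> \<noteq> 0" using \<alpha>\<beta>(4) by (simp add: eq_neg_iff_add_eq_0)
  ultimately show False using \<alpha>\<beta> c nz by simp
qed

end

lemma ratfun_degree_X_power: "ratfun_degree (ratfun_X ^ k) = k"
  by (simp add: X_power ratfun_degree_to_fract degree_monom_eq)

lemma X_power_compose: "i > 0 \<Longrightarrow> ratfun_X ^ j \<circ>\<^sub>r ratfun_X ^ i = (ratfun_X ^ (i * j) :: 'a::field ratfun)"
  by (simp add: compose_power X_compose ratfun_degree_X_power power_mult)

context two_ended
begin

text \<open>If neither remainder dominates, their orders agree and are divisible by \<open>e\<close> and \<open>e'\<close>, hence by \<open>N\<close>, and less than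
\<open>(l - 1) N\<close>.\<close>

lemma weights_small: "i0 * e' \<le> (l - 2) * N" "j0 * e \<le> (l - 2) * N"
proof -
  have swapped: "\<not> ((l - 2) * N < j0 * e \<and> i0 * e' < j0 * e)"
    using two_ended.no_remainder_u[OF swap]
    by (auto simp: two_ended.i0_def[OF swap] two_ended.j0_def[OF swap] two_ended.\<rho>_def[OF swap]
      two_ended.\<sigma>_def[OF swap] i0_def j0_def \<rho>_def \<sigma>_def mult.commute[of e' e])
  have tie: "i0 * e' \<le> (l - 2) * N" if "i0 * e' = j0 * e"
  proof -
    have "e dvd i0 * e'" unfolding that by simp
    hence "e dvd i0" using cop by (metis coprime_dvd_mult_left_iff)
    then obtain k where k: "i0 = e * k" by (elim dvdE)
    have "k * N < (l - 1) * N" using \<rho>_less by (simp add: k mult_ac)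
    hence "k < l - 1" by (metis mult_less_cancel2)
    hence "k * N \<le> (l - 2) * N" using l3 by (intro mult_right_mono) auto
    thus ?thesis by (simp add: k mult_ac)
  qed
  show "i0 * e' \<le> (l - 2) * N" "j0 * e \<le> (l - 2) * N"
    using swapped no_remainder_u tie by (metis le_trans linorder_neqE_nat nat_le_linear not_le)+
qed

text \<open>With small remainders \<open>A\<^sup>l - B\<^sup>l\<close> has order at most \<open>(l - 2) N\<close>, so \<open>P\<close> has a zero of order \<open>N\<close> at infinity and
\<open>Q\<close> one at zero. Their poles at the other end have order \<open>N\<close> as well.\<close>

lemma P_Q_monomials: "\<exists>x. P * ratfun_X ^ N = ratfun_const x" "Q = ratfun_const (\<beta> - \<alpha>) * ratfun_X ^ N"
proof -
  have small: "\<exists>c. leads K c y" if "leads M d y" "M \<le> K" for K M d and y :: "'a fls"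
    using that leads_less[OF that(1), of K] by (cases "M = K") auto
  have wi: "int (degree \<rho> * e') \<le> int ((l - 2) * N)" "int (degree \<sigma> * e) \<le> int ((l - 2) * N)"
    using weights_small unfolding i0_def j0_def by (simp_all only: of_nat_le_iff)
  obtain x1 x2 where x: "leads (int ((l - 2) * N)) x1 (at_inf (to_fract \<sigma> \<circ>\<^sub>r v))" "leads (int ((l - 2) * N)) x2 (at_inf (to_fract \<rho> \<circ>\<^sub>r u))"
    using small[OF poly_v_inf[of \<sigma>] wi(2)] small[OF poly_u_inf[of \<rho>] wi(1)] by blast
  obtain z1 z2 where z: "leads (int ((l - 2) * N)) z1 (at_zero (to_fract \<sigma> \<circ>\<^sub>r v))" "leads (int ((l - 2) * N)) z2 (at_zero (to_fract \<rho> \<circ>\<^sub>r u))"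
    using small[OF poly_v_zero[of \<sigma>] wi(2)] small[OF poly_u_zero[of \<rho>] wi(1)] by blast
  have di: "leads (int ((l - 2) * N)) (x1 - x2) (at_inf (A ^ l - B ^ l))"
    unfolding difference inf.eval_diff by (rule leads_diff[OF x])
  have dz: "leads (0 + int ((l - 2) * N)) (\<beta> ^ l * (z1 - z2)) (at_zero (ratfun_const (\<beta> ^ l) * (A ^ l - B ^ l)))"
    unfolding difference zer.eval_diff zer.eval_mult by (intro leads_mult at_zero_const leads_diff z)
  have l1: "int (l - 1) * int N = int ((l - 2) * N) + int N"
  proof -
    have l2: "l - 1 = Suc (l - 2)" using l3 by simp
    show ?thesis unfolding l2 by (simp add: distrib_right)
  qed
  obtain t p where t: "p \<noteq> 0" "leads (- int t) p (at_inf P)" using P_inf_order by blast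
  have "leads (- int t + int (l - 1) * int N) (p * (of_nat l * 1 ^ (l - 1))) (at_inf (A ^ l - B ^ l))"
    unfolding inf.eval_diff inf.eval_power
    by (rule leads_power_diff[OF A_leads(1) B_leads(1)]) (use t l3 in \<open>auto simp: P_def inf.eval_diff\<close>)
  from leads_le[OF this di] have "- int t \<le> - int N" using t lK l1 by simp
  then obtain x where x: "leads (- int N) x (at_inf P)" using small[OF t(2)] by blast
  obtain s q where s: "q \<noteq> 0" "leads (- int s) q (at_zero Q)" using Q_zero_order by blast
  have "leads (- int s + int (l - 1) * int N) (q * (of_nat l * (\<beta> * \<alpha>) ^ (l - 1)))
      (at_zero (ratfun_const (\<beta> ^ l) * (A ^ l - B ^ l)))"
    unfolding scaled_difference[symmetric] zer.eval_diff zer.eval_power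
    by (rule leads_power_diff[OF Q_zero_leads]) (use s l3 in \<open>auto simp: Q_def zer.eval_diff\<close>)
  from leads_le[OF this dz] have "- int s \<le> - int N" using s lK \<alpha>\<beta> nz l1 by simp
  then obtain y where y: "leads (- int N) y (at_zero Q)" using small[OF s(2)] by blast
  have P1: "leads (- int N + int N * 1) (x * 1 ^ N) (at_inf (P * ratfun_X ^ N))"
    unfolding inf.eval_mult inf.eval_power by (intro leads_mult leads_power x at_inf_X)
  have P2: "leads (int N + int N * (-1)) ((\<alpha> - \<beta>) * 1 ^ N) (at_zero (P * ratfun_X ^ N))"
    unfolding zer.eval_mult zer.eval_power by (intro leads_mult leads_power P_zero at_zero_X)
  have "P * ratfun_X ^ N - ratfun_const x = 0"
    by (rule laurent_eq_0[where c = "(\<alpha> - \<beta>) - x"])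
      (use leads_diff[OF _ at_inf_const[of x], of "x"] leads_diff[OF _ at_zero_const[of x], of "\<alpha> - \<beta>"] P1 P2 in
        \<open>auto simp: inf.eval_diff zer.eval_diff intro!: laurent_diff laurent_mult laurent_power laurent_AB\<close>)
  thus "\<exists>x. P * ratfun_X ^ N = ratfun_const x" by auto
  have X1: "leads (0 + int N * 1) ((\<beta> - \<alpha>) * 1 ^ N) (at_inf (ratfun_const (\<beta> - \<alpha>) * ratfun_X ^ N))"
    unfolding inf.eval_mult inf.eval_power by (intro leads_mult leads_power at_inf_const at_inf_X)
  have X2: "leads (0 + int N * (-1)) ((\<beta> - \<alpha>) * 1 ^ N) (at_zero (ratfun_const (\<beta> - \<alpha>) * ratfun_X ^ N))"
    unfolding zer.eval_mult zer.eval_power by (intro leads_mult leads_power at_zero_const at_zero_X)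
  have D: "(Q - ratfun_const (\<beta> - \<alpha>) * ratfun_X ^ N) * inverse (ratfun_X ^ N) = 0"
  proof (rule laurent_eq_0)
    have "laurent_polynomial (inverse (ratfun_X ^ N) :: 'a ratfun)"
      unfolding laurent_iff by (rule exI[of _ 1], rule exI[of _ N]) simp
    thus "laurent_polynomial ((Q - ratfun_const (\<beta> - \<alpha>) * ratfun_X ^ N) * inverse (ratfun_X ^ N))"
      by (intro laurent_mult laurent_diff laurent_power laurent_AB laurent_const laurent_X)
    have i: "leads (int N) 0 (at_inf (Q - ratfun_const (\<beta> - \<alpha>) * ratfun_X ^ N))"
      using leads_diff[OF Q_inf, of "\<beta> - \<alpha>"] X1 by (simp add: inf.eval_diff)
    have z: "leads (- int N) (y - (\<beta> - \<alpha>)) (at_zero (Q - ratfun_const (\<beta> - \<alpha>) * ratfun_X ^ N))"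
      using leads_diff[OF y, of "\<beta> - \<alpha>"] X2 by (simp add: zer.eval_diff)
    have Xi: "leads (- (int N * 1)) (inverse (1 ^ N)) (at_inf (inverse (ratfun_X ^ N)))"
      unfolding inf.eval_inverse inf.eval_power by (intro leads_inverse leads_power at_inf_X) simp
    have Xz: "leads (- (int N * (-1))) (inverse (1 ^ N)) (at_zero (inverse (ratfun_X ^ N)))"
      unfolding zer.eval_inverse zer.eval_power by (intro leads_inverse leads_power at_zero_X) simp
    show "leads 0 0 (at_inf ((Q - ratfun_const (\<beta> - \<alpha>) * ratfun_X ^ N) * inverse (ratfun_X ^ N)))"
      using leads_mult[OF i Xi] by (simp only: inf.eval_mult) simp
    show "leads 0 (y - (\<beta> - \<alpha>)) (at_zero ((Q - ratfun_const (\<beta> - \<alpha>) * ratfun_X ^ N) * inverse (ratfun_X ^ N)))"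
      using leads_mult[OF z Xz] by (simp only: zer.eval_mult) simp
  qed
  thus "Q = ratfun_const (\<beta> - \<alpha>) * ratfun_X ^ N" by simp
qed

lemma A_in_power: "\<exists>\<psi>. laurent_polynomial \<psi> \<and> A = \<psi> \<circ>\<^sub>r ratfun_X ^ N"
proof -
  obtain x where x: "P * ratfun_X ^ N = ratfun_const x" using P_Q_monomials(1) by blast
  have Px: "P = ratfun_const x * inverse (ratfun_X ^ N)"
    unfolding x[symmetric] by (simp add: mult.assoc)
  have "ratfun_const (\<beta> - \<alpha>) * A = Q - ratfun_const \<alpha> * P"
    unfolding Q_def P_def ratfun_const_diff by (simp only: algebra_simps)
  moreover have "ratfun_const (\<beta> - \<alpha>) \<noteq> 0" using \<alpha>\<beta>(3) by simp
  ultimately have "A = (Q - ratfun_const \<alpha> * P) / ratfun_const (\<beta> - \<alpha>)"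
    by (metis nonzero_eq_divide_eq mult.commute)
  hence "A = inverse (ratfun_const (\<beta> - \<alpha>)) * (Q - ratfun_const \<alpha> * P)"
    by (simp only: divide_inverse mult.commute)
  hence A: "A = ratfun_const (inverse (\<beta> - \<alpha>)) * (ratfun_const (\<beta> - \<alpha>) * ratfun_X ^ N - ratfun_const \<alpha> * (ratfun_const x * inverse (ratfun_X ^ N)))"
    by (simp only: ratfun_const_inverse P_Q_monomials(2) Px)
  define \<psi> where "\<psi> = ratfun_const (inverse (\<beta> - \<alpha>)) * (ratfun_const (\<beta> - \<alpha>) * ratfun_X - ratfun_const \<alpha> * (ratfun_const x * inverse ratfun_X))"
  have XN: "ratfun_degree (ratfun_X ^ N :: 'a ratfun) \<ge> 1" using pos by (simp only: ratfun_degree_X_power) simp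
  have A\<psi>: "\<psi> \<circ>\<^sub>r ratfun_X ^ N = A"
    unfolding A \<psi>_def compose_mult[OF XN] compose_diff[OF XN] compose_const[OF XN] compose_inverse[OF XN] X_compose[OF XN] ..
  have "laurent_polynomial \<psi>"
    unfolding \<psi>_def by (intro laurent_mult laurent_diff laurent_const laurent_X laurent_inverse_X)
  thus ?thesis using A\<psi>[symmetric] by (intro exI conjI)
qed

text \<open>For a prime \<open>q\<close> dividing \<open>e'\<close>, \<open>A1(u)\<close> is a function of \<open>x\<^sup>q\<close>. As \<open>q\<close> does not divide \<open>e = deg A1\<close>, so is \<open>u\<close>,
which then is decomposable.\<close>

lemma e'_one:
  assumes NK: "of_nat N \<noteq> (0::'a)"
  shows "e' = 1"
proof (rule ccontr)
  assume "e' \<noteq> 1"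
  then obtain q where q: "prime q" "q dvd e'" using prime_factor_nat by blast
  have q0: "q > 0" using q(1) by (rule prime_gt_0_nat)
  obtain m where m: "N = q * m" using q(2) by (metis dvd_mult dvdE)
  have m0: "m > 0" using pos m by (cases "m = 0") auto
  obtain \<psi> where \<psi>: "laurent_polynomial \<psi>" "A = \<psi> \<circ>\<^sub>r ratfun_X ^ N" using A_in_power by blast
  have Xq: "ratfun_degree (ratfun_X ^ q :: 'a ratfun) \<ge> 1" using q0 by (simp add: ratfun_degree_X_power)
  have Xm: "ratfun_degree (ratfun_X ^ m :: 'a ratfun) \<ge> 1" using m0 by (simp add: ratfun_degree_X_power)
  have A': "A = (\<psi> \<circ>\<^sub>r ratfun_X ^ m) \<circ>\<^sub>r ratfun_X ^ q"
    unfolding \<psi>(2) m compose_assoc[OF Xq] X_power_compose[OF q0] ..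
  have tame: "tame_laurent A" unfolding tame_laurent_def
    using laurent_AB(1) A_leads(1) NK pos by (intro conjI exI[of _ N] exI[of _ 1]) auto
  obtain s t where st: "to_fract s \<circ>\<^sub>r u = t \<circ>\<^sub>r (ratfun_X ^ q)" "degree s = (if q dvd degree A1 then q else 1)"
    using common_multiple_with_power[OF lu u1 ui pos(2) tame A_def A' laurent_in_power_nth(2)[OF \<psi>(1) m0] q(1)] by blast
  have "\<not> q dvd e" using cop q by (metis coprime_common_divisor_nat not_prime_1 coprime_def nat_dvd_1_iff_1)
  hence s1: "ratfun_degree (to_fract s) = 1" using st(2) A1(1) by (simp add: ratfun_degree_to_fract)
  then obtain \<kappa> where \<kappa>: "ratfun_degree \<kappa> = 1" "\<kappa> \<circ>\<^sub>r to_fract s = ratfun_X" using mobius_inverse by blast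
  have "u = \<kappa> \<circ>\<^sub>r (to_fract s \<circ>\<^sub>r u)" using \<kappa> s1 u1 by (simp add: X_compose flip: compose_assoc)
  define w where "w = ratfun_degree (\<kappa> \<circ>\<^sub>r t)"
  have td: "ratfun_degree u = ratfun_degree t * q"
    using arg_cong[OF st(1), of ratfun_degree] s1 u1 Xq by (simp add: ratfun_degree_compose ratfun_degree_X_power)
  hence t1: "ratfun_degree t \<ge> 1" using u1 by (cases "ratfun_degree t") auto
  have ut: "u = (\<kappa> \<circ>\<^sub>r t) \<circ>\<^sub>r ratfun_X ^ q"
    using \<open>u = _\<close> st(1) by (simp add: compose_assoc[OF Xq])
  have dt: "ratfun_degree (\<kappa> \<circ>\<^sub>r t) = ratfun_degree t" using \<kappa>(1) t1 by (simp add: ratfun_degree_compose)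
  have "ratfun_degree t = 1 \<or> q = 1"
    using indecomposable_compose_cases[OF u[unfolded ut] Xq] dt by (simp add: ratfun_degree_X_power)
  hence "ratfun_degree t = 1" using q(1) by auto
  hence "2 * e' = q" using td deg_u by simp
  moreover have "q \<le> e'" using q(2) pos(2) by (rule dvd_imp_le)
  ultimately show False using q0 by simp
qed

end


lemma simple_poles_form:
  assumes lu: "laurent_polynomial u" and ui: "leads 1 1 (at_inf u)" and uz: "leads 1 \<mu> (at_zero u)" 
  shows "\<exists>c. u = ratfun_X + ratfun_const c + ratfun_const \<mu> * inverse ratfun_X"
proof -
  define D where "D = u - (ratfun_X + ratfun_const \<mu> * inverse ratfun_X)"
  have lD: "laurent_polynomial D"
    unfolding D_def by (intro laurent_diff laurent_add laurent_mult lu laurent_X laurent_const laurent_inverse_X)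
  have Xi: "leads (-1) 1 (at_inf (inverse ratfun_X))" using leads_inverse[OF at_inf_X] by (simp add: inf.eval_inverse)
  have Xz: "leads 1 1 (at_zero (inverse ratfun_X))" using leads_inverse[OF at_zero_X] by (simp add: zer.eval_inverse)
  have "leads (0 + -1) (\<mu> * 1) (at_inf (ratfun_const \<mu> * inverse ratfun_X))"
    unfolding inf.eval_mult by (intro leads_mult at_inf_const Xi)
  hence "leads 1 0 (at_inf (ratfun_const \<mu> * inverse ratfun_X))" by (rule leads_less) simp
  from leads_diff[OF ui leads_add[OF at_inf_X this]] have "leads 1 0 (at_inf D)"
    by (simp add: D_def inf.eval_diff inf.eval_add)
  then obtain c where "leads (1 - 1) c (at_inf D)" using leads_pred[THEN iffD1] by blast
  hence Di: "leads 0 c (at_inf D)" by simp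
  have "leads (0 + 1) (\<mu> * 1) (at_zero (ratfun_const \<mu> * inverse ratfun_X))"
    unfolding zer.eval_mult by (intro leads_mult at_zero_const Xz)
  hence "leads 1 \<mu> (at_zero (ratfun_const \<mu> * inverse ratfun_X))" by simp
  from leads_diff[OF uz leads_add[OF leads_less[OF at_zero_X] this]] have "leads 1 0 (at_zero D)"
    by (simp add: D_def zer.eval_diff zer.eval_add)
  then obtain c' where "leads (1 - 1) c' (at_zero D)" using leads_pred[THEN iffD1] by blast
  hence Dz: "leads 0 c' (at_zero D)" by simp
  have "D - ratfun_const c = 0"
    by (rule laurent_eq_0[where c = "c' - c"])
      (use leads_diff[OF Di at_inf_const[of c]] leads_diff[OF Dz at_zero_const[of c]] in
        \<open>auto simp: inf.eval_diff zer.eval_diff intro!: laurent_diff lD\<close>)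
  hence "u = ratfun_X + ratfun_const c + ratfun_const \<mu> * inverse ratfun_X"
    by (simp add: D_def algebra_simps)
  thus ?thesis by blast
qed

text \<open>\<open>x + c + \<mu>/x\<close> is invariant under \<open>x \<mapsto> \<mu>/x\<close>; two such invariances yield invariance under
  \<open>x \<mapsto> (\<mu>/\<nu>) x\<close>.\<close>

lemma common_dihedral:
  fixes f u v :: "'a::field ratfun"
  assumes f: "f = to_fract a \<circ>\<^sub>r u" "f = to_fract b \<circ>\<^sub>r v" and lf: "laurent_polynomial f"
    and u: "u = ratfun_X + ratfun_const c + ratfun_const \<mu> * inverse ratfun_X"
    and v: "v = ratfun_X + ratfun_const d + ratfun_const \<nu> * inverse ratfun_X"
    and nz: "\<mu> \<noteq> 0" "\<nu> \<noteq> 0" and uv1: "ratfun_degree u \<ge> 1" "ratfun_degree v \<ge> 1"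
    and l: "l > 0" "(\<mu> / \<nu>) ^ l = 1" "\<And>k. 0 < k \<Longrightarrow> k < l \<Longrightarrow> (\<mu> / \<nu>) ^ k \<noteq> 1"
    and i: "at_zero f $$ i \<noteq> 0"
  shows "int l dvd i"
proof -
  define \<iota> where "\<iota> = (\<lambda>m::'a. ratfun_const m * inverse ratfun_X)"
  have \<iota>_eq: "\<iota> m = ratfun_const m * inverse ratfun_X" for m by (simp add: \<iota>_def)
  have d\<iota>: "ratfun_degree (\<iota> m) = 1" if "m \<noteq> 0" for m
  proof -
    have iX: "ratfun_degree (inverse ratfun_X :: 'a ratfun) \<ge> 1" by (simp add: ratfun_degree_inverse_X)
    have "\<iota> m = (ratfun_const m * ratfun_X + ratfun_const 0) \<circ>\<^sub>r inverse ratfun_X"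
      by (simp add: \<iota>_def compose_mult[OF iX] compose_const[OF iX] X_compose[OF iX])
    thus ?thesis by (simp only: ratfun_degree_compose[OF iX] ratfun_degree_linear[OF that] ratfun_degree_inverse_X mult_1)
  qed
  have inv: "(ratfun_X + ratfun_const k + ratfun_const m * inverse ratfun_X) \<circ>\<^sub>r \<iota> m =
      ratfun_X + ratfun_const k + ratfun_const m * inverse ratfun_X" if "m \<noteq> 0" for k m
  proof -
    have i1: "ratfun_degree (\<iota> m) \<ge> 1" using d\<iota>[OF that] by simp
    have "ratfun_const m * inverse (\<iota> m) = ratfun_X" using that by (simp add: \<iota>_def field_simps)
    thus ?thesis
      by (simp add: compose_add[OF i1] compose_mult[OF i1] compose_const[OF i1] X_compose[OF i1] compose_inverse[OF i1])
        (simp add: \<iota>_def)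
  qed
  have i1: "ratfun_degree (\<iota> \<mu>) \<ge> 1" "ratfun_degree (\<iota> \<nu>) \<ge> 1" using d\<iota> nz by simp_all
  have "f \<circ>\<^sub>r \<iota> \<mu> = f" unfolding f(1) using inv[OF nz(1), of c] i1 uv1 by (simp add: compose_assoc flip: u)
  moreover have "f \<circ>\<^sub>r \<iota> \<nu> = f" unfolding f(2) using inv[OF nz(2), of d] i1 uv1 by (simp add: compose_assoc flip: v)
  ultimately have "f \<circ>\<^sub>r (\<iota> \<mu> \<circ>\<^sub>r \<iota> \<nu>) = f" using i1 by (simp flip: compose_assoc)
  define \<gamma> where "\<gamma> = \<mu> / \<nu>"
  have \<gamma>: "\<gamma> \<noteq> 0" using nz by (simp add: \<gamma>_def)
  define \<kappa> where "\<kappa> = to_fract (monom \<gamma> 1)"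
  have \<kappa>X: "\<kappa> = ratfun_const \<gamma> * ratfun_X"
    by (simp add: \<kappa>_def ratfun_X_def ratfun_const_def monom_altdef flip: to_fract_mult)
  have "\<iota> \<mu> \<circ>\<^sub>r \<iota> \<nu> = \<kappa>"
    unfolding \<iota>_eq[of \<mu>] compose_mult[OF i1(2)] compose_const[OF i1(2)] compose_inverse[OF i1(2)] X_compose[OF i1(2)]
    unfolding \<iota>_def \<kappa>X \<gamma>_def using nz by (simp add: ratfun_const_divide field_simps)
  hence f\<kappa>: "f \<circ>\<^sub>r \<kappa> = f" using \<open>f \<circ>\<^sub>r (\<iota> \<mu> \<circ>\<^sub>r \<iota> \<nu>) = f\<close> by simp
  have k1: "ratfun_degree \<kappa> \<ge> 1" using \<gamma> by (simp add: \<kappa>_def ratfun_degree_to_fract degree_monom_eq)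
  obtain p n where p: "f * ratfun_X ^ n = to_fract p" using lf by (auto simp: laurent_iff)
  have "to_fract (pcompose p (monom \<gamma> 1)) = (f * ratfun_X ^ n) \<circ>\<^sub>r \<kappa>"
    unfolding p to_fract_compose[OF k1] unfolding \<kappa>_def poly_const_to_fract ..
  also have "\<dots> = ratfun_const (\<gamma> ^ n) * (f * ratfun_X ^ n)"
    unfolding compose_mult[OF k1] compose_power[OF k1] X_compose[OF k1] f\<kappa>
    unfolding \<kappa>X by (simp add: power_mult_distrib ratfun_const_power mult_ac)
  finally have "pcompose p (monom \<gamma> 1) = smult (\<gamma> ^ n) p" unfolding p to_fract_smult[symmetric] by (simp only: to_fract_eq_iff)
  hence cf: "\<gamma> ^ j * coeff p j = \<gamma> ^ n * coeff p j" for j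
    using coeff_pcompose_monom_linear[of p \<gamma> j] by auto
  define j where "j = nat (i + int n)"
  have ij: "int j = i + int n" "coeff p j \<noteq> 0" using i unfolding at_zero_nth[OF p] j_def by (auto split: if_splits)
  have pow: "\<gamma> ^ (l * k) = 1" for k using l(2) by (simp add: power_mult \<gamma>_def)
  have order: "l dvd k" if "\<gamma> ^ k = 1" for k
  proof -
    have "\<gamma> ^ k = \<gamma> ^ (l * (k div l)) * \<gamma> ^ (k mod l)" by (simp flip: power_add)
    hence "\<gamma> ^ (k mod l) = 1" using that pow by simp
    hence "k mod l = 0" using l(3)[of "k mod l"] l(1) by (auto simp: \<gamma>_def)
    thus ?thesis by auto
  qed
  have "\<gamma> ^ j = \<gamma> ^ n" using cf[of j] ij(2) by simp
  hence "l dvd j - n" "l dvd n - j"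
    using \<gamma> order by (cases "j \<le> n"; simp add: power_diff; fail)+
  hence "int l dvd int j - int n"
    by (cases "j \<le> n") (metis dvd_minus_iff int_dvd_int_iff minus_diff_eq of_nat_diff, metis int_dvd_int_iff nat_le_linear of_nat_diff)
  thus ?thesis by (simp add: ij)
qed

section \<open>Comparing two Laurent right factors\<close>

text \<open>Write \<open>deg a = d\<^sub>0 e\<close> and \<open>deg b = d\<^sub>0 e'\<close> with coprime \<open>e\<close>, \<open>e'\<close>. Then \<open>u\<close>, \<open>v\<close> have pole orders
\<open>e' g\<close>, \<open>e g\<close> at infinity and \<open>e' g'\<close>, \<open>e g'\<close> at zero. Let \<open>l\<close> be the order of \<open>\<mu>\<^sup>e / \<nu>\<^sup>e\<^sup>'\<close>, where \<open>\<mu>\<close>, \<open>\<nu>\<close>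
are the leading coefficients at zero. Approximate roots of degrees \<open>l e\<close>, \<open>l e'\<close> give a common multiple, and
\<open>deg v = e (g + g')\<close>, so only \<open>l > g + g'\<close> needs the finer analysis at the two ends.\<close>

theorem two_laurent_factors:
  fixes f u v :: "'a::field ratfun" and a b :: "'a poly"
  assumes tame: "tame_laurent f" and u: "indecomposable u" and v: "indecomposable v"
    and lu: "laurent_polynomial u" "leads (int N1) 1 (at_inf u)" "N1 > 0"
    and lv: "laurent_polynomial v" "leads (int N2) 1 (at_inf v)" "N2 > 0"
    and f: "f = to_fract a \<circ>\<^sub>r u" "f = to_fract b \<circ>\<^sub>r v"
  shows "v \<in> range (\<lambda>c. c \<circ>\<^sub>r u) \<or>
    (\<exists>s t. s \<circ>\<^sub>r u = t \<circ>\<^sub>r v \<and> 1 \<le> ratfun_degree s \<and> ratfun_degree s \<le> ratfun_degree v) \<or>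
    (\<exists>q \<phi>. prime q \<and> laurent_polynomial \<phi> \<and> f = \<phi> \<circ>\<^sub>r (ratfun_X ^ q))"
proof (cases "v \<in> range (\<lambda>c. c \<circ>\<^sub>r u)")
  case ne: False
  obtain n \<phi> where n: "n > 0" "\<phi> \<noteq> 0" "of_nat n \<noteq> (0::'a)" "leads (int n) \<phi> (at_inf f)"
    using tame by (auto simp: tame_laurent_def)
  have lf: "laurent_polynomial f" using tame by (simp add: tame_laurent_def)
  have f0: "f \<noteq> 0" using n by auto
  have u1: "ratfun_degree u \<ge> 1" and v1: "ratfun_degree v \<ge> 1"
    using indecomposable_degree[OF u] indecomposable_degree[OF v] by simp_all
  have ab0: "a \<noteq> 0" "b \<noteq> 0" using f0 f by (auto simp: compose_0[OF u1] compose_0[OF v1])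
  have lead: "leads (int (degree p) * int N) (lead_coeff p) (at_inf (to_fract p \<circ>\<^sub>r w))"
    if "leads (int N) 1 (at_inf w)" "N > 0" "ratfun_degree w \<ge> 1" for p :: "'a poly" and w N
    using leads_poly[OF that(1) _ order_refl, of p] that by (simp add: inf.eval_compose_poly)
  have na: "n = degree a * N1" "lead_coeff a = \<phi>"
    using leads_order_unique[OF n(4) lead[OF lu(2,3) u1, of a, folded f(1)] n(2)] ab0
    by (simp_all flip: of_nat_mult)
  have nb: "n = degree b * N2" "lead_coeff b = \<phi>"
    using leads_order_unique[OF n(4) lead[OF lv(2,3) v1, of b, folded f(2)] n(2)] ab0
    by (simp_all flip: of_nat_mult)
  define d0 where "d0 = gcd (degree a) (degree b)"
  have dpos: "degree a > 0" "degree b > 0" using n(1) na nb by (auto intro: gr0I)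
  obtain e e' where ee: "degree a = e * d0" "degree b = e' * d0" "coprime e e'"
    using gcd_coprime_exists[of "degree a" "degree b"] dpos unfolding d0_def by auto
  have pos: "d0 > 0" "e > 0" "e' > 0" using ee dpos by (auto intro: gr0I)
  \<comment> \<open>Pole orders \<open>M1\<close>, \<open>M2\<close> of \<open>u\<close>, \<open>v\<close> with \<open>deg a M1 = deg b M2\<close> are \<open>e' g\<close> and \<open>e g\<close>.\<close>
  have split: "\<exists>g. M1 = e' * g \<and> M2 = e * g" if M: "degree a * M1 = degree b * M2" for M1 M2
  proof -
    have "e * M1 = e' * M2" using M pos by (simp add: ee) 
    moreover from this have "e' dvd e * M1" by simp
    hence "e' dvd M1" using ee(3) by (metis coprime_commute coprime_dvd_mult_right_iff)
    then obtain g where "M1 = e' * g" by (elim dvdE)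
    ultimately show ?thesis using pos by (intro exI[of _ g]) (simp add: mult.left_commute)
  qed
  obtain g where g: "N1 = e' * g" "N2 = e * g" using split[of N1 N2] na nb by auto
  have gpos: "g > 0" using g lu(3) by (auto intro: gr0I)
  define a1 b1 where "a1 = smult (inverse \<phi>) a" and "b1 = smult (inverse \<phi>) b"
  have a1: "degree a1 = e * d0" "lead_coeff a1 = 1" and b1: "degree b1 = e' * d0" "lead_coeff b1 = 1"
    using n(2) na nb by (simp_all add: a1_def b1_def ee)
  have f1: "to_fract a1 \<circ>\<^sub>r u = to_fract b1 \<circ>\<^sub>r v"
    using f by (simp add: a1_def b1_def to_fract_smult compose_mult[OF u1] compose_mult[OF v1]
      compose_const[OF u1] compose_const[OF v1])
  \<comment> \<open>Composing approximate roots with \<open>u\<close> and \<open>v\<close> gives Laurent polynomials which agree at infinity.\<close>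
  have roots: "\<exists>C D. degree C = r * e \<and> lead_coeff C = 1 \<and> degree D = r * e' \<and> lead_coeff D = 1 \<and>
      leads 0 0 (at_inf ((to_fract C \<circ>\<^sub>r u) - (to_fract D \<circ>\<^sub>r v))) \<and>
      (\<forall>M \<mu> \<nu>. leads (int (e' * M)) \<mu> (at_zero u) \<longrightarrow> leads (int (e * M)) \<nu> (at_zero v) \<longrightarrow> M > 0 \<longrightarrow> \<mu> \<noteq> 0 \<longrightarrow>
         \<mu> ^ (r * e) = \<nu> ^ (r * e') \<longrightarrow> leads 0 0 (at_zero ((to_fract C \<circ>\<^sub>r u) - (to_fract D \<circ>\<^sub>r v))))"
    if kr: "d0 = k * r" for k r
  proof -
    have k: "k > 0" "of_nat k \<noteq> (0::'a)"
      using pos(1) n(3) by (auto simp: kr na(1) ee(1))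
    obtain C where C: "degree C = r * e" "lead_coeff C = 1" "degree (a1 - C ^ k) \<le> (k - 1) * (r * e)" "coeff (a1 - C ^ k) ((k - 1) * (r * e)) = 0"
      using approximate_root[OF k one_neq_zero, of a1 "r * e"] a1 by (auto simp: kr mult_ac)
    obtain D where D: "degree D = r * e'" "lead_coeff D = 1" "degree (b1 - D ^ k) \<le> (k - 1) * (r * e')" "coeff (b1 - D ^ k) ((k - 1) * (r * e')) = 0"
      using approximate_root[OF k one_neq_zero, of b1 "r * e'"] b1 by (auto simp: kr mult_ac)
    let ?W = "to_fract C \<circ>\<^sub>r u" and ?V = "to_fract D \<circ>\<^sub>r v"
    have diff: "?W ^ k - ?V ^ k = (to_fract (b1 - D ^ k) \<circ>\<^sub>r v) - (to_fract (a1 - C ^ k) \<circ>\<^sub>r u)"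
      using f1 by (simp add: compose_diff[OF u1] compose_diff[OF v1] compose_power[OF u1] compose_power[OF v1] to_fract_power)
    have close: "leads 0 0 (E ?W - E ?V)"
      if E: "E = ratfun_eval.eval fls_const y0" "ratfun_eval fls_const y0"
        and uv: "leads (int (e' * M)) \<mu> (E u)" "leads (int (e * M)) \<nu> (E v)" "M > 0" "\<mu> \<noteq> 0"
        and eq: "\<mu> ^ (r * e) = \<nu> ^ (r * e')" for E y0 M \<mu> \<nu>
    proof -
      interpret E: ratfun_eval fls_const y0 by (rule E(2))
      have M0: "int (e' * M) > 0" "int (e * M) > 0" using uv(3) pos by simp_all
      have Ep: "E (to_fract p \<circ>\<^sub>r u) = poly (map_poly fls_const p) (E u)" "E (to_fract p \<circ>\<^sub>r v) = poly (map_poly fls_const p) (E v)" for p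
        by (simp_all add: E(1) E.eval_compose_poly[OF u1] E.eval_compose_poly[OF v1])
      have W: "leads (int (r * e * e' * M)) (\<mu> ^ (r * e)) (E ?W)"
        using leads_poly[OF uv(1) M0(1) order_refl, of C] C(1,2) by (simp add: Ep mult_ac)
      have "leads (int (r * e * e' * M)) (\<nu> ^ (r * e')) (E ?V)"
        using leads_poly[OF uv(2) M0(2) order_refl, of D] D(1,2) by (simp add: Ep mult_ac)
      hence V: "leads (int (r * e * e' * M)) (\<mu> ^ (r * e)) (E ?V)" by (simp only: eq)
      define K where "K = 0 + int (k - 1) * int (r * e * e' * M)"
      have K: "int ((k - 1) * (r * e')) * int (e * M) = K" "int ((k - 1) * (r * e)) * int (e' * M) = K"
        unfolding K_def by (simp_all only: of_nat_mult mult_ac add_0)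
      have lD: "leads K 0 (E (to_fract (b1 - D ^ k) \<circ>\<^sub>r v))"
        unfolding Ep K(1)[symmetric] using leads_poly[OF uv(2) M0(2) D(3)] unfolding D(4) by simp
      have lC: "leads K 0 (E (to_fract (a1 - C ^ k) \<circ>\<^sub>r u))"
        unfolding Ep K(2)[symmetric] using leads_poly[OF uv(1) M0(1) C(3)] unfolding C(4) by simp
      from leads_diff[OF lD lC] have "leads K 0 (E (?W ^ k - ?V ^ k))"
        unfolding diff unfolding E(1) E.eval_diff by simp
      hence "leads K 0 (E ?W ^ k - E ?V ^ k)"
        by (simp add: E(1) E.eval_diff E.eval_power)
      thus ?thesis using leads_power_diff_cancel[OF W V k] uv(4) unfolding K_def by simp
    qed
    have "leads 0 0 (at_inf (?W - ?V))"
      using close[OF refl inf.ratfun_eval_axioms, of g 1 1] lu lv gpos by (simp add: g inf.eval_diff)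
    moreover have "leads 0 0 (at_zero (?W - ?V))" if "leads (int (e' * M)) \<mu> (at_zero u)" "leads (int (e * M)) \<nu> (at_zero v)"
        "M > 0" "\<mu> \<noteq> 0" "\<mu> ^ (r * e) = \<nu> ^ (r * e')" for M \<mu> \<nu>
      using close[OF refl zer.ratfun_eval_axioms that] by (simp add: zer.eval_diff)
    ultimately show ?thesis using C(1,2) D(1,2) by blast
  qed
  have s_deg: "1 \<le> ratfun_degree (to_fract C)" if "degree C = r * e" "r > 0" for C :: "'a poly" and r
    using that pos by (simp add: ratfun_degree_to_fract)
  have "u \<noteq> 0" "v \<noteq> 0" using lu lv by auto
  then obtain m1 \<mu> m2 \<nu> where m: "\<mu> \<noteq> 0" "leads m1 \<mu> (at_zero u)" "\<nu> \<noteq> 0" "leads m2 \<nu> (at_zero v)"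
    using leads_exists[of "at_zero u"] leads_exists[of "at_zero v"] by auto
  have zp: "leads (int (degree p) * M) (lead_coeff p * \<eta> ^ degree p) (at_zero (to_fract p \<circ>\<^sub>r w))"
    if "leads M \<eta> (at_zero w)" "M > 0" "ratfun_degree w \<ge> 1" for p :: "'a poly" and w M \<eta>
    using leads_poly[OF that(1,2) order_refl, of p] that by (simp add: zer.eval_compose_poly)
  have zreg: "\<exists>d. leads 0 d (at_zero (to_fract p \<circ>\<^sub>r w))"
    if w: "leads M \<eta> (at_zero w)" "M \<le> 0" "ratfun_degree w \<ge> 1" for p :: "'a poly" and w M \<eta>
  proof -
    have "leads 0 (at_zero w $$ 0) (at_zero w)" using w by (auto simp: leads_def)
    from leads_poly_regular[OF this] show ?thesis using w(3) by (simp add: zer.eval_compose_poly)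
  qed
  show ?thesis
  proof (cases "m1 > 0")
    case False
    have "m2 \<le> 0"
    proof (rule ccontr)
      assume "\<not> m2 \<le> 0"
      hence m2: "m2 > 0" by simp
      obtain d where d: "leads 0 d (at_zero f)" using zreg[OF m(2) _ u1, of a] False f by auto
      have "int (degree b) * m2 \<le> 0"
        by (rule leads_le[OF zp[OF m(4) m2 v1, of b, folded f(2)] d]) (use ab0 m in simp)
      moreover have "int (degree b) * m2 > 0" using dpos m2 by simp
      ultimately show False by linarith
    qed
    obtain C D where CD: "degree C = 1 * e" "lead_coeff C = 1" "leads 0 0 (at_inf ((to_fract C \<circ>\<^sub>r u) - (to_fract D \<circ>\<^sub>r v)))"
      using roots[of d0 1] by auto
    obtain x y where "leads 0 x (at_zero (to_fract C \<circ>\<^sub>r u))" "leads 0 y (at_zero (to_fract D \<circ>\<^sub>r v))"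
      using zreg[OF m(2) _ u1, of C] zreg[OF m(4) _ v1, of D] False \<open>m2 \<le> 0\<close> by auto
    from leads_diff[OF this] have z: "leads 0 (x - y) (at_zero ((to_fract C \<circ>\<^sub>r u) - (to_fract D \<circ>\<^sub>r v)))"
      by (simp add: zer.eval_diff)
    have "(to_fract C \<circ>\<^sub>r u) - (to_fract D \<circ>\<^sub>r v) = 0"
      by (rule laurent_eq_0[OF _ CD(3) z]) (intro laurent_diff laurent_compose_poly lu lv u1 v1)
    hence "to_fract C \<circ>\<^sub>r u = to_fract D \<circ>\<^sub>r v" by simp
    moreover have "ratfun_degree (to_fract C) \<le> ratfun_degree v"
    proof -
      have "e \<le> N2" using g gpos by simp
      thus ?thesis using laurent_degree(1)[OF lv(1,2) one_neq_zero] CD(1) by (simp add: ratfun_degree_to_fract)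
    qed
    ultimately show ?thesis using s_deg[OF CD(1) zero_less_one] by blast
  next
    case m1: True
    have zfa: "leads (int (degree a) * m1) (lead_coeff a * \<mu> ^ degree a) (at_zero f)"
      using zp[OF m(2) m1 u1, of a] f by simp
    have m2: "m2 > 0"
    proof (rule ccontr)
      assume "\<not> m2 > 0"
      then obtain d where d: "leads 0 d (at_zero f)" using zreg[OF m(4) _ v1, of b] f by auto
      have "int (degree a) * m1 \<le> 0" by (rule leads_le[OF zfa d]) (use ab0 m in simp)
      moreover have "int (degree a) * m1 > 0" using dpos m1 by simp
      ultimately show False by linarith
    qed
    have zfb: "leads (int (degree b) * m2) (lead_coeff b * \<nu> ^ degree b) (at_zero f)"
      using zp[OF m(4) m2 v1, of b] f by simp
    have mm: "int (degree a) * m1 = int (degree b) * m2" "lead_coeff a * \<mu> ^ degree a = lead_coeff b * \<nu> ^ degree b"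
      using leads_order_unique[OF zfa zfb] ab0 m by simp_all
    have "int (degree a * nat m1) = int (degree b * nat m2)" using mm(1) m1 m2 by simp
    hence "degree a * nat m1 = degree b * nat m2" by (simp only: of_nat_eq_iff)
    then obtain g' where "nat m1 = e' * g'" "nat m2 = e * g'" using split by blast
    hence g': "m1 = int (e' * g')" "m2 = int (e * g')" using m1 m2 by linarith+
    have g'pos: "g' > 0" using g' m1 by (auto intro: gr0I)
    have \<mu>\<nu>: "(\<mu> ^ e) ^ d0 = (\<nu> ^ e') ^ d0" using mm(2) n(2) unfolding na(2) nb(2) by (simp add: ee power_mult)
    define \<gamma> where "\<gamma> = \<mu> ^ e / \<nu> ^ e'"
    have \<gamma>d: "\<gamma> ^ d0 = 1" using \<mu>\<nu> m by (simp add: \<gamma>_def power_divide)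
    have \<gamma>iff: "\<gamma> ^ k = 1 \<longleftrightarrow> \<mu> ^ (k * e) = \<nu> ^ (k * e')" for k
      using m by (simp add: \<gamma>_def power_divide mult.commute[of k] power_mult)
    define l where "l = (LEAST k. k > 0 \<and> \<gamma> ^ k = 1)"
    have l: "l > 0" "\<gamma> ^ l = 1"
      using LeastI[of "\<lambda>k. k > 0 \<and> \<gamma> ^ k = 1" d0] pos \<gamma>d by (auto simp: l_def)
    have lmin: "\<gamma> ^ k \<noteq> 1" if "0 < k" "k < l" for k
      using not_less_Least[of k "\<lambda>k. k > 0 \<and> \<gamma> ^ k = 1"] that by (auto simp: l_def)
    have "l dvd d0"
    proof -
      have "\<gamma> ^ (l * (d0 div l)) = 1" using l by (simp add: power_mult)
      moreover have "\<gamma> ^ d0 = \<gamma> ^ (l * (d0 div l)) * \<gamma> ^ (d0 mod l)" by (simp flip: power_add)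
      ultimately have "\<gamma> ^ (d0 mod l) = 1" using \<gamma>d by simp
      hence "d0 mod l = 0" using lmin[of "d0 mod l"] l(1) by fastforce
      thus ?thesis by auto
    qed
    then obtain k where k: "d0 = k * l" by (metis dvdE mult.commute)
    obtain C D where CD: "degree C = l * e" "lead_coeff C = 1" "degree D = l * e'" "lead_coeff D = 1"
        "leads 0 0 (at_inf ((to_fract C \<circ>\<^sub>r u) - (to_fract D \<circ>\<^sub>r v)))"
        "leads 0 0 (at_zero ((to_fract C \<circ>\<^sub>r u) - (to_fract D \<circ>\<^sub>r v)))"
      using roots[OF k] m g' g'pos l(2) \<gamma>iff by metis
    have "(to_fract C \<circ>\<^sub>r u) - (to_fract D \<circ>\<^sub>r v) = 0"
      by (rule laurent_eq_0[OF _ CD(5,6)]) (intro laurent_diff laurent_compose_poly lu lv u1 v1)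
    hence st: "to_fract C \<circ>\<^sub>r u = to_fract D \<circ>\<^sub>r v" by simp
    have dv: "ratfun_degree v = e * (g + g')"
      using laurent_degree(2)[OF lv(1,2) one_neq_zero m(4)[unfolded g'(2)] _ m(3)] pos g'pos by (simp add: g distrib_left)
    show ?thesis
    proof (cases "l \<le> g + g'")
      case True
      have "ratfun_degree (to_fract C) = e * l" using CD(1) by (simp add: ratfun_degree_to_fract)
      also have "\<dots> \<le> e * (g + g')" using True by (rule mult_le_mono2)
      finally have "ratfun_degree (to_fract C) \<le> ratfun_degree v" by (simp only: dv)
      thus ?thesis using st s_deg[OF CD(1) l(1)] by blast
    next
      case big: False
      hence l3: "l \<ge> 3" using gpos g'pos by simp
      obtain p where p: "p \<noteq> 0" "coeval u p v = 0" using algebraic_relation_exists[OF u1] by blast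
      have X: "ratfun_X \<in> range (\<lambda>q. coeval u q v)" using indecomposable_relation_degree(2)[OF u ne p] by simp
      have D: "degree a * e' = d0 * e * e'" "degree b * e = d0 * e * e'" by (simp_all add: ee mult_ac)
      have nD: "n = d0 * e * e' * g" by (simp add: na ee g mult_ac)
      hence Dnz: "of_nat (d0 * e * e') \<noteq> (0::'a)" using n(3) by (auto simp only: of_nat_mult mult_eq_0_iff)
      have fab: "to_fract a \<circ>\<^sub>r u = to_fract b \<circ>\<^sub>r v" using f by simp
      have "int g dvd 1"
        by (rule generator_order_dvd[OF inf.ratfun_eval_axioms u1 v1 lu(2)[unfolded g] _ pos(3) lv(2)[unfolded g] _ pos(2) fab D Dnz gpos X at_inf_X]) simp_all
      moreover have "int g' dvd -1"
        by (rule generator_order_dvd[OF zer.ratfun_eval_axioms u1 v1 m(2)[unfolded g'] m(1) pos(3) m(4)[unfolded g'] m(3) pos(2) fab D Dnz g'pos X at_zero_X]) simp_all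
      ultimately have gg: "g = 1" "g' = 1" by simp_all
      have lK: "of_nat l \<noteq> (0::'a)" "of_nat (e * e') \<noteq> (0::'a)" using Dnz by (auto simp: k)
      obtain A1 where A1: "degree A1 = e" "lead_coeff A1 = 1" "degree (C - A1 ^ l) \<le> (l - 1) * e" "coeff (C - A1 ^ l) ((l - 1) * e) = 0"
        using approximate_root[OF l(1) lK(1) one_neq_zero, of C e] CD by auto
      obtain B1 where B1: "degree B1 = e'" "lead_coeff B1 = 1" "degree (D - B1 ^ l) \<le> (l - 1) * e'" "coeff (D - B1 ^ l) ((l - 1) * e') = 0"
        using approximate_root[OF l(1) lK(1) one_neq_zero, of D e'] CD by auto
      have root: "(\<mu> ^ e) ^ l = (\<nu> ^ e') ^ l" using l(2) \<gamma>iff[of l] by (simp add: mult.commute[of l] power_mult)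
      have noroot: "(\<mu> ^ e) ^ 2 \<noteq> (\<nu> ^ e') ^ 2" using lmin[of 2] l3 \<gamma>iff[of 2] by (simp add: mult.commute[of 2] power_mult)
      interpret two: two_ended u v C D A1 B1 e e' l \<mu> \<nu>
        by unfold_locales
          (use u v ne lu lv m pos ee(3) st CD A1 B1 l3 lK root noroot in \<open>simp_all add: g g' gg\<close>)
      have "e' = 1" by (rule two.e'_one[OF lK(2)])
      moreover have "e = 1" using two_ended.e'_one[OF two.swap] lK(2) by (simp add: mult.commute)
      ultimately have e1: "e = 1" "e' = 1" by simp_all
      obtain c where c: "u = ratfun_X + ratfun_const c + ratfun_const \<mu> * inverse ratfun_X"
        using simple_poles_form[OF lu(1), of \<mu>] lu(2) m(2) by (auto simp: g g' gg e1)
      obtain d where d: "v = ratfun_X + ratfun_const d + ratfun_const \<nu> * inverse ratfun_X"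
        using simple_poles_form[OF lv(1), of \<nu>] lv(2) m(4) by (auto simp: g g' gg e1)
      have \<gamma>': "\<gamma> = \<mu> / \<nu>" by (simp add: \<gamma>_def e1)
      obtain q where q: "prime q" "q dvd l" using prime_factor_nat[of l] l3 by auto
      have "int q dvd i" if "at_zero f $$ i \<noteq> 0" for i
      proof -
        have "int l dvd i"
          by (rule common_dihedral[OF f lf c d m(1,3) u1 v1 l(1) _ _ that]) (use l(2) lmin \<gamma>' in auto)
        thus ?thesis using q(2) by (metis dvd_trans int_dvd_int_iff)
      qed
      from laurent_in_power[OF lf prime_gt_0_nat[OF q(1)] this] q(1) show ?thesis by blast
    qed
  qed
qed blast

section \<open>Uniqueness of the degrees\<close>

text \<open>Left factors of \<open>f\<close> are determined only up to fractional linear changes of the variable, and the induction has to apply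
to all of them.\<close>

definition tame_up_to_mobius :: "'a::field ratfun \<Rightarrow> bool" where
  "tame_up_to_mobius f \<longleftrightarrow> (\<exists>\<mu>. ratfun_degree \<mu> = 1 \<and> tame_laurent (f \<circ>\<^sub>r \<mu>))"

lemma tame_imp_tame_up_to_mobius: "tame_laurent f \<Longrightarrow> tame_up_to_mobius f"
  unfolding tame_up_to_mobius_def by (intro exI[of _ ratfun_X]) (simp add: ratfun_compose_X)

lemma indecomposable_X_prime: 
  assumes "prime q"
  shows "indecomposable (ratfun_X ^ q)"
  unfolding indecomposable_def
proof (intro conjI notI)
  show "1 < ratfun_degree (ratfun_X ^ q)" using prime_gt_1_nat[OF assms] by (simp add: ratfun_degree_X_power)
  assume "\<exists>u v. 1 < ratfun_degree u \<and> 1 < ratfun_degree v \<and> ratfun_X ^ q = u \<circ>\<^sub>r (v :: 'a ratfun)"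
  then obtain u v :: "'a ratfun" where uv: "1 < ratfun_degree u" "1 < ratfun_degree v" "ratfun_X ^ q = u \<circ>\<^sub>r v" by blast
  have "q = ratfun_degree u * ratfun_degree v"
    using arg_cong[OF uv(3), of ratfun_degree] uv(2) by (simp add: ratfun_degree_X_power ratfun_degree_compose)
  thus False using assms uv(1,2) by (metis less_irrefl prime_product)
qed

lemma prime_of_indecomposable_X_power:
  assumes "indecomposable (ratfun_X ^ k :: 'a::field ratfun)"
  shows "prime k"
proof -
  have k: "k > 1" using indecomposable_degree[OF assms] by (simp add: ratfun_degree_X_power)
  then obtain q where q: "prime q" "q dvd k" using prime_factor_nat[of k] by auto
  then obtain m where m: "k = q * m" by (elim dvdE)
  have q0: "q > 0" using q(1) by (rule prime_gt_0_nat)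
  have "indecomposable (ratfun_X ^ m \<circ>\<^sub>r ratfun_X ^ q :: 'a ratfun)" using assms by (simp add: X_power_compose[OF q0] m)
  from indecomposable_compose_cases[OF this] have "m = 1 \<or> q = 1" using q0 by (simp add: ratfun_degree_X_power)
  thus ?thesis using q m by auto
qed

lemma tame_left_factor_power:
  fixes \<phi> :: "'a::field ratfun"
  assumes tame: "tame_laurent (\<phi> \<circ>\<^sub>r ratfun_X ^ k)" and l\<phi>: "laurent_polynomial \<phi>" and k: "k > 0"
  shows "tame_laurent \<phi>"
proof -
  have Xk: "ratfun_degree (ratfun_X ^ k :: 'a ratfun) \<ge> 1" using k by (simp add: ratfun_degree_X_power)
  obtain n c where n: "n > 0" "c \<noteq> 0" "of_nat n \<noteq> (0::'a)" "leads (int n) c (at_inf (\<phi> \<circ>\<^sub>r ratfun_X ^ k))"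
    using tame by (auto simp: tame_laurent_def)
  obtain P j where P: "\<phi> * ratfun_X ^ j = to_fract P" using l\<phi> by (auto simp: laurent_iff)
  have "\<phi> \<noteq> 0" using n by (auto simp: compose_0[OF Xk])
  hence P0: "P \<noteq> 0" using P by auto
  have lXk: "leads (int k * 1) (1 ^ k) (at_inf (ratfun_X ^ k))" unfolding inf.eval_power by (intro leads_power at_inf_X)
  have "leads (int n + int j * int k) (c * 1 ^ j) (at_inf ((\<phi> * ratfun_X ^ j) \<circ>\<^sub>r ratfun_X ^ k))"
    unfolding compose_mult[OF Xk] compose_power[OF Xk] X_compose[OF Xk] inf.eval_mult
    using leads_mult[OF n(4) leads_power[OF lXk, of j]] by (simp add: inf.eval_power)
  moreover have "leads (int (degree P) * int k) (lead_coeff P) (at_inf ((\<phi> * ratfun_X ^ j) \<circ>\<^sub>r ratfun_X ^ k))"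
    unfolding P inf.eval_compose_poly[OF Xk] using leads_poly[OF lXk _ order_refl, of P] k by simp
  ultimately have "int n + int j * int k = int (degree P) * int k"
    by (rule leads_order_unique(1)) (use n P0 in auto)
  hence eq: "int n = (int (degree P) - int j) * int k" by (simp add: left_diff_distrib)
  hence "int (degree P) - int j > 0" using n(1) k by (metis of_nat_0_less_iff zero_less_mult_pos2)
  then obtain d where d: "int (degree P) - int j = int d" "d > 0" by (metis zero_less_imp_eq_int)
  have nd: "n = d * k" using eq unfolding d(1) by (metis of_nat_eq_iff of_nat_mult)
  have "leads (int (degree P) + - (int j * 1)) (lead_coeff P * inverse (1 ^ j)) (at_inf (to_fract P) * inverse (at_inf (ratfun_X ^ j)))"
    unfolding inf.eval_power by (intro leads_mult leads_inverse leads_power at_inf_X at_inf_to_fract P0) simp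
  hence "leads (int d) (lead_coeff P) (at_inf (to_fract P * inverse (ratfun_X ^ j)))"
    using d(1) by (simp add: inf.eval_mult inf.eval_inverse)
  moreover have "to_fract P * inverse (ratfun_X ^ j) = \<phi>" unfolding P[symmetric] by (simp add: mult.assoc)
  ultimately have "leads (int d) (lead_coeff P) (at_inf \<phi>)" by simp
  moreover have "of_nat d \<noteq> (0::'a)" using n(3) by (auto simp: nd)
  ultimately show ?thesis unfolding tame_laurent_def using l\<phi> d(2) P0 by (intro conjI exI[of _ d] exI[of _ "lead_coeff P"]) auto
qed

text \<open>The two shapes of \<open>f = a \<circ> u\<close>. In the first, all poles of \<open>f\<close> are poles of \<open>u\<close>; in the second, zero and infinity
stay apart under \<open>u\<close>.\<close>

definition laurent_factor :: "'a::field ratfun \<Rightarrow> 'a ratfun \<Rightarrow> bool" where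
  "laurent_factor a u \<longleftrightarrow> (\<exists>p N. a = to_fract p \<and> laurent_polynomial u \<and> N > 0 \<and> leads (int N) 1 (at_inf u))"

definition power_factor :: "'a::field ratfun \<Rightarrow> 'a ratfun \<Rightarrow> bool" where
  "power_factor a u \<longleftrightarrow> laurent_polynomial a \<and> (\<exists>q. prime q \<and> u = ratfun_X ^ q)"

lemma normalized_last_factor:
  fixes f a u :: "'a::field ratfun"
  assumes tame: "tame_laurent f" and f: "f = a \<circ>\<^sub>r u" and u: "indecomposable u" and D: "decomp_degrees a M"
  shows "\<exists>a' u'. f = a' \<circ>\<^sub>r u' \<and> indecomposable u' \<and> ratfun_degree u' = ratfun_degree u \<and> decomp_degrees a' M \<and>
     tame_laurent a' \<and> ratfun_degree a' < ratfun_degree f \<and> (laurent_factor a' u' \<or> power_factor a' u')"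
proof -
  obtain n \<phi> where n: "n > 0" "\<phi> \<noteq> 0" "of_nat n \<noteq> (0::'a)" "leads (int n) \<phi> (at_inf f)" and lf: "laurent_polynomial f"
    using tame by (auto simp: tame_laurent_def)
  have du: "ratfun_degree u > 1" by (rule indecomposable_degree[OF u])
  hence u1: "ratfun_degree u \<ge> 1" by simp
  obtain \<mu> u' where \<mu>: "ratfun_degree \<mu> = 1" "ratfun_degree u' \<ge> 1" "u = \<mu> \<circ>\<^sub>r u'"
    and alt: "(\<exists>p N. a \<circ>\<^sub>r \<mu> = to_fract p \<and> laurent_polynomial u' \<and> N > 0 \<and> leads (int N) 1 (at_inf u')) \<or>
     (laurent_polynomial (a \<circ>\<^sub>r \<mu>) \<and> (\<exists>k\<ge>1. u' = ratfun_X ^ k))"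
    using laurent_factor_normal_form[OF lf n(4,1,2) f u1] by blast
  define a' where "a' = a \<circ>\<^sub>r \<mu>"
  have fa: "f = a' \<circ>\<^sub>r u'" using \<mu> by (simp add: f a'_def compose_assoc)
  obtain \<nu> where \<nu>: "ratfun_degree \<nu> = 1" "\<nu> \<circ>\<^sub>r \<mu> = ratfun_X" using mobius_inverse[OF \<mu>(1)] by blast
  have "u' = \<nu> \<circ>\<^sub>r u" using \<mu> \<nu> by (simp add: X_compose flip: compose_assoc)
  hence iu: "indecomposable u'" using indecomposable_compose_mobius(2)[OF u \<nu>(1)] by simp
  have deg: "ratfun_degree u' = ratfun_degree u" using \<mu> by (simp add: ratfun_degree_compose)
  have Da: "decomp_degrees a' M" unfolding a'_def by (rule decomp_degrees_mobius_right[OF D \<mu>(1)])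
  have "ratfun_degree a' \<ge> 1" by (rule decomp_degrees_pos[OF Da])
  hence "ratfun_degree a' * 1 < ratfun_degree a' * ratfun_degree u'"
    using du deg by (intro mult_strict_left_mono) auto
  hence less: "ratfun_degree a' < ratfun_degree f" using \<mu>(2) by (simp add: fa ratfun_degree_compose)
  from alt have "tame_laurent a' \<and> (laurent_factor a' u' \<or> power_factor a' u')"
  proof
    assume "\<exists>p N. a \<circ>\<^sub>r \<mu> = to_fract p \<and> laurent_polynomial u' \<and> N > 0 \<and> leads (int N) 1 (at_inf u')"
    then obtain p N where p: "a' = to_fract p" "laurent_polynomial u'" "N > 0" "leads (int N) 1 (at_inf u')"
      unfolding a'_def by blast
    have p0: "p \<noteq> 0" using n \<mu>(2) by (auto simp: fa p(1) compose_0)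
    have "leads (int (degree p) * int N) (lead_coeff p) (at_inf f)"
      using leads_poly[OF p(4) _ order_refl, of p] p(3) by (simp add: fa p(1) inf.eval_compose_poly[OF \<mu>(2)])
    hence "n = degree p * N"
      using leads_order_unique(1)[OF n(4) _ n(2)] p0 by (metis leading_coeff_0_iff of_nat_eq_iff of_nat_mult)
    hence "degree p > 0" "of_nat (degree p) \<noteq> (0::'a)" using n(1,3) by (auto intro: gr0I)
    hence "tame_laurent a'" unfolding tame_laurent_def p(1)
      using at_inf_to_fract[OF p0] p0 by (intro conjI laurent_to_fract exI[of _ "degree p"] exI[of _ "lead_coeff p"]) auto
    thus ?thesis using p by (auto simp: laurent_factor_def)
  next
    assume "laurent_polynomial (a \<circ>\<^sub>r \<mu>) \<and> (\<exists>k\<ge>1. u' = ratfun_X ^ k)"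
    then obtain k where k: "laurent_polynomial a'" "k \<ge> 1" "u' = ratfun_X ^ k" unfolding a'_def by blast
    have "tame_laurent a'" using tame_left_factor_power[of a' k] tame k by (simp add: fa)
    moreover have "prime k" using iu unfolding k(3) by (rule prime_of_indecomposable_X_power)
    ultimately show ?thesis using k by (auto simp: power_factor_def)
  qed
  thus ?thesis using fa iu deg Da less by blast
qed

lemma laurent_power_alternative:
  fixes f u :: "'a::field ratfun"
  assumes tame: "tame_laurent f" and f: "f = a \<circ>\<^sub>r u" "f = b \<circ>\<^sub>r ratfun_X ^ q" and u1: "ratfun_degree u \<ge> 1"
    and a: "laurent_factor a u" and b: "laurent_polynomial b" "prime q"
  shows "\<exists>s t. s \<circ>\<^sub>r u = t \<circ>\<^sub>r ratfun_X ^ q \<and> 1 \<le> ratfun_degree s \<and> ratfun_degree s \<le> ratfun_degree (ratfun_X ^ q :: 'a ratfun)"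
proof -
  obtain p N where p: "a = to_fract p" "laurent_polynomial u" "N > 0" "leads (int N) 1 (at_inf u)"
    using a by (auto simp: laurent_factor_def)
  obtain s t where "to_fract s \<circ>\<^sub>r u = t \<circ>\<^sub>r (ratfun_X ^ q)" "degree s = (if q dvd degree p then q else 1)"
    using common_multiple_with_power[OF p(2) u1 p(4,3) tame f(1)[unfolded p(1)] f(2) b] by blast
  thus ?thesis using prime_gt_0_nat[OF b(2)]
    by (intro exI[of _ "to_fract s"] exI[of _ t]) (auto simp: ratfun_degree_to_fract ratfun_degree_X_power)
qed

text \<open>Induction on the degree. The left factors of normalised decompositions are tame again, since the pole order of \<open>f\<close> at
infinity is a multiple of theirs.\<close>

theorem tame_up_to_mobius_unique_degrees:
  fixes f :: "'a::field ratfun"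
  shows "tame_up_to_mobius f \<Longrightarrow> unique_degrees f"
proof (induction "ratfun_degree f" arbitrary: f rule: less_induct)
  case (less f0)
  obtain \<mu> where \<mu>: "ratfun_degree \<mu> = 1" "tame_laurent (f0 \<circ>\<^sub>r \<mu>)" using less.prems by (auto simp: tame_up_to_mobius_def)
  define f where "f = f0 \<circ>\<^sub>r \<mu>"
  have tame: "tame_laurent f" using \<mu> by (simp add: f_def)
  have deg: "ratfun_degree f = ratfun_degree f0" using \<mu> by (simp add: f_def ratfun_degree_compose)
  have IH: "unique_degrees g" if "tame_laurent g" "ratfun_degree g < ratfun_degree f" for g :: "'a ratfun"
    by (rule less.hyps) (use that deg tame_imp_tame_up_to_mobius in auto)
  show ?case unfolding unique_degrees_def
  proof (intro allI impI)
    fix M M' assume MM0: "decomp_degrees f0 M" "decomp_degrees f0 M'"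
    hence MM: "decomp_degrees f M" "decomp_degrees f M'"
      unfolding f_def using decomp_degrees_mobius_right \<mu>(1) by blast+
    show "M = M'"
    proof (cases "ratfun_degree f = 1")
      case True
      have "K = {#}" if "decomp_degrees f K" for K
        using that
      proof (cases rule: decomp_degrees.cases)
        case (compose a Ma u)
        have "ratfun_degree u > 1" "ratfun_degree a \<ge> 1"
          using compose indecomposable_degree decomp_degrees_pos by blast+
        moreover have "ratfun_degree a * ratfun_degree u = 1"
          using True compose(1) calculation by (simp add: ratfun_degree_compose)
        ultimately show ?thesis by simp
      qed
      thus ?thesis using MM by metis
    next
      case False
      obtain a u Ma where au: "f = a \<circ>\<^sub>r u" "M = add_mset (ratfun_degree u) Ma" "decomp_degrees a Ma" "indecomposable u"
        using MM(1) False by (cases rule: decomp_degrees.cases) auto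
      obtain b v Mb where bv: "f = b \<circ>\<^sub>r v" "M' = add_mset (ratfun_degree v) Mb" "decomp_degrees b Mb" "indecomposable v"
        using MM(2) False by (cases rule: decomp_degrees.cases) auto
      obtain a' u' where a: "f = a' \<circ>\<^sub>r u'" "indecomposable u'" "ratfun_degree u' = ratfun_degree u" "decomp_degrees a' Ma"
        "unique_degrees a'" "laurent_factor a' u' \<or> power_factor a' u'"
        using normalized_last_factor[OF tame au(1,4,3)] IH by blast
      obtain b' v' where b: "f = b' \<circ>\<^sub>r v'" "indecomposable v'" "ratfun_degree v' = ratfun_degree v" "decomp_degrees b' Mb"
        "unique_degrees b'" "laurent_factor b' v' \<or> power_factor b' v'"
        using normalized_last_factor[OF tame bv(1,4,3)] IH by blast
      have u1: "ratfun_degree u' \<ge> 1" and v1: "ratfun_degree v' \<ge> 1"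
        using indecomposable_degree[OF a(2)] indecomposable_degree[OF b(2)] by simp_all
      have eq: "a' \<circ>\<^sub>r u' = b' \<circ>\<^sub>r v'" using a(1) b(1) by simp
      note step = unique_degrees_step[OF a(2) b(2) eq a(5) b(5) a(4) b(4)]
      note step' = unique_degrees_step[OF b(2) a(2) eq[symmetric] b(5) a(5) b(4) a(4)]
      have "add_mset (ratfun_degree u') Ma = add_mset (ratfun_degree v') Mb"
        using a(6)
      proof
        assume la: "laurent_factor a' u'"
        show ?thesis using b(6)
        proof
          assume lb: "laurent_factor b' v'"
          obtain p N1 where p: "a' = to_fract p" "laurent_polynomial u'" "N1 > 0" "leads (int N1) 1 (at_inf u')"
            using la by (auto simp: laurent_factor_def)
          obtain r N2 where r: "b' = to_fract r" "laurent_polynomial v'" "N2 > 0" "leads (int N2) 1 (at_inf v')"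
            using lb by (auto simp: laurent_factor_def)
          consider "v' \<in> range (\<lambda>c. c \<circ>\<^sub>r u') \<or>
              (\<exists>s t. s \<circ>\<^sub>r u' = t \<circ>\<^sub>r v' \<and> 1 \<le> ratfun_degree s \<and> ratfun_degree s \<le> ratfun_degree v')"
            | q \<phi> where "prime q" "laurent_polynomial \<phi>" "f = \<phi> \<circ>\<^sub>r (ratfun_X ^ q)"
            using two_laurent_factors[OF tame a(2) b(2) p(2,4,3) r(2,4,3) a(1)[unfolded p(1)] b(1)[unfolded r(1)]] by blast
          thus ?thesis
          proof cases
            case 1
            thus ?thesis by (rule step)
          next
            \<comment> \<open>Compare both decompositions with one ending in \<open>x\<^sup>q\<close>.\<close>
            case (2 q \<phi>)
            have iX: "indecomposable (ratfun_X ^ q :: 'a ratfun)" by (rule indecomposable_X_prime[OF 2(1)])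
            have Xq: "ratfun_degree (ratfun_X ^ q :: 'a ratfun) > 1" by (rule indecomposable_degree[OF iX])
            have "tame_laurent \<phi>" using tame_left_factor_power[of \<phi> q] tame 2 prime_gt_0_nat[OF 2(1)] by simp
            moreover have d\<phi>: "ratfun_degree f = ratfun_degree \<phi> * ratfun_degree (ratfun_X ^ q :: 'a ratfun)"
              using Xq by (simp add: 2(3) ratfun_degree_compose)
            have "ratfun_degree f \<ge> 1" using MM(1) by (rule decomp_degrees_pos)
            hence \<phi>1: "ratfun_degree \<phi> \<ge> 1" using d\<phi> by (cases "ratfun_degree \<phi>") auto
            have "ratfun_degree \<phi> * 1 < ratfun_degree \<phi> * ratfun_degree (ratfun_X ^ q :: 'a ratfun)"
              using \<phi>1 Xq by (intro mult_strict_left_mono) auto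
            ultimately have uq: "unique_degrees \<phi>" using IH d\<phi> by simp
            obtain M\<phi> where M\<phi>: "decomp_degrees \<phi> M\<phi>" using decomp_degrees_exists[OF \<phi>1] by blast
            have "add_mset (ratfun_degree u') Ma = add_mset (ratfun_degree (ratfun_X ^ q :: 'a ratfun)) M\<phi>"
              using unique_degrees_step[OF a(2) iX _ a(5) uq a(4) M\<phi>] a(1) 2(3)
                laurent_power_alternative[OF tame a(1) 2(3) u1 la 2(2,1)] by simp
            moreover have "add_mset (ratfun_degree v') Mb = add_mset (ratfun_degree (ratfun_X ^ q :: 'a ratfun)) M\<phi>"
              using unique_degrees_step[OF b(2) iX _ b(5) uq b(4) M\<phi>] b(1) 2(3)
                laurent_power_alternative[OF tame b(1) 2(3) v1 lb 2(2,1)] by simp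
            ultimately show ?thesis by simp
          qed
        next
          assume "power_factor b' v'"
          then obtain q where q: "laurent_polynomial b'" "prime q" "v' = ratfun_X ^ q" by (auto simp: power_factor_def)
          show ?thesis
            by (rule step, rule disjI2)
              (use laurent_power_alternative[OF tame a(1) b(1)[unfolded q(3)] u1 la q(1,2)] q(3) in simp)
        qed
      next
        assume pa: "power_factor a' u'"
        then obtain q where q: "laurent_polynomial a'" "prime q" "u' = ratfun_X ^ q" by (auto simp: power_factor_def)
        show ?thesis using b(6)
        proof
          assume lb: "laurent_factor b' v'"
          have "add_mset (ratfun_degree v') Mb = add_mset (ratfun_degree u') Ma"
            by (rule step', rule disjI2)
              (use laurent_power_alternative[OF tame b(1) a(1)[unfolded q(3)] v1 lb q(1,2)] q(3) in simp)
          thus ?thesis by simp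
        next
          assume "power_factor b' v'"
          then obtain q' where q': "prime q'" "v' = ratfun_X ^ q'" by (auto simp: power_factor_def)
          have "ratfun_X ^ q' \<circ>\<^sub>r u' = ratfun_X ^ q \<circ>\<^sub>r v'"
            using prime_gt_0_nat[OF q(2)] prime_gt_0_nat[OF q'(1)] by (simp add: q(3) q'(2) X_power_compose mult.commute)
          thus ?thesis
            using prime_gt_0_nat[OF q'(1)] q'(2)
            by (intro step disjI2 exI[of _ "ratfun_X ^ q'"] exI[of _ "ratfun_X ^ q"]) (auto simp: ratfun_degree_X_power)
        qed
      qed
      thus ?thesis using au(2) bv(2) a(3) b(3) by simp
    qed
  qed
qed

section \<open>Pole orders at zero and infinity\<close>

lemma at_inf_compose_inverse: "at_inf (f \<circ>\<^sub>r inverse ratfun_X) = at_zero f"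
proof -
  have iX: "ratfun_degree (inverse ratfun_X :: 'a ratfun) \<ge> 1" by (simp add: ratfun_degree_inverse_X)
  have "inverse fls_X_inv = (fls_X :: 'a fls)"
  proof -
    have "fls_X_inv * fls_X = (1 :: 'a fls)" by (simp add: fls_X_inv_times_conv_shift)
    thus ?thesis by (rule inverse_unique)
  qed
  hence *: "at_inf (to_fract p \<circ>\<^sub>r inverse ratfun_X) = at_zero (to_fract p)" for p :: "'a poly"
    by (simp add: inf.eval_compose_poly[OF iX] inf.eval_inverse inf.eval_X zer.eval_to_fract zer.peval_def)
  have "f \<circ>\<^sub>r inverse ratfun_X = (to_fract (numer f) / to_fract (denom f)) \<circ>\<^sub>r inverse ratfun_X"
    by (simp flip: ratfun_quot)
  thus ?thesis
    by (simp add: compose_divide[OF iX] inf.eval_divide *) (simp flip: zer.eval_divide ratfun_quot)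
qed

lemma laurent_compose_inverse:
  fixes f :: "'a::field ratfun"
  assumes "laurent_polynomial f"
  shows "laurent_polynomial (f \<circ>\<^sub>r inverse ratfun_X)"
proof -
  have iX: "ratfun_degree (inverse ratfun_X :: 'a ratfun) \<ge> 1" by (simp add: ratfun_degree_inverse_X)
  obtain p n where p: "f * ratfun_X ^ n = to_fract p" using assms by (auto simp: laurent_iff)
  have "(f \<circ>\<^sub>r inverse ratfun_X) * inverse ratfun_X ^ n = to_fract p \<circ>\<^sub>r inverse ratfun_X"
    by (simp flip: p add: compose_mult[OF iX] compose_power[OF iX] X_compose[OF iX])
  hence "f \<circ>\<^sub>r inverse ratfun_X = (to_fract p \<circ>\<^sub>r inverse ratfun_X) * ratfun_X ^ n"
    by (simp add: power_inverse field_simps)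
  thus ?thesis by (simp add: laurent_mult laurent_compose_poly[OF laurent_inverse_X iX] laurent_power laurent_X)
qed

lemma tame_at_infinity:
  fixes f :: "'a::field ratfun"
  assumes lf: "laurent_polynomial f" and p: "pole_order_infinity f > 0" "\<not> CHAR('a) dvd pole_order_infinity f"
  shows "tame_laurent f"
proof -
  have n0: "numer f \<noteq> 0" using p(1) by (auto simp: pole_order_infinity_def)
  have "leads (int (degree (numer f)) + - int (degree (denom f))) (lead_coeff (numer f) * inverse (lead_coeff (denom f)))
     (at_inf (to_fract (numer f)) * inverse (at_inf (to_fract (denom f))))"
    by (intro leads_mult leads_inverse at_inf_to_fract n0 denom_nonzero) (simp add: denom_nonzero)
  hence "leads (int (pole_order_infinity f)) (lead_coeff (numer f)) (at_inf f)"
    using p(1) numer_denom(3)[of f]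
    by (simp add: pole_order_infinity_def of_nat_diff ratfun_quot[symmetric] flip: divide_inverse inf.eval_divide)
  thus ?thesis unfolding tame_laurent_def using lf p n0
    by (intro conjI exI[of _ "pole_order_infinity f"] exI[of _ "lead_coeff (numer f)"]) (auto simp: of_nat_eq_0_iff_char_dvd)
qed

lemma tame_at_zero:
  fixes f :: "'a::field ratfun"
  assumes lf: "laurent_polynomial f" and p: "pole_order_zero f > 0" "\<not> CHAR('a) dvd pole_order_zero f"
  shows "tame_laurent (f \<circ>\<^sub>r inverse ratfun_X)"
proof -
  let ?m = "pole_order_zero f"
  have d: "denom f = monom 1 ?m" by (rule laurent_denom[OF lf])
  have "poly (denom f) 0 = 0" using p(1) by (subst d) (simp add: poly_monom)
  hence g0: "coeff (numer f) 0 \<noteq> 0"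
    using coprime_no_common_root[OF numer_denom(2)[of f], of 0] by (simp add: poly_0_coeff_0)
  have "leads (0 + - (int ?m * (-1))) (coeff (numer f) 0 * inverse (1 ^ ?m)) (at_zero (to_fract (numer f)) * inverse (at_zero (ratfun_X ^ ?m)))"
    unfolding zer.eval_power by (intro leads_mult leads_inverse leads_power at_zero_X at_zero_to_fract) simp
  moreover have "f = to_fract (numer f) * inverse (ratfun_X ^ ?m)"
    by (subst (1) ratfun_quot, subst (1) d) (simp add: X_power divide_inverse)
  hence "at_zero f = at_zero (to_fract (numer f)) * inverse (at_zero (ratfun_X ^ ?m))"
    by (metis zer.eval_mult zer.eval_inverse)
  ultimately have "leads (int ?m) (coeff (numer f) 0) (at_inf (f \<circ>\<^sub>r inverse ratfun_X))"
    unfolding at_inf_compose_inverse by simp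
  thus ?thesis unfolding tame_laurent_def using laurent_compose_inverse[OF lf] p g0
    by (intro conjI exI[of _ ?m] exI[of _ "coeff (numer f) 0"]) (auto simp: of_nat_eq_0_iff_char_dvd)
qed

theorem corollary1p6:
  fixes f :: "'a::field ratfun" and as bs :: "'a ratfun list"
  assumes "laurent_polynomial f"
    and "\<not> (pole_order_zero f > 0 \<and> CHAR('a) dvd pole_order_zero f)"
    and "\<not> (pole_order_infinity f > 0 \<and> CHAR('a) dvd pole_order_infinity f)"
    and "f = ratfun_compose_list as" and "\<forall>a\<in>set as. ratfun_degree a > 1 \<and> indecomposable a"
    and "f = ratfun_compose_list bs" and "\<forall>b\<in>set bs. ratfun_degree b > 1 \<and> indecomposable b"
  shows "length as = length bs \<and> mset (map ratfun_degree as) = mset (map ratfun_degree bs)"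
proof -
  have D: "decomp_degrees f (mset (map ratfun_degree as))" "decomp_degrees f (mset (map ratfun_degree bs))"
    using decomp_degrees_list[of as] decomp_degrees_list[of bs] assms(4-7) by auto
  have f1: "ratfun_degree f \<ge> 1" by (rule decomp_degrees_pos[OF D(1)])
  have "tame_up_to_mobius f"
  proof (cases "pole_order_infinity f > 0")
    case True
    thus ?thesis using tame_at_infinity[OF assms(1)] assms(3) tame_imp_tame_up_to_mobius by blast
  next
    case inf: False
    have "pole_order_zero f > 0"
    proof (rule ccontr)
      assume "\<not> ?thesis"
      hence "denom f = 1" using laurent_denom[OF assms(1)] by (simp add: monom_0 one_pCons)
      hence "ratfun_degree f = 0" using inf by (simp add: ratfun_degree_def pole_order_infinity_def)
      thus False using f1 by simp
    qed
    hence "tame_laurent (f \<circ>\<^sub>r inverse ratfun_X)" using tame_at_zero[OF assms(1)] assms(2) by blast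
    thus ?thesis unfolding tame_up_to_mobius_def using ratfun_degree_inverse_X by blast
  qed
  hence "unique_degrees f" by (rule tame_up_to_mobius_unique_degrees)
  hence eq: "mset (map ratfun_degree as) = mset (map ratfun_degree bs)" using D by (auto simp: unique_degrees_def)
  moreover have "length as = length bs" using arg_cong[OF eq, of size] by simp
  ultimately show ?thesis by blast
qed

end
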